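(* Let $E$ be a Banach space, let $F$ be an $(M_\infty)$-space, and let $n\ge1$. If $n<cd(E)$, then $\mathcal P_w(^nE,F)$ is an $M$-ideal in $\mathcal P(^nE,F)$.
   Context: $\mathcal P(^nE,F)$ is the Banach space of continuous $n$-homogeneous polynomials $P:E\to F$ with norm $\|P\|=\sup_{\|x\|\le1}\|P(x)\|$. $\mathcal P_w(^nE,F)$ is the subspace of polynomials that are weakly continuous on bounded sets: $\|P(x_\alpha)-P(x)\|\to0$ for every bounded net $(x_\alpha)$ converging weakly to $x\in E$. The critical degree $cd(E)$ is the smallest $k\ge1$ such that $\mathcal P_w(^kE,\mathbb K)\ne\mathcal P(^kE,\mathbb K)$, with $cd(E)=\infty$ if no such $k$ exists. A closed subspace $J$ of a Banach space $X$ is an $M$-ideal if there is a linear projection $\pi$ on $X^*$ with kernel $J^\perp$ such that $\|x^*\|=\|\pi(x^* )\|+\|x^*-\pi(x^* )\|$ for all $x^*\in X^*$. A Banach space $F$ is an $(M_\infty)$-space if the space of compact operators $\mathcal K(F\oplus_\infty F)$ is an $M$-ideal in the space of bounded operators $\mathcal L(F\oplus_\infty F)$, where $\oplus_\infty$ is the direct sum with maximum norm. *)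

theory Defs
  imports "HOL-Analysis.Analysis" "HOL-Library.Function_Algebras" "HOL-Library.Extended_Nat"
begin

section \<open>The scalar field\<close>

text \<open>The scalar field \<open>K\<close> is \<open>\<real>\<close> or \<open>\<complex>\<close>: a type \<open>'k\<close> isometrically isomorphic, as a normed field,
  to one of the two subfields \<open>\<real>\<close>, \<open>\<complex>\<close> of \<open>\<complex>\<close>.\<close>

class real_or_complex = real_normed_field +
  assumes real_or_complex:
    "\<exists>f :: 'a \<Rightarrow> complex. f 1 = 1 \<and> (\<forall>x y. f (x + y) = f x + f y) \<and> (\<forall>x y. f (x * y) = f x * f y)
      \<and> (\<forall>x. norm (f x) = norm x) \<and> (range f = \<real> \<or> range f = UNIV)"

instance real :: real_or_complex
proof
  show "\<exists>f :: real \<Rightarrow> complex. f 1 = 1 \<and> (\<forall>x y. f (x + y) = f x + f y) \<and> (\<forall>x y. f (x * y) = f x * f y)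
      \<and> (\<forall>x. norm (f x) = norm x) \<and> (range f = \<real> \<or> range f = UNIV)"
    by (rule exI[of _ complex_of_real]) (auto simp: Reals_def)
qed

instance complex :: real_or_complex
proof
  show "\<exists>f :: complex \<Rightarrow> complex. f 1 = 1 \<and> (\<forall>x y. f (x + y) = f x + f y) \<and> (\<forall>x y. f (x * y) = f x * f y)
      \<and> (\<forall>x. norm (f x) = norm x) \<and> (range f = \<real> \<or> range f = UNIV)"
    by (rule exI[of _ "\<lambda>x. x"]) auto
qed

text \<open>A Banach space over \<open>K\<close> is a type of class \<^class>\<open>banach\<close> together with a scalar
  multiplication \<open>s\<close> by \<open>K\<close> that is compatible with the norm and extends \<^const>\<open>scaleR\<close>.\<close>

locale scaling = vector_space s
  for s :: "'k::real_or_complex \<Rightarrow> 'a::real_normed_vector \<Rightarrow> 'a" +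
  assumes norm_scale: "norm (s c x) = norm c * norm x"
    and scale_of_real: "s (of_real r) x = r *\<^sub>R x"

lemma scaling_scaleR: "scaling (scaleR :: real \<Rightarrow> 'a::real_normed_vector \<Rightarrow> 'a)"
  by unfold_locales (auto simp: algebra_simps)

lemma scaling_mult: "scaling ((*) :: 'k::real_or_complex \<Rightarrow> 'k \<Rightarrow> 'k)"
  by unfold_locales (auto simp: algebra_simps norm_mult scaleR_conv_of_real)


section \<open>The direct sum with maximum norm\<close>

text \<open>The product type of the library carries the Euclidean norm, so a copy of it is needed.\<close>

typedef ('a, 'b) max_sum = "UNIV :: ('a \<times> 'b) set"
  by auto

instantiation max_sum :: (real_normed_vector, real_normed_vector) real_normed_vector
begin

definition "0 = Abs_max_sum 0"
definition "x + y = Abs_max_sum (Rep_max_sum x + Rep_max_sum y)"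
definition "x - y = Abs_max_sum (Rep_max_sum x - Rep_max_sum y)"
definition "- x = Abs_max_sum (- Rep_max_sum x)"
definition "r *\<^sub>R x = Abs_max_sum (r *\<^sub>R Rep_max_sum x)"
definition norm_max_sum_def:
  "norm x = max (norm (fst (Rep_max_sum x))) (norm (snd (Rep_max_sum x)))"
definition dist_max_sum_def: "dist x y = norm (x - y :: ('a, 'b) max_sum)"
definition sgn_max_sum_def: "sgn x = inverse (norm x) *\<^sub>R (x :: ('a, 'b) max_sum)"
definition uniformity_max_sum_def:
  "uniformity = (INF e\<in>{0<..}. principal {(x, y :: ('a, 'b) max_sum). dist x y < e})"
definition open_max_sum_def:
  "open (U :: ('a, 'b) max_sum set) \<longleftrightarrow> (\<forall>x\<in>U. eventually (\<lambda>(x', y). x' = x \<longrightarrow> y \<in> U) uniformity)"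

lemmas max_sum_ops = zero_max_sum_def plus_max_sum_def minus_max_sum_def uminus_max_sum_def
  scaleR_max_sum_def

lemma Rep_max_sum_simps:
  "Rep_max_sum 0 = 0" "Rep_max_sum (x + y) = Rep_max_sum x + Rep_max_sum y"
  "Rep_max_sum (x - y) = Rep_max_sum x - Rep_max_sum y" "Rep_max_sum (- x) = - Rep_max_sum x"
  "Rep_max_sum (r *\<^sub>R x) = r *\<^sub>R Rep_max_sum x"
  by (simp_all add: max_sum_ops Abs_max_sum_inverse)

instance
proof
  fix x y z :: "('a, 'b) max_sum" and a b :: real
  show "x + y + z = x + (y + z)" "x + y = y + x" "0 + x = x" "- x + x = 0" "x - y = x + - y"
    "a *\<^sub>R (x + y) = a *\<^sub>R x + a *\<^sub>R y" "(a + b) *\<^sub>R x = a *\<^sub>R x + b *\<^sub>R x"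
    "a *\<^sub>R b *\<^sub>R x = (a * b) *\<^sub>R x" "1 *\<^sub>R x = x"
    by (simp_all add: Rep_max_sum_inject[symmetric] Rep_max_sum_simps algebra_simps)
  show "norm x = 0 \<longleftrightarrow> x = 0"
    by (auto simp: norm_max_sum_def Rep_max_sum_inject[symmetric] Rep_max_sum_simps prod_eq_iff max_def)
  show "norm (x + y) \<le> norm x + norm y"
    by (auto simp: norm_max_sum_def Rep_max_sum_simps intro!: order_trans[OF norm_triangle_ineq] add_mono)
  show "norm (a *\<^sub>R x) = \<bar>a\<bar> * norm x"
    by (auto simp: norm_max_sum_def Rep_max_sum_simps max_mult_distrib_left)
qed (auto simp: dist_max_sum_def sgn_max_sum_def uniformity_max_sum_def open_max_sum_def)

end

instance max_sum :: (banach, banach) banach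
proof
  fix X :: "nat \<Rightarrow> ('a, 'b) max_sum"
  assume X: "Cauchy X"
  have le: "dist (fst (Rep_max_sum u)) (fst (Rep_max_sum v)) \<le> dist u v"
    "dist (snd (Rep_max_sum u)) (snd (Rep_max_sum v)) \<le> dist u v" for u v :: "('a, 'b) max_sum"
    by (auto simp: dist_max_sum_def norm_max_sum_def Rep_max_sum_simps dist_norm)
  have "Cauchy (\<lambda>n. fst (Rep_max_sum (X n)))" "Cauchy (\<lambda>n. snd (Rep_max_sum (X n)))"
    using X unfolding Cauchy_def by (blast intro: le_less_trans[OF le(1)] le_less_trans[OF le(2)])+
  then obtain a b where a: "(\<lambda>n. fst (Rep_max_sum (X n))) \<longlonglongrightarrow> a"
    and b: "(\<lambda>n. snd (Rep_max_sum (X n))) \<longlonglongrightarrow> b"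
    unfolding Cauchy_convergent_iff convergent_def by blast
  have "(\<lambda>n. max (dist (fst (Rep_max_sum (X n))) a) (dist (snd (Rep_max_sum (X n))) b)) \<longlonglongrightarrow> max 0 0"
    using tendsto_dist_iff[THEN iffD1, OF a] tendsto_dist_iff[THEN iffD1, OF b]
    by (rule tendsto_max)
  moreover have "dist (X n) (Abs_max_sum (a, b))
      = max (dist (fst (Rep_max_sum (X n))) a) (dist (snd (Rep_max_sum (X n))) b)" for n
    by (simp add: dist_max_sum_def norm_max_sum_def Rep_max_sum_simps dist_norm Abs_max_sum_inverse)
  ultimately have "X \<longlonglongrightarrow> Abs_max_sum (a, b)"
    by (subst tendsto_dist_iff) simp
  then show "convergent X"
    by (rule convergentI)
qed

definition max_sum_scale ::
  "('k \<Rightarrow> 'a \<Rightarrow> 'a) \<Rightarrow> ('k \<Rightarrow> 'b \<Rightarrow> 'b) \<Rightarrow> 'k \<Rightarrow> ('a, 'b) max_sum \<Rightarrow> ('a, 'b) max_sum"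
  where "max_sum_scale s t c z = Abs_max_sum (map_prod (s c) (t c) (Rep_max_sum z))"

lemma scaling_max_sum:
  fixes s :: "'k::real_or_complex \<Rightarrow> 'a::real_normed_vector \<Rightarrow> 'a"
    and t :: "'k \<Rightarrow> 'b::real_normed_vector \<Rightarrow> 'b"
  assumes "scaling s" "scaling t"
  shows "scaling (max_sum_scale s t)"
proof -
  interpret s: scaling s by fact
  interpret t: scaling t by fact
  show ?thesis
  proof
    fix a b :: 'k and x y :: "('a, 'b) max_sum" and r :: real
    note simps = max_sum_scale_def Rep_max_sum_inject[symmetric] Rep_max_sum_simps
      Abs_max_sum_inverse norm_max_sum_def prod_eq_iff
    show "max_sum_scale s t a (x + y) = max_sum_scale s t a x + max_sum_scale s t a y"
      by (simp add: simps s.scale_right_distrib t.scale_right_distrib)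
    show "max_sum_scale s t (a + b) x = max_sum_scale s t a x + max_sum_scale s t b x"
      by (simp add: simps s.scale_left_distrib t.scale_left_distrib)
    show "max_sum_scale s t a (max_sum_scale s t b x) = max_sum_scale s t (a * b) x"
      by (simp add: simps)
    show "max_sum_scale s t 1 x = x"
      by (simp add: simps)
    show "norm (max_sum_scale s t a x) = norm a * norm x"
      by (simp add: simps s.norm_scale t.norm_scale max_mult_distrib_left)
    show "max_sum_scale s t (of_real r) x = r *\<^sub>R x"
      by (simp add: simps s.scale_of_real t.scale_of_real)
  qed
qed


section \<open>\<open>M\<close>-ideals\<close>

text \<open>Spaces of maps such as \<open>\<P>(\<^sup>nE,F)\<close> or \<open>\<L>(E)\<close> are not types, so the notions below
  refer to a subset \<open>X\<close> of a vector space \<open>'a\<close> over \<open>K\<close> with scalar multiplication \<open>s\<close>,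
  and to a function \<open>N\<close> that is a norm on \<open>X\<close>. Values of \<open>N\<close> outside \<open>X\<close> are irrelevant.\<close>

locale normed_space_on = vector_space s
  for s :: "'k::real_or_complex \<Rightarrow> 'a::ab_group_add \<Rightarrow> 'a" and X :: "'a set" and N :: "'a \<Rightarrow> real" +
  assumes subspace_X: "module.subspace s X"
    and N_nonneg: "x \<in> X \<Longrightarrow> 0 \<le> N x"
    and N_eq_0: "x \<in> X \<Longrightarrow> N x = 0 \<longleftrightarrow> x = 0"
    and N_scale: "x \<in> X \<Longrightarrow> N (s c x) = norm c * N x"
    and N_triangle: "x \<in> X \<Longrightarrow> y \<in> X \<Longrightarrow> N (x + y) \<le> N x + N y"

locale banach_space_on = normed_space_on s X N
  for s :: "'k::real_or_complex \<Rightarrow> 'a::ab_group_add \<Rightarrow> 'a" and X :: "'a set" and N :: "'a \<Rightarrow> real" +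
  assumes complete_X:
    "(\<forall>i. u i \<in> X) \<Longrightarrow> (\<forall>e>0. \<exists>m::nat. \<forall>i\<ge>m. \<forall>j\<ge>m. N (u i - u j) < e) \<Longrightarrow>
      \<exists>x\<in>X. (\<lambda>i. N (u i - x)) \<longlonglongrightarrow> 0"

definition closed_subspace_on ::
  "('k::field \<Rightarrow> 'a::ab_group_add \<Rightarrow> 'a) \<Rightarrow> 'a set \<Rightarrow> ('a \<Rightarrow> real) \<Rightarrow> 'a set \<Rightarrow> bool"
  where "closed_subspace_on s X N J \<longleftrightarrow> J \<subseteq> X \<and> module.subspace s J \<and>
    (\<forall>(u :: nat \<Rightarrow> 'a) x. (\<forall>i. u i \<in> J) \<longrightarrow> x \<in> X \<longrightarrow> (\<lambda>i. N (u i - x)) \<longlonglongrightarrow> 0 \<longrightarrow> x \<in> J)"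

definition linear_map_on ::
  "('k \<Rightarrow> 'a \<Rightarrow> 'a) \<Rightarrow> ('k \<Rightarrow> 'b \<Rightarrow> 'b) \<Rightarrow> 'a::ab_group_add set \<Rightarrow> ('a \<Rightarrow> 'b::ab_group_add) \<Rightarrow> bool"
  where "linear_map_on s t X f \<longleftrightarrow>
    (\<forall>x\<in>X. \<forall>y\<in>X. f (x + y) = f x + f y) \<and> (\<forall>c. \<forall>x\<in>X. f (s c x) = t c (f x))"

text \<open>Pointwise scalar multiplication of functions; addition, zero and subtraction of functions are
  the pointwise ones from \<^theory>\<open>HOL-Library.Function_Algebras\<close>.\<close>

definition fun_scale :: "('k \<Rightarrow> 'b \<Rightarrow> 'b) \<Rightarrow> 'k \<Rightarrow> ('a \<Rightarrow> 'b) \<Rightarrow> 'a \<Rightarrow> 'b"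
  where "fun_scale s c f = (\<lambda>x. s c (f x))"

text \<open>A functional on \<open>X\<close> is represented by the function that extends it by \<open>0\<close> outside \<open>X\<close>.\<close>

definition dual_space ::
  "('k::real_or_complex \<Rightarrow> 'a::ab_group_add \<Rightarrow> 'a) \<Rightarrow> 'a set \<Rightarrow> ('a \<Rightarrow> real) \<Rightarrow> ('a \<Rightarrow> 'k) set"
  where "dual_space s X N = {f. linear_map_on s (*) X f \<and> (\<exists>C. \<forall>x\<in>X. norm (f x) \<le> C * N x) \<and>
    (\<forall>x. x \<notin> X \<longrightarrow> f x = 0)}"

definition dual_norm ::
  "'a set \<Rightarrow> ('a \<Rightarrow> real) \<Rightarrow> ('a \<Rightarrow> 'k::real_normed_vector) \<Rightarrow> real"
  where "dual_norm X N f = (SUP x\<in>{x\<in>X. N x \<le> 1}. norm (f x))"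

definition annihilator ::
  "('k::real_or_complex \<Rightarrow> 'a::ab_group_add \<Rightarrow> 'a) \<Rightarrow> 'a set \<Rightarrow> ('a \<Rightarrow> real) \<Rightarrow> 'a set \<Rightarrow> ('a \<Rightarrow> 'k) set"
  where "annihilator s X N J = {f \<in> dual_space s X N. \<forall>x\<in>J. f x = 0}"

definition M_ideal ::
  "('k::real_or_complex \<Rightarrow> 'a::ab_group_add \<Rightarrow> 'a) \<Rightarrow> 'a set \<Rightarrow> ('a \<Rightarrow> real) \<Rightarrow> 'a set \<Rightarrow> bool"
  where "M_ideal s X N J \<longleftrightarrow> banach_space_on s X N \<and> closed_subspace_on s X N J \<and>
    (\<exists>\<pi> :: ('a \<Rightarrow> 'k) \<Rightarrow> ('a \<Rightarrow> 'k).
      \<pi> ` dual_space s X N \<subseteq> dual_space s X N \<and>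
      linear_map_on (fun_scale (*)) (fun_scale (*)) (dual_space s X N) \<pi> \<and>
      (\<forall>f\<in>dual_space s X N. \<pi> (\<pi> f) = \<pi> f) \<and>
      {f \<in> dual_space s X N. \<pi> f = 0} = annihilator s X N J \<and>
      (\<forall>f\<in>dual_space s X N. dual_norm X N f = dual_norm X N (\<pi> f) + dual_norm X N (f - \<pi> f)))"


section \<open>Bounded and compact operators, \<open>(M\<^sub>\<infinity>)\<close>-spaces\<close>

definition bounded_ops :: "('k::field \<Rightarrow> 'a::real_normed_vector \<Rightarrow> 'a) \<Rightarrow> ('a \<Rightarrow> 'a) set"
  where "bounded_ops s = {T. Vector_Spaces.linear s s T \<and> bounded_linear T}"

definition compact_ops :: "('k::field \<Rightarrow> 'a::real_normed_vector \<Rightarrow> 'a) \<Rightarrow> ('a \<Rightarrow> 'a) set"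
  where "compact_ops s = {T \<in> bounded_ops s. compact (closure (T ` cball 0 1))}"

definition M_infinity_space :: "('k::real_or_complex \<Rightarrow> 'f::banach \<Rightarrow> 'f) \<Rightarrow> bool"
  where "M_infinity_space s \<longleftrightarrow>
    M_ideal (fun_scale (max_sum_scale s s)) (bounded_ops (max_sum_scale s s)) onorm
      (compact_ops (max_sum_scale s s))"


section \<open>Homogeneous polynomials and the critical degree\<close>

text \<open>An \<open>n\<close>-tuple in \<open>E\<^sup>n\<close> is a list of length \<open>n\<close>. Continuous \<open>n\<close>-homogeneous polynomials are
  the continuous maps \<open>x \<mapsto> A(x,\<dots>,x)\<close> with \<open>A\<close> an \<open>n\<close>-linear map.\<close>

definition multilinear_map ::
  "nat \<Rightarrow> ('k::field \<Rightarrow> 'e::ab_group_add \<Rightarrow> 'e) \<Rightarrow> ('k \<Rightarrow> 'f::ab_group_add \<Rightarrow> 'f) \<Rightarrow> ('e list \<Rightarrow> 'f) \<Rightarrow> bool"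
  where "multilinear_map n s t A \<longleftrightarrow>
    (\<forall>xs i. length xs = n \<longrightarrow> i < n \<longrightarrow> Vector_Spaces.linear s t (\<lambda>x. A (xs[i := x])))"

definition hom_polys ::
  "nat \<Rightarrow> ('k::field \<Rightarrow> 'e::real_normed_vector \<Rightarrow> 'e) \<Rightarrow> ('k \<Rightarrow> 'f::real_normed_vector \<Rightarrow> 'f) \<Rightarrow> ('e \<Rightarrow> 'f) set"
  where "hom_polys n s t =
    {P. continuous_on UNIV P \<and> (\<exists>A. multilinear_map n s t A \<and> (\<forall>x. P x = A (replicate n x)))}"

definition poly_norm :: "('e::real_normed_vector \<Rightarrow> 'f::real_normed_vector) \<Rightarrow> real"
  where "poly_norm P = (SUP x\<in>cball 0 1. norm (P x))"

definition weakly_tendsto ::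
  "('k::real_or_complex \<Rightarrow> 'e::real_normed_vector \<Rightarrow> 'e) \<Rightarrow> ('i \<Rightarrow> 'e) \<Rightarrow> 'e \<Rightarrow> 'i filter \<Rightarrow> bool"
  where "weakly_tendsto s g l F \<longleftrightarrow>
    (\<forall>\<phi> :: 'e \<Rightarrow> 'k. Vector_Spaces.linear s (*) \<phi> \<longrightarrow> bounded_linear \<phi> \<longrightarrow> ((\<lambda>i. \<phi> (g i)) \<longlongrightarrow> \<phi> l) F)"

text \<open>Convergence of nets is expressed by filters, which here live on \<open>E\<close> itself (the filter generated
  by the tails of the net), because a definition cannot quantify over index types. The lemma
  \<open>weakly_continuous_on_bounded_net\<close> below gives the version for nets over an arbitrary index type.\<close>

definition weakly_continuous_on_bounded ::
  "('k::real_or_complex \<Rightarrow> 'e::real_normed_vector \<Rightarrow> 'e) \<Rightarrow> ('e \<Rightarrow> 'f::real_normed_vector) \<Rightarrow> bool"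
  where "weakly_continuous_on_bounded s P \<longleftrightarrow>
    (\<forall>F B x. bounded B \<longrightarrow> eventually (\<lambda>y. y \<in> B) F \<longrightarrow> weakly_tendsto s (\<lambda>y. y) x F \<longrightarrow>
      ((\<lambda>y. norm (P y - P x)) \<longlongrightarrow> 0) F)"

lemma weakly_continuous_on_bounded_net:
  assumes "weakly_continuous_on_bounded s P" "bounded (range g)" "weakly_tendsto s g x F"
  shows "((\<lambda>i. norm (P (g i) - P x)) \<longlongrightarrow> 0) F"
proof -
  have "eventually (\<lambda>y. y \<in> range g) (filtermap g F)"
    by (simp add: eventually_filtermap)
  moreover have "weakly_tendsto s (\<lambda>y. y) x (filtermap g F)"
    using assms(3) by (simp add: weakly_tendsto_def filterlim_filtermap)
  ultimately have "((\<lambda>y. norm (P y - P x)) \<longlongrightarrow> 0) (filtermap g F)"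
    using assms(1,2) unfolding weakly_continuous_on_bounded_def by blast
  then show ?thesis
    by (simp add: filterlim_filtermap)
qed

definition wc_hom_polys ::
  "nat \<Rightarrow> ('k::real_or_complex \<Rightarrow> 'e::real_normed_vector \<Rightarrow> 'e) \<Rightarrow> ('k \<Rightarrow> 'f::real_normed_vector \<Rightarrow> 'f) \<Rightarrow> ('e \<Rightarrow> 'f) set"
  where "wc_hom_polys n s t = {P \<in> hom_polys n s t. weakly_continuous_on_bounded s P}"

definition critical_degree :: "('k::real_or_complex \<Rightarrow> 'e::real_normed_vector \<Rightarrow> 'e) \<Rightarrow> enat"
  where "critical_degree s =
    (if \<exists>k\<ge>1. wc_hom_polys k s ((*) :: 'k \<Rightarrow> 'k \<Rightarrow> 'k) \<noteq> hom_polys k s (*)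
     then enat (LEAST k. k \<ge> 1 \<and> wc_hom_polys k s ((*) :: 'k \<Rightarrow> 'k \<Rightarrow> 'k) \<noteq> hom_polys k s (*))
     else \<infinity>)"

end

theory Submission
  imports Defs
begin

text \<open>Uniqueness of the \<open>L\<close>-projection \<open>\<pi>\<close> with kernel \<open>\<K>(F \<oplus>\<^sub>\<infinity> F)\<^sup>\<bottom>\<close> makes \<open>\<pi>\<close> commute with the
  coordinate symmetries of \<open>F \<oplus>\<^sub>\<infinity> F\<close>, and \<open>\<pi>\<close> fixes the functionals \<open>S \<mapsto> \<psi> (S z)\<close>. A Hahn-Banach
  separation argument then yields compact operators \<open>K\<close> on \<open>F\<close> that almost fix finitely many given
  vectors and satisfy \<open>\<parallel>K x + (y - K y)\<parallel> \<le> (1 + \<epsilon>) max \<parallel>x\<parallel> \<parallel>y\<parallel>\<close>. Composition with such a net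
  \<open>K\<^sub>a\<close> sends every polynomial to a weakly continuous one because \<open>n < cd(E)\<close>, and \<open>K\<^sub>a \<circ> P\<close> tends
  to \<open>P\<close> in norm for weakly continuous \<open>P\<close> because \<open>P\<close> maps the unit ball to a totally bounded set.
  Hence \<open>\<pi> f (P) = lim\<^sub>a f (K\<^sub>a \<circ> P)\<close> is the required \<open>L\<close>-projection.\<close>

section \<open>The Hahn-Banach theorem\<close>

text \<open>Why the square of \<open>F\<close> enters: the bound on \<open>K x + (y - K y)\<close>
  with independent \<open>x\<close> and \<open>y\<close> says that the operator
  \<open>(x, y) \<mapsto> (K x + y - K y, 0)\<close> on the sum has norm at most
  \<open>1 + e\<close>. A functional \<open>f\<close> that separates such operators from small norms
  has to be tested at two operators at once, and the two halves of the identity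
  \<open>\<parallel>f\<parallel> = \<parallel>\<pi> f\<parallel> + \<parallel>f - \<pi>
  f\<parallel>\<close> allow this: \<open>\<pi> f\<close> is evaluated at the first coordinate
  projection, \<open>f - \<pi> f\<close> at that projection after the swap. Almost fixing finitely
  many vectors is made part of the same separation problem. A second obstacle is total boundedness.
  The unit ball of \<open>E\<close> need not be weakly compact, so weak continuity at each point
  does not by itself give a totally bounded image. The polynomial structure repairs this: induction
  on the degree upgrades pointwise weak continuity to uniform weak continuity on balls, and balls
  are always weakly totally bounded.\<close>

text \<open>Taking \<open>\<iota>\<close> to be the imaginary unit over the complex numbers and 0
  over the reals lets one recovery formula \<open>x = re x - \<iota> * re (\<iota> * x)\<close>
  serve both fields.\<close>

lemma real_or_complex_parts:
  obtains \<iota> :: "'k::real_or_complex" and re :: "'k \<Rightarrow> real"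
  where "\<iota> = 0 \<or> \<iota> * \<iota> = -1" "norm \<iota> \<le> 1" "re \<iota> = 0"
    "\<And>x y. re (x + y) = re x + re y" "\<And>t x. re (of_real t * x) = t * re x"
    "\<And>x. \<bar>re x\<bar> \<le> norm x" "\<And>t. re (of_real t) = t"
    "\<And>x. x = of_real (re x) - \<iota> * of_real (re (\<iota> * x))"
proof -
  obtain h :: "'k \<Rightarrow> complex" where h1: "h 1 = 1" and add: "\<And>x y. h (x + y) = h x + h y"
    and mult: "\<And>x y. h (x * y) = h x * h y" and nrm: "\<And>x. norm (h x) = norm x"
    and rng: "range h = \<real> \<or> range h = UNIV"
    using real_or_complex[where ?'a = 'k] by blast
  have diff: "h (x - y) = h x - h y" for x y
    using add[of "x - y" y] by simp
  have h0: "h 0 = 0" using nrm[of 0] by simp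
  have inj: "x = y" if "h x = h y" for x y
    using nrm[of "x - y"] that by (simp add: diff)
  \<comment> \<open>Real linearity of \<open>h\<close> is not among its given properties. It follows
    because the distances of \<open>h (of_real t)\<close> from 0 and from 1 are
    \<open>\<bar>t\<bar>\<close> and \<open>\<bar>t - 1\<bar>\<close>, and \<open>t\<close> is the
    only such complex number.\<close>
  have h_real: "h (of_real t) = of_real t" for t
  proof -
    define z where "z = h (of_real t)"
    have a: "(norm z)\<^sup>2 = t\<^sup>2"
      by (simp add: z_def nrm)
    have "norm (z - 1) = norm (of_real t - 1 :: 'k)"
      by (simp add: z_def nrm flip: h1 diff)
    also have "\<dots> = \<bar>t - 1\<bar>"
      by (metis norm_of_real of_real_1 of_real_diff)
    finally have b: "(norm (z - 1))\<^sup>2 = (t - 1)\<^sup>2"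
      by simp
    have "Re z = t"
      using a b unfolding cmod_power2 by (simp add: power2_eq_square algebra_simps)
    then have "Im z = 0"
      using a by (simp add: cmod_power2)
    with \<open>Re z = t\<close> show ?thesis
      by (simp add: complex_eq_iff z_def)
  qed
  define re where "re x = Re (h x)" for x
  have re: "re (x + y) = re x + re y" "re (of_real t * x) = t * re x" "\<bar>re x\<bar> \<le> norm x" "re (of_real t) = t"
    for x y t
    using abs_Re_le_cmod[of "h x"] by (simp_all add: re_def add mult h_real nrm)
  from rng show ?thesis
  proof
    assume r: "range h = \<real>"
    have "x = of_real (re x)" for x
    proof (rule inj)
      have "h x \<in> \<real>" using r by auto
      then show "h x = h (of_real (re x))"
        by (simp add: h_real re_def)
    qed
    then show ?thesis
      using re by (intro that[of 0 re]) (auto simp: re_def h0)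
  next
    assume "range h = UNIV"
    then obtain \<iota> where i: "h \<iota> = \<i>"
      by (metis rangeE UNIV_I)
    have "x = of_real (re x) - \<iota> * of_real (re (\<iota> * x))" for x
      by (rule inj) (simp add: diff add mult h_real i re_def complex_eq_iff)
    moreover have "\<iota> * \<iota> = - 1"
      by (rule inj) (simp add: mult i diff[of 0 1, simplified] h1 h0)
    moreover have "norm \<iota> = 1" using nrm[of \<iota>] by (simp add: i)
    ultimately show ?thesis
      using re by (intro that[of \<iota> re]) (auto simp: re_def i)
  qed
qed

text \<open>Heine-Borel for the abstract field: by the recovery formula the ball is a closed part of
  the continuous image of a compact square.\<close>

lemma compact_cball_scalar: "compact (cball (0::'k::real_or_complex) R)"
proof -
  obtain \<iota> :: 'k and re where i: "norm \<iota> \<le> 1" and re: "\<And>x. \<bar>re x\<bar> \<le> norm x"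
    and dec: "\<And>x. x = of_real (re x) - \<iota> * of_real (re (\<iota> * x))"
    by (rule real_or_complex_parts[where ?'k = 'k]) (rule that, assumption+)
  let ?S = "(\<lambda>(a, b). of_real a - \<iota> * of_real b) ` ({-R..R} \<times> {-R..R})"
  have "compact ?S"
    by (intro compact_continuous_image compact_Times compact_Icc)
      (auto simp: case_prod_unfold intro!: continuous_intros)
  moreover have "cball 0 R \<subseteq> ?S"
  proof
    fix x :: 'k assume "x \<in> cball 0 R"
    then have x: "norm x \<le> R" by simp
    have "norm (\<iota> * x) \<le> norm x"
      using i by (simp add: norm_mult mult_left_le_one_le)
    then have "(re x, re (\<iota> * x)) \<in> {-R..R} \<times> {-R..R}"
      using x re[of x] re[of "\<iota> * x"] by (auto simp: abs_le_iff)
    then show "x \<in> ?S"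
      using dec[of x] by (intro image_eqI[where x = "(re x, re (\<iota> * x))"]) auto
  qed
  ultimately show ?thesis
    by (metis closed_cball compact_Int_closed inf.absorb_iff2)
qed

text \<open>The space is a subset \<open>X\<close> of a type because the result is applied to spaces
  of operators and of maps. Partial extensions are handled as graphs, so that an upper bound of a
  chain is simply its union.\<close>

lemma real_hahn_banach:
  fixes r :: "real \<Rightarrow> 'a::ab_group_add \<Rightarrow> 'a"
  assumes "vector_space r" and X: "module.subspace r X" and W: "module.subspace r W" "W \<subseteq> X"
    and p_add: "\<And>x y. x \<in> X \<Longrightarrow> y \<in> X \<Longrightarrow> p (x + y) \<le> p x + p y"
    and p_scale: "\<And>t x. x \<in> X \<Longrightarrow> t > 0 \<Longrightarrow> p (r t x) = t * p x"
    and f_add: "\<And>x y. x \<in> W \<Longrightarrow> y \<in> W \<Longrightarrow> f (x + y) = f x + f y"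
    and f_scale: "\<And>t x. x \<in> W \<Longrightarrow> f (r t x) = t * f x"
    and f_le: "\<And>x. x \<in> W \<Longrightarrow> f x \<le> p x"
  obtains g where "\<And>x y. x \<in> X \<Longrightarrow> y \<in> X \<Longrightarrow> g (x + y) = g x + g y"
    "\<And>t x. x \<in> X \<Longrightarrow> g (r t x) = t * g x" "\<And>x. x \<in> X \<Longrightarrow> g x \<le> p x"
    "\<And>x. x \<in> W \<Longrightarrow> g x = (f x :: real)"
proof -
  interpret vector_space r by fact
  note X_closed = subspace_0[OF X] subspace_add[OF X] subspace_scale[OF X] subspace_diff[OF X] subspace_neg[OF X]
  \<comment> \<open>Single-valuedness is not part of \<open>good\<close>: if \<open>(x, t)\<close>
    and \<open>(x, u)\<close> are in \<open>G\<close>, then so is \<open>(0, t - u)\<close>, and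
    domination by \<open>p\<close> with \<open>p 0 = 0\<close> yields \<open>t = u\<close> (see
    \<open>uniq\<close>).\<close>
  define good where "good G \<longleftrightarrow> (\<forall>z\<in>G. fst z \<in> X \<and> snd z \<le> p (fst z)) \<and> (0, 0) \<in> G \<and>
    (\<forall>a\<in>G. \<forall>b\<in>G. (fst a + fst b, snd a + snd b) \<in> G) \<and>
    (\<forall>t. \<forall>a\<in>G. (r t (fst a), t * snd a) \<in> G)" for G :: "('a \<times> real) set"
  define A where "A = {G. good G \<and> (\<lambda>x. (x, f x)) ` W \<subseteq> G}"
  have "(\<lambda>x. (x, f x)) ` W \<in> A"
    using W f_le f_scale[OF subspace_0[OF W(1)], of 0]
    by (auto simp: A_def good_def image_iff subspace_0 f_add f_scale subspace_add subspace_scale)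
  then have "A \<noteq> {}" by auto
  moreover have "\<Union>C \<in> A" if C: "C \<noteq> {}" "subset.chain A C" for C
  proof -
    have CA: "C \<subseteq> A" and lin: "\<And>G H. G \<in> C \<Longrightarrow> H \<in> C \<Longrightarrow> G \<subseteq> H \<or> H \<subseteq> G"
      using C(2) by (auto simp: subset.chain_def)
    have gd: "good G" "(\<lambda>x. (x, f x)) ` W \<subseteq> G" if "G \<in> C" for G
      using CA that by (auto simp: A_def)
    have add: "(fst a + fst b, snd a + snd b) \<in> \<Union>C" if "a \<in> G" "b \<in> H" "G \<in> C" "H \<in> C" for a b G H
    proof -
      obtain K where "K \<in> C" "a \<in> K" "b \<in> K" using lin[OF \<open>G \<in> C\<close> \<open>H \<in> C\<close>] \<open>a \<in> G\<close> \<open>b \<in> H\<close> \<open>G \<in> C\<close> \<open>H \<in> C\<close>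
        by (meson subsetD)
      then show ?thesis using gd(1)[of K] by (auto simp: good_def)
    qed
    have zero: "(0, 0) \<in> \<Union>C"
      using C(1) gd(1) by (auto simp: good_def)
    have ext: "(\<lambda>x. (x, f x)) ` W \<subseteq> \<Union>C"
      using C(1) gd(2) by blast
    have le: "fst z \<in> X \<and> snd z \<le> p (fst z)" if "z \<in> \<Union>C" for z
      using that gd(1) unfolding good_def by blast
    have scale: "(r t (fst z), t * snd z) \<in> \<Union>C" if "z \<in> \<Union>C" for z t
      using that gd(1) unfolding good_def by blast
    show ?thesis
      unfolding A_def good_def mem_Collect_eq
    proof (intro conjI ballI allI)
      fix a b assume "a \<in> \<Union>C" "b \<in> \<Union>C"
      then show "(fst a + fst b, snd a + snd b) \<in> \<Union>C" using add by blast
    qed (use le zero scale ext in \<open>simp_all only:\<close>)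
  qed
  ultimately obtain G where GA: "G \<in> A" and maxG: "\<And>H. H \<in> A \<Longrightarrow> G \<subseteq> H \<Longrightarrow> H = G"
    using subset_Zorn_nonempty[of A] by blast
  have G: "good G" and GW: "\<And>x. x \<in> W \<Longrightarrow> (x, f x) \<in> G"
    using GA by (auto simp: A_def)
  have GX: "x \<in> X" and Gp: "t \<le> p x" if "(x, t) \<in> G" for x t
    using G that by (auto simp: good_def)
  have G0: "(0, 0) \<in> G" using G by (simp add: good_def)
  have Gadd: "(x + y, t + u) \<in> G" if "(x, t) \<in> G" "(y, u) \<in> G" for x y t u
    using G that unfolding good_def by fastforce
  have Gscale: "(r c x, c * t) \<in> G" if "(x, t) \<in> G" for x t c
    using G that unfolding good_def by fastforce
  have p0: "p 0 = 0"
    using p_scale[of 0 2] X_closed(1) by simp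
  have uniq: "t = u" if "(x, t) \<in> G" "(x, u) \<in> G" for x t u
  proof -
    have "(x + r (-1) x, t + (-1) * u) \<in> G" "(x + r (-1) x, u + (-1) * t) \<in> G"
      by (rule Gadd[OF that(1) Gscale[OF that(2)]], rule Gadd[OF that(2) Gscale[OF that(1)]])
    then have "t - u \<le> p 0" "u - t \<le> p 0" using Gp by fastforce+
    with p0 show ?thesis by simp
  qed
  have dom: "\<exists>t. (x, t) \<in> G" if xX: "x \<in> X" for x
  proof (rule ccontr)
    assume nx: "\<nexists>t. (x, t) \<in> G"
    \<comment> \<open>An admissible value \<open>a\<close> at the new vector \<open>x\<close> must
      lie above every \<open>t - p (y - x)\<close> and below every \<open>p (z + x) - u\<close>. By
      \<open>key\<close> the supremum of the lower bounds qualifies.\<close>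
    let ?L = "(\<lambda>z. snd z - p (fst z - x)) ` G"
    have key: "t - p (y - x) \<le> p (z + x) - u" if "(y, t) \<in> G" "(z, u) \<in> G" for y z t u
    proof -
      have "t + u \<le> p ((y - x) + (z + x))" using Gp[OF Gadd[OF that]] by (simp add: algebra_simps)
      also have "\<dots> \<le> p (y - x) + p (z + x)"
        using that GX xX X_closed by (intro p_add) auto
      finally show ?thesis by simp
    qed
    define a where "a = Sup ?L"
    have bdd: "bdd_above ?L"
      by (rule bdd_aboveI[of _ "p (0 + x) - 0"]) (use key[OF _ G0] in auto)
    have lo: "t - p (y - x) \<le> a" if "(y, t) \<in> G" for y t
      unfolding a_def by (rule cSUP_upper2[OF bdd that]) simp
    have up: "a \<le> p (z + x) - u" if "(z, u) \<in> G" for z u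
      unfolding a_def using G0 key[OF _ that] by (intro cSup_least) auto
    define H where "H = {(y + r c x, t + c * a) | y t c. (y, t) \<in> G}"
    have "t + c * a \<le> p (y + r c x)" if yt: "(y, t) \<in> G" for y t c
    proof -
      \<comment> \<open>Dividing by \<open>\<bar>c\<bar>\<close> reduces the bound to
        \<open>up\<close> for positive \<open>c\<close> and to \<open>lo\<close> for negative
        \<open>c\<close>.\<close>
      consider "c = 0" | "c > 0" | "c < 0" by linarith
      then show ?thesis
      proof cases
        case 1 then show ?thesis using Gp[OF yt] by simp
      next
        case 2
        have "c * a \<le> c * (p (r (1/c) y + x) - (1/c) * t)"
          using up[OF Gscale[OF yt, of "1/c"]] 2 by (intro mult_left_mono) auto
        also have "\<dots> = p (r c (r (1/c) y + x)) - t"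
          using 2 GX[OF yt] xX by (subst p_scale) (auto simp: X_closed algebra_simps)
        finally show ?thesis using 2 by (simp add: scale_right_distrib)
      next
        case 3
        have "t - p (y + r c x) = t - p (r (-c) (r (1/(-c)) y - x))"
          using 3 by (simp add: scale_right_diff_distrib)
        also have "\<dots> = (-c) * ((1/(-c)) * t - p (r (1/(-c)) y - x))"
          using 3 GX[OF yt] xX by (subst p_scale) (auto simp: X_closed algebra_simps)
        also have "\<dots> \<le> (-c) * a"
          using lo[OF Gscale[OF yt, of "1/(-c)"]] 3 by (intro mult_left_mono) auto
        finally show ?thesis by simp
      qed
    qed
    then have "good H"
      unfolding good_def
    proof (intro conjI ballI allI)
      fix z assume "z \<in> H" then show "fst z \<in> X"
        using GX xX X_closed by (auto simp: H_def)
    next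
      show "(0, 0) \<in> H" using G0 unfolding H_def by force
    next
      fix z w assume "z \<in> H" "w \<in> H"
      then obtain y t c y' t' c' where "(y, t) \<in> G" "(y', t') \<in> G"
        "z = (y + r c x, t + c * a)" "w = (y' + r c' x, t' + c' * a)"
        unfolding H_def by blast
      then show "(fst z + fst w, snd z + snd w) \<in> H"
        unfolding H_def
        by (intro CollectI exI[of _ "y + y'"] exI[of _ "t + t'"] exI[of _ "c + c'"])
          (auto simp: algebra_simps Gadd)
    next
      fix k z assume "z \<in> H"
      then obtain y t c where "(y, t) \<in> G" "z = (y + r c x, t + c * a)"
        unfolding H_def by blast
      then show "(r k (fst z), k * snd z) \<in> H"
        unfolding H_def
        by (intro CollectI exI[of _ "r k y"] exI[of _ "k * t"] exI[of _ "k * c"])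
          (auto simp: algebra_simps Gscale)
    qed (auto simp: H_def)
    moreover have "G \<subseteq> H"
    proof
      fix z assume "z \<in> G"
      then show "z \<in> H" unfolding H_def
        by (intro CollectI exI[of _ "fst z"] exI[of _ "snd z"] exI[of _ 0]) auto
    qed
    ultimately have "H = G"
      using GA by (intro maxG) (auto simp: A_def)
    moreover have "(x, a) \<in> H"
      unfolding H_def by (intro CollectI exI[of _ 0] exI[of _ 0] exI[of _ 1]) (use G0 in auto)
    ultimately show False using nx by blast
  qed
  define g where "g x = (THE t. (x, t) \<in> G)" for x
  have g_eq: "g x = t" if "(x, t) \<in> G" for x t
    unfolding g_def using that uniq by blast
  have gG: "(x, g x) \<in> G" if "x \<in> X" for x
    using dom[OF that] g_eq by blast
  show ?thesis
  proof (rule that[of g])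
    show "g (x + y) = g x + g y" if "x \<in> X" "y \<in> X" for x y
      using that by (intro g_eq Gadd gG)
    show "g (r t x) = t * g x" if "x \<in> X" for x t
      using that by (intro g_eq Gscale gG)
    show "g x \<le> p x" if "x \<in> X" for x
      using Gp[OF gG[OF that]] .
    show "g x = f x" if "x \<in> W" for x
      using g_eq[OF GW[OF that]] .
  qed
qed

text \<open>A linear functional is determined by its real part, so it suffices to extend
  \<open>re \<circ> f\<close> and to rebuild the functional from the extension.\<close>

lemma hahn_banach:
  fixes s :: "'k::real_or_complex \<Rightarrow> 'a::ab_group_add \<Rightarrow> 'a"
  assumes "vector_space s" and X: "module.subspace s X" and W: "module.subspace s W" "W \<subseteq> X"
    and p_add: "\<And>x y. x \<in> X \<Longrightarrow> y \<in> X \<Longrightarrow> p (x + y) \<le> p x + p y"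
    and p_scale: "\<And>c x. x \<in> X \<Longrightarrow> p (s c x) = norm c * p x"
    and f: "linear_map_on s (*) W f" and f_le: "\<And>x. x \<in> W \<Longrightarrow> norm (f x) \<le> p x"
  obtains g where "linear_map_on s (*) X g" "\<And>x. x \<in> X \<Longrightarrow> norm (g x) \<le> p x"
    "\<And>x. x \<in> W \<Longrightarrow> g x = f x"
proof -
  interpret vector_space s by fact
  obtain \<iota> :: 'k and re where i: "\<iota> = 0 \<or> \<iota> * \<iota> = -1" and re_i: "re \<iota> = 0"
    and re_add: "\<And>x y. re (x + y) = re x + re y" and re_scale: "\<And>t x. re (of_real t * x) = t * re x"
    and re_le: "\<And>x. \<bar>re x\<bar> \<le> norm x" and re_real: "\<And>t. re (of_real t) = t"
    and dec: "\<And>x. x = of_real (re x) - \<iota> * of_real (re (\<iota> * x))"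
    by (rule real_or_complex_parts[where ?'k = 'k]) (rule that, assumption+)
  have f_add: "f (x + y) = f x + f y" and f_scale: "f (s c x) = c * f x" if "x \<in> W" "y \<in> W" for x y c
    using f that by (auto simp: linear_map_on_def)
  define r where "r t = s (of_real t)" for t
  have r: "vector_space r"
    by unfold_locales (simp_all add: r_def algebra_simps)
  have sub: "module.subspace r Y" if "module.subspace s Y" for Y
  proof -
    interpret r: vector_space r by (rule r)
    show ?thesis using that by (simp add: subspace_def r.subspace_def r_def)
  qed
  obtain g where g_add: "\<And>x y. x \<in> X \<Longrightarrow> y \<in> X \<Longrightarrow> g (x + y) = g x + g y"
    and g_scale: "\<And>t x. x \<in> X \<Longrightarrow> g (r t x) = t * g x"
    and g_le: "\<And>x. x \<in> X \<Longrightarrow> g x \<le> p x" and g_f: "\<And>x. x \<in> W \<Longrightarrow> g x = re (f x)"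
  proof (rule real_hahn_banach[OF r sub[OF X] sub[OF W(1)] W(2), of p "\<lambda>x. re (f x)"])
    show "re (f x) \<le> p x" if "x \<in> W" for x
      using re_le[of "f x"] f_le[OF that] by linarith
  qed (auto simp: p_add p_scale f_add f_scale re_add re_scale r_def)
  note X_closed = subspace_0[OF X] subspace_add[OF X] subspace_scale[OF X]
  have g_scale': "g (s (of_real t) x) = t * g x" if "x \<in> X" for t x
    using g_scale[OF that] by (simp add: r_def)
  have g0: "g 0 = 0" using g_scale'[of 0 0] X_closed by simp
  \<comment> \<open>The real part of \<open>F\<close> is \<open>g\<close>. Over the reals
    \<open>\<iota>\<close> is 0 and \<open>F\<close> is just \<open>g\<close>.\<close>
  define F where "F x = of_real (g x) - \<iota> * of_real (g (s \<iota> x))" for x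
  have F_add: "F (x + y) = F x + F y" if "x \<in> X" "y \<in> X" for x y
    using that by (simp add: F_def g_add X_closed scale_right_distrib algebra_simps)
  have F_real: "F (s (of_real t) x) = of_real t * F x" if "x \<in> X" for x t
  proof -
    have "s \<iota> (s (of_real t) x) = s (of_real t) (s \<iota> x)" by (simp add: mult.commute)
    then show ?thesis
      using that by (simp add: F_def g_scale' X_closed algebra_simps del: scale_scale)
  qed
  have F_i: "F (s \<iota> x) = \<iota> * F x" if "x \<in> X" for x
    using i
  proof
    assume "\<iota> = 0" then show ?thesis using that g0 by (simp add: F_def)
  next
    assume ii: "\<iota> * \<iota> = -1"
    have "g (s (\<iota> * \<iota>) x) = - g x"
      using g_scale'[OF that, of "-1"] by (simp add: ii)
    then show ?thesis
      using ii by (simp add: F_def right_diff_distrib flip: mult.assoc)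
  qed
  have F_scale: "F (s c x) = c * F x" if "x \<in> X" for c x
  proof -
    define a b where "a = re c" and "b = - re (\<iota> * c)"
    have c: "c = of_real a + of_real b * \<iota>"
      using dec[of c] by (simp add: a_def b_def mult.commute)
    have "s c x = s (of_real a) x + s (of_real b) (s \<iota> x)"
      by (simp add: c scale_left_distrib)
    then have "F (s c x) = of_real a * F x + of_real b * (\<iota> * F x)"
      using that by (simp add: F_add F_real F_i X_closed del: scale_scale)
    then show ?thesis by (simp add: c algebra_simps)
  qed
  have re_diff: "re (x - y) = re x - re y" for x y
    using re_add[of "x - y" y] by simp
  have re_F: "re (F x) = g x" for x
    using re_scale[of "g (s \<iota> x)" \<iota>] by (simp add: F_def re_diff re_real re_i mult.commute)
  have F_le: "norm (F x) \<le> p x" if "x \<in> X" for x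
  proof (cases "F x = 0")
    case True
    have "0 \<le> p x"
    proof -
      have "p (0 :: 'a) = 0" using p_scale[of 0 0] X_closed by simp
      moreover have "p (x + s (-1) x) \<le> p x + p x"
        using p_add[of x "s (-1) x"] p_scale[of x "-1"] that X_closed(3)[of x "-1"] by simp
      ultimately show ?thesis by simp
    qed
    with True show ?thesis by simp
  next
    case False
    \<comment> \<open>A unimodular factor rotates \<open>F x\<close> to the nonnegative reals, where
      it coincides with a value of \<open>g\<close>.\<close>
    define u where "u = of_real (norm (F x)) / F x"
    have "norm u = 1" using False by (simp add: u_def norm_divide)
    have "F (s u x) = of_real (norm (F x))"
      using False that by (simp add: F_scale u_def)
    then have "norm (F x) = g (s u x)"
      using re_F[of "s u x"] by (simp add: re_real)
    also have "\<dots> \<le> p (s u x)" using that by (intro g_le X_closed)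
    finally show ?thesis using \<open>norm u = 1\<close> that by (simp add: p_scale)
  qed
  show ?thesis
  proof (rule that[of F])
    show "linear_map_on s (*) X F"
      by (auto simp: linear_map_on_def F_add F_scale)
    show "F x = f x" if "x \<in> W" for x
      using that g_f[of x] g_f[of "s \<iota> x"] dec[of "f x"]
      by (simp add: F_def f_scale subspace_scale[OF W(1)])
  qed (rule F_le)
qed

text \<open>The functional to extend sends \<open>s c v + w\<close> to \<open>c * d\<close>. It is
  well defined since \<open>v \<in> W\<close> would give \<open>d \<le> p 0 = 0\<close> by
  \<open>far\<close>, and it is dominated by \<open>p\<close> because \<open>far\<close> can be
  scaled by \<open>c\<close>.\<close>

lemma hahn_banach_separation:
  fixes s :: "'k::real_or_complex \<Rightarrow> 'a::ab_group_add \<Rightarrow> 'a"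
  assumes "vector_space s" and X: "module.subspace s X" and W: "module.subspace s W" "W \<subseteq> X"
    and p_add: "\<And>x y. x \<in> X \<Longrightarrow> y \<in> X \<Longrightarrow> p (x + y) \<le> p x + p y"
    and p_scale: "\<And>c x. x \<in> X \<Longrightarrow> p (s c x) = norm c * p x"
    and v: "v \<in> X" and d: "0 < d" and far: "\<And>w. w \<in> W \<Longrightarrow> d \<le> p (v + w)"
  obtains g where "linear_map_on s (*) X g" "\<And>x. x \<in> X \<Longrightarrow> norm (g x) \<le> p x"
    "\<And>x. x \<in> W \<Longrightarrow> g x = 0" "g v = of_real d"
proof -
  interpret vector_space s by fact
  note Wc = subspace_0[OF W(1)] subspace_add[OF W(1)] subspace_scale[OF W(1)] subspace_diff[OF W(1)] subspace_neg[OF W(1)]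
  note Xc = subspace_0[OF X] subspace_add[OF X] subspace_scale[OF X] subspace_neg[OF X]
  have p0: "p 0 = 0" using p_scale[of 0 0] Xc by simp
  have vW: "c = 0" if "s c v \<in> W" for c
  proof (rule ccontr)
    assume "c \<noteq> 0"
    then have "- v \<in> W" using Wc(3)[OF that, of "- inverse c"] by simp
    then show False using far[of "- v"] p0 d by simp
  qed
  have uniq: "c = c'" if "s c v + w = s c' v + w'" "w \<in> W" "w' \<in> W" for c c' w w'
  proof -
    have "s (c - c') v = w' - w" using that(1) by (simp add: scale_left_diff_distrib algebra_simps)
    then have "s (c - c') v \<in> W" using that Wc by simp
    then show ?thesis using vW by force
  qed
  define V where "V = {s c v + w |c w. w \<in> W}"
  define f where "f x = of_real d * (THE c. \<exists>w\<in>W. x = s c v + w)" for x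
  have f: "f (s c v + w) = of_real d * c" if "w \<in> W" for c w
  proof -
    have "(THE c'. \<exists>w'\<in>W. s c v + w = s c' v + w') = c"
      by (rule the_equality) (use that uniq in blast)+
    then show ?thesis by (simp add: f_def)
  qed
  have V_add: "(s c v + w) + (s c' v + w') = s (c + c') v + (w + w')" for c c' w w'
    by (simp add: algebra_simps)
  have V_scale: "s k (s c v + w) = s (k * c) v + s k w" for k c w
    by (simp add: scale_right_distrib)
  have "subspace V"
    unfolding subspace_def
  proof (intro conjI ballI allI)
    show "0 \<in> V" unfolding V_def by (intro CollectI exI[of _ 0]) (auto simp: Wc)
    show "x + y \<in> V" if "x \<in> V" "y \<in> V" for x y
      using that V_add Wc(2) unfolding V_def by blast
    show "s c x \<in> V" if "x \<in> V" for x c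
      using that V_scale Wc(3) unfolding V_def by blast
  qed
  moreover have "V \<subseteq> X" using v W Xc by (auto simp: V_def)
  moreover have "linear_map_on s (*) V f"
    unfolding linear_map_on_def
  proof (intro conjI ballI allI)
    show "f (x + y) = f x + f y" if "x \<in> V" "y \<in> V" for x y
    proof -
      obtain c w c' w' where "x = s c v + w" "w \<in> W" "y = s c' v + w'" "w' \<in> W"
        using \<open>x \<in> V\<close> \<open>y \<in> V\<close> unfolding V_def by blast
      then show ?thesis by (simp only: V_add f Wc distrib_left)
    qed
    show "f (s k x) = k * f x" if "x \<in> V" for k x
    proof -
      obtain c w where "x = s c v + w" "w \<in> W"
        using \<open>x \<in> V\<close> unfolding V_def by blast
      then show ?thesis by (simp only: V_scale f Wc mult.left_commute)
    qed
  qed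
  moreover have "norm (f x) \<le> p x" if "x \<in> V" for x
  proof -
    obtain c w where x: "x = s c v + w" "w \<in> W" using \<open>x \<in> V\<close> unfolding V_def by blast
    show ?thesis
    proof (cases "c = 0")
      case True
      \<comment> \<open>A seminorm is nonnegative:
        \<open>0 = p (w - w) \<le> 2 * p w\<close>.\<close>
      have "w \<in> X" "s (-1) w \<in> X" using x W Xc by auto
      then have "0 \<le> p w"
        using p_add[of w "s (-1) w"] p_scale[of w "-1"] p0 by simp
      then show ?thesis using x True f[OF x(2), of c] by simp
    next
      case False
      have "x = s c (v + s (inverse c) w)" using False by (simp add: x scale_right_distrib)
      moreover have "v + s (inverse c) w \<in> X" using v x W Xc by auto
      ultimately have "p x = norm c * p (v + s (inverse c) w)" using p_scale by metis
      also have "\<dots> \<ge> norm c * d" using x by (intro mult_left_mono far Wc) auto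
      finally show ?thesis using f[OF x(2), of c] x d by (simp add: norm_mult mult.commute)
    qed
  qed
  ultimately obtain g where g: "linear_map_on s (*) X g" "\<And>x. x \<in> X \<Longrightarrow> norm (g x) \<le> p x"
    "\<And>x. x \<in> V \<Longrightarrow> g x = f x"
    using hahn_banach[OF \<open>vector_space s\<close> X, of V p f] p_add p_scale by blast
  show ?thesis
  proof (rule that[of g])
    show "g x = 0" if "x \<in> W" for x
    proof -
      have "x \<in> V" unfolding V_def using that by (intro CollectI exI[of _ 0] exI[of _ x]) auto
      then show ?thesis using g(3) f[OF that, of 0] by simp
    qed
    have "v \<in> V" unfolding V_def by (intro CollectI exI[of _ 1] exI[of _ 0]) (auto simp: Wc)
    then show "g v = of_real d" using g(3) f[OF Wc(1), of 1] by simp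
  qed (use g in auto)
qed

section \<open>Projections on the dual space\<close>

lemma unimodular_norm:
  fixes z :: "'k::real_normed_field"
  obtains u where "norm u = 1" "u * z = of_real (norm z)"
proof (cases "z = 0")
  case True then show ?thesis by (intro that[of 1]) auto
next
  case False
  then show ?thesis by (intro that[of "of_real (norm z) / z"]) (auto simp: norm_divide)
qed

section \<open>The dual of a normed space that is given as a subset of a type\<close>

context normed_space_on
begin

lemmas X_closed = subspace_0[OF subspace_X] subspace_add[OF subspace_X] subspace_scale[OF subspace_X]
  subspace_diff[OF subspace_X] subspace_neg[OF subspace_X]

lemma N_0: "N 0 = 0"
  using N_eq_0[of 0] X_closed by simp

lemma linear_bound:
  assumes "linear_map_on s (*) X h" "\<And>x. x \<in> X \<Longrightarrow> N x \<le> 1 \<Longrightarrow> norm (h x) \<le> c" "x \<in> X"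
  shows "norm (h x) \<le> c * N x"
proof (cases "x = 0")
  case True
  have "h (s 0 0) = 0 * h 0"
    using assms(1) X_closed(1) unfolding linear_map_on_def by blast
  then show ?thesis using True by (simp add: N_0)
next
  case False
  then have Nx: "N x > 0" using N_nonneg[OF assms(3)] N_eq_0[OF assms(3)] by simp
  define k :: 'k where "k = of_real (1 / N x)"
  have nk: "norm k = 1 / N x" using Nx by (simp add: k_def norm_divide)
  have "norm (h (s k x)) \<le> c"
    using Nx nk by (intro assms(2)) (simp_all add: X_closed N_scale assms(3))
  moreover have "h (s k x) = k * h x" using assms(1,3) by (auto simp: linear_map_on_def)
  ultimately show ?thesis using Nx nk by (simp add: norm_mult field_simps)
qed

abbreviation "D \<equiv> dual_space s X N"

lemma dual_add: "f \<in> D \<Longrightarrow> x \<in> X \<Longrightarrow> y \<in> X \<Longrightarrow> f (x + y) = f x + f y"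
  and dual_scale: "f \<in> D \<Longrightarrow> x \<in> X \<Longrightarrow> f (s c x) = c * f x"
  and dual_outside: "f \<in> D \<Longrightarrow> x \<notin> X \<Longrightarrow> f x = 0"
  by (auto simp: dual_space_def linear_map_on_def)

lemma dual_diff: "f \<in> D \<Longrightarrow> x \<in> X \<Longrightarrow> y \<in> X \<Longrightarrow> f (x - y) = f x - f y"
  using dual_add[of f "x - y" y] X_closed by simp

lemma dualI:
  assumes "linear_map_on s (*) X f" "\<And>x. x \<in> X \<Longrightarrow> norm (f x) \<le> C * N x" "\<And>x. x \<notin> X \<Longrightarrow> f x = 0"
  shows "f \<in> D"
  using assms by (auto simp: dual_space_def)

lemma dual_bdd: "f \<in> D \<Longrightarrow> bdd_above ((\<lambda>x. norm (f x)) ` {x \<in> X. N x \<le> 1})"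
proof -
  assume "f \<in> D"
  then obtain C where C: "\<And>x. x \<in> X \<Longrightarrow> norm (f x) \<le> C * N x" by (auto simp: dual_space_def)
  have "norm (f x) \<le> \<bar>C\<bar>" if "x \<in> X" "N x \<le> 1" for x
  proof -
    have "C * N x \<le> \<bar>C\<bar> * 1" using that N_nonneg by (intro mult_mono) auto
    with C[OF that(1)] show ?thesis by simp
  qed
  then show ?thesis by (auto intro!: bdd_aboveI[of _ "\<bar>C\<bar>"])
qed

lemma dual_norm_ge: "f \<in> D \<Longrightarrow> x \<in> X \<Longrightarrow> N x \<le> 1 \<Longrightarrow> norm (f x) \<le> dual_norm X N f"
  unfolding dual_norm_def by (rule cSUP_upper[OF _ dual_bdd]) auto

lemma dual_norm_nonneg: "f \<in> D \<Longrightarrow> 0 \<le> dual_norm X N f"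
  using dual_norm_ge[of f 0] N_0 X_closed by (auto intro: order_trans[OF norm_ge_zero])

lemma dual_norm_apply: "f \<in> D \<Longrightarrow> x \<in> X \<Longrightarrow> norm (f x) \<le> dual_norm X N f * N x"
  by (rule linear_bound) (auto intro: dual_norm_ge, simp add: dual_space_def)

lemma dual_norm_le:
  assumes "\<And>x. x \<in> X \<Longrightarrow> N x \<le> 1 \<Longrightarrow> norm (f x) \<le> c"
  shows "dual_norm X N f \<le> c"
  unfolding dual_norm_def using assms X_closed N_0 by (intro cSUP_least) auto

lemma dual_norm_le_0:
  assumes "f \<in> D" "dual_norm X N f \<le> 0" shows "f = 0"
proof
  fix x
  show "f x = 0 x"
  proof (cases "x \<in> X")
    case True
    have "dual_norm X N f * N x \<le> 0" using assms(2) N_nonneg[OF True] by (rule mult_nonpos_nonneg)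
    then show ?thesis using dual_norm_apply[OF assms(1) True] by (metis norm_le_zero_iff order_trans zero_fun_apply)
  qed (simp add: dual_outside[OF assms(1)])
qed

lemma dual_diff_closed:
  assumes "f \<in> D" "g \<in> D" shows "f - g \<in> D"
proof (rule dualI)
  show "linear_map_on s (*) X (f - g)"
    using assms by (simp add: linear_map_on_def dual_add dual_scale algebra_simps)
  show "norm ((f - g) x) \<le> (dual_norm X N f + dual_norm X N g) * N x" if "x \<in> X" for x
    using norm_triangle_ineq4[of "f x" "g x"] dual_norm_apply[OF assms(1) that] dual_norm_apply[OF assms(2) that]
    by (simp add: algebra_simps)
qed (use assms in \<open>auto simp: dual_outside\<close>)

lemma dual_add_closed:
  assumes "f \<in> D" "g \<in> D" shows "f + g \<in> D"
proof (rule dualI)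
  show "linear_map_on s (*) X (f + g)"
    using assms by (simp add: linear_map_on_def dual_add dual_scale algebra_simps)
  show "norm ((f + g) x) \<le> (dual_norm X N f + dual_norm X N g) * N x" if "x \<in> X" for x
    using norm_triangle_ineq[of "f x" "g x"] dual_norm_apply[OF assms(1) that] dual_norm_apply[OF assms(2) that]
    by (simp add: algebra_simps)
qed (use assms in \<open>auto simp: dual_outside\<close>)

lemma dual_scale_closed:
  assumes "f \<in> D" shows "fun_scale (*) c f \<in> D"
proof (rule dualI)
  show "linear_map_on s (*) X (fun_scale (*) c f)"
    using assms by (simp add: linear_map_on_def fun_scale_def dual_add dual_scale algebra_simps)
  show "norm (fun_scale (*) c f x) \<le> (norm c * dual_norm X N f) * N x" if "x \<in> X" for x
    using dual_norm_apply[OF assms(1) that] mult_left_mono[OF _ norm_ge_zero[of c]]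
    by (fastforce simp: norm_mult fun_scale_def mult.assoc)
qed (use assms in \<open>auto simp: dual_outside fun_scale_def\<close>)

lemma dual_norm_triangle:
  assumes "f \<in> D" "g \<in> D" shows "dual_norm X N (f + g) \<le> dual_norm X N f + dual_norm X N g"
  using assms by (intro dual_norm_le) (auto intro!: order_trans[OF norm_triangle_ineq] add_mono dual_norm_ge)

text \<open>Functionals are extended by 0 outside \<open>X\<close>, so \<open>\<Phi>\<close> must
  also send the complement of \<open>X\<close> to itself. Being an involution that preserves
  \<open>X\<close>, it does.\<close>

lemma dual_comp:
  assumes "h \<in> D" and lin: "linear_map_on s s X \<Phi>" and inv: "\<And>x. \<Phi> (\<Phi> x) = x"
    and XX: "\<And>x. x \<in> X \<Longrightarrow> \<Phi> x \<in> X" and iso: "\<And>x. x \<in> X \<Longrightarrow> N (\<Phi> x) = N x"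
  shows "(\<lambda>x. h (\<Phi> x)) \<in> D"
proof (rule dualI)
  show "linear_map_on s (*) X (\<lambda>x. h (\<Phi> x))"
    using lin XX assms(1) by (simp add: linear_map_on_def dual_add dual_scale)
  show "norm (h (\<Phi> x)) \<le> dual_norm X N h * N x" if "x \<in> X" for x
    using dual_norm_apply[OF \<open>h \<in> D\<close> XX[OF that]] by (simp add: iso that)
  show "h (\<Phi> x) = 0" if "x \<notin> X" for x
    using that inv[of x] XX[of "\<Phi> x"] dual_outside[OF \<open>h \<in> D\<close>] by metis
qed

end

section \<open>The L-projection that belongs to an M-ideal\<close>

locale M_projection = normed_space_on s X N
  for s :: "'k::real_or_complex \<Rightarrow> 'a::ab_group_add \<Rightarrow> 'a" and X N +
  fixes J :: "'a set" and \<pi> :: "('a \<Rightarrow> 'k) \<Rightarrow> 'a \<Rightarrow> 'k"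
  assumes J_sub: "J \<subseteq> X"
    and pi_D: "\<pi> ` dual_space s X N \<subseteq> dual_space s X N"
    and pi_lin: "linear_map_on (fun_scale (*)) (fun_scale (*)) (dual_space s X N) \<pi>"
    and pi_idem: "\<forall>f\<in>dual_space s X N. \<pi> (\<pi> f) = \<pi> f"
    and pi_ker: "{f \<in> dual_space s X N. \<pi> f = 0} = annihilator s X N J"
    and pi_norm: "\<forall>f\<in>dual_space s X N.
      dual_norm X N f = dual_norm X N (\<pi> f) + dual_norm X N (f - \<pi> f)"
begin

lemma pi_closed: "f \<in> D \<Longrightarrow> \<pi> f \<in> D"
  using pi_D by auto

lemma pi_add: "f \<in> D \<Longrightarrow> g \<in> D \<Longrightarrow> \<pi> (f + g) = \<pi> f + \<pi> g"
  and pi_scale: "f \<in> D \<Longrightarrow> \<pi> (fun_scale (*) c f) = fun_scale (*) c (\<pi> f)"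
  using pi_lin by (auto simp: linear_map_on_def)

lemma pi_diff: "f \<in> D \<Longrightarrow> g \<in> D \<Longrightarrow> \<pi> (f - g) = \<pi> f - \<pi> g"
  using pi_add[of "f - g" g] dual_diff_closed[of f g] by simp

text \<open>By idempotence \<open>f - \<pi> f\<close> lies in the kernel of \<open>\<pi>\<close>,
  which is the annihilator of \<open>J\<close>.\<close>

lemma pi_on_J: "f \<in> D \<Longrightarrow> x \<in> J \<Longrightarrow> \<pi> f x = f x"
proof -
  assume f: "f \<in> D" and x: "x \<in> J"
  have "\<pi> (f - \<pi> f) = 0" using f pi_idem by (simp add: pi_diff pi_closed)
  then have "f - \<pi> f \<in> annihilator s X N J"
    unfolding pi_ker[symmetric] using f by (simp add: dual_diff_closed pi_closed)
  then show ?thesis using x by (auto simp: annihilator_def)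
qed

lemma pi_annihilator: "f \<in> D \<Longrightarrow> (\<And>x. x \<in> J \<Longrightarrow> f x = 0) \<Longrightarrow> \<pi> f = 0"
  using pi_ker by (auto simp: annihilator_def)

text \<open>If \<open>\<pi>\<close> does not decrease the norm of \<open>k\<close>, the additive
  norm identity leaves nothing for \<open>k - \<pi> k\<close>.\<close>

lemma pi_fix:
  assumes "k \<in> D" "dual_norm X N k \<le> dual_norm X N (\<pi> k)"
  shows "\<pi> k = k"
proof -
  have "k - \<pi> k = 0"
    using assms pi_norm by (intro dual_norm_le_0 dual_diff_closed pi_closed) auto
  then show ?thesis by simp
qed

lemma pi_norm_le: "f \<in> D \<Longrightarrow> dual_norm X N (\<pi> f) \<le> dual_norm X N f"
  using pi_norm dual_norm_nonneg[OF dual_diff_closed[OF _ pi_closed], of f f] by auto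

text \<open>This is the form in which the M-ideal property enters the construction of compact
  operators: the two parts of \<open>f\<close> may be tested at different vectors of the unit ball,
  at no extra cost.\<close>

lemma pi_split_le:
  assumes "f \<in> D" "x \<in> X" "N x \<le> 1" "y \<in> X" "N y \<le> 1"
  shows "norm (f x - \<pi> f x + \<pi> f y) \<le> dual_norm X N f"
proof -
  have "norm (f x - \<pi> f x) \<le> dual_norm X N (f - \<pi> f)" "norm (\<pi> f y) \<le> dual_norm X N (\<pi> f)"
    using dual_norm_ge[of "f - \<pi> f" x] dual_norm_ge[of "\<pi> f" y] assms
    by (simp_all add: dual_diff_closed pi_closed)
  then show ?thesis
    using pi_norm assms(1) norm_triangle_ineq[of "f x - \<pi> f x" "\<pi> f y"] by auto
qed

text \<open>An \<open>L\<close>-projection is determined by its kernel, so it commutes with the isometries that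
  preserve \<open>J\<close>; involutions suffice here.\<close>

lemma pi_commute:
  assumes f: "f \<in> D" and lin: "linear_map_on s s X \<Phi>" and inv: "\<And>x. \<Phi> (\<Phi> x) = x"
    and XX: "\<And>x. x \<in> X \<Longrightarrow> \<Phi> x \<in> X" and iso: "\<And>x. x \<in> X \<Longrightarrow> N (\<Phi> x) = N x"
    and JJ: "\<And>x. x \<in> J \<Longrightarrow> \<Phi> x \<in> J"
  shows "\<pi> (\<lambda>x. f (\<Phi> x)) = (\<lambda>x. \<pi> f (\<Phi> x))"
proof -
  note cl = dual_comp[OF _ lin inv XX iso]
  have le: "dual_norm X N (\<lambda>x. h (\<Phi> x)) \<le> dual_norm X N h" if "h \<in> D" for h
    using that by (intro dual_norm_le dual_norm_ge) (auto simp: iso XX)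
  define g where "g = \<pi> f"
  define k where "k = (\<lambda>x. g (\<Phi> x))"
  \<comment> \<open>On \<open>J\<close>, where \<open>\<pi> k\<close> agrees with \<open>k\<close>,
    composing twice with \<open>\<Phi>\<close> gives back \<open>g\<close>. Hence
    \<open>\<pi> m = g\<close>, and the chain of norms below runs from \<open>k\<close> to
    \<open>\<pi> k\<close>, which forces \<open>\<pi> k = k\<close>.\<close>
  define m where "m = (\<lambda>x. \<pi> k (\<Phi> x))"
  have D: "g \<in> D" "k \<in> D" "m \<in> D" "\<pi> k \<in> D"
    using f by (simp_all add: g_def k_def m_def cl pi_closed)
  have "\<pi> (m - g) = 0"
    using D by (intro pi_annihilator dual_diff_closed)
      (auto simp: m_def pi_on_J JJ k_def inv)
  then have mg: "\<pi> m = g"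
    using D pi_idem f by (simp add: pi_diff g_def)
  have "dual_norm X N k \<le> dual_norm X N g" unfolding k_def by (rule le) fact
  also have "\<dots> \<le> dual_norm X N m" using pi_norm_le[of m] D mg by simp
  also have "\<dots> \<le> dual_norm X N (\<pi> k)" unfolding m_def by (rule le) fact
  finally have k: "\<pi> k = k" using D by (intro pi_fix)
  have "\<pi> ((\<lambda>x. f (\<Phi> x)) - k) = 0"
    using D cl[OF f] by (intro pi_annihilator dual_diff_closed)
      (auto simp: k_def g_def pi_on_J JJ f)
  then show ?thesis
    using D cl[OF f] k by (simp add: pi_diff k_def g_def)
qed

end

lemma M_ideal_projection:
  assumes "M_ideal s X N J"
  obtains \<pi> where "M_projection s X N J \<pi>"
proof -
  obtain \<pi> where pi: "\<pi> ` dual_space s X N \<subseteq> dual_space s X N"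
      "linear_map_on (fun_scale (*)) (fun_scale (*)) (dual_space s X N) \<pi>"
      "\<forall>f\<in>dual_space s X N. \<pi> (\<pi> f) = \<pi> f"
      "{f \<in> dual_space s X N. \<pi> f = 0} = annihilator s X N J"
      "\<forall>f\<in>dual_space s X N. dual_norm X N f = dual_norm X N (\<pi> f) + dual_norm X N (f - \<pi> f)"
    and J: "J \<subseteq> X" and "banach_space_on s X N"
    using assms unfolding M_ideal_def closed_subspace_on_def by blast
  interpret banach_space_on s X N by fact
  have "M_projection s X N J \<pi>"
    by unfold_locales (fact J pi)+
  then show ?thesis by (rule that)
qed

text \<open>The projection is \<open>\<pi> f = lim\<^sub>a f \<circ> T\<^sub>a\<close>. The limit exists: \<open>f\<close> and a norm preserving
  extension \<open>g\<close> of its restriction to \<open>J\<close> agree on the range of \<open>T\<^sub>a\<close>, and the estimate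
  \<open>\<parallel>g \<circ> T\<^sub>a\<parallel> + \<parallel>g - g \<circ> T\<^sub>a\<parallel> \<le> (1 + e\<^sub>a) \<parallel>g\<parallel>\<close> forces \<open>g \<circ> T\<^sub>a \<longlonglongrightarrow> g\<close>.\<close>

theorem M_ideal_from_net:
  fixes s :: "'k::real_or_complex \<Rightarrow> 'a::ab_group_add \<Rightarrow> 'a" and T :: "'i \<Rightarrow> 'a \<Rightarrow> 'a"
  assumes "banach_space_on s X N" and J: "closed_subspace_on s X N J" and "F \<noteq> bot"
    and T_lin: "\<And>a. linear_map_on s s X (T a)" and TJ: "\<And>a x. x \<in> X \<Longrightarrow> T a x \<in> J"
    and est: "\<And>a x y. x \<in> X \<Longrightarrow> y \<in> X \<Longrightarrow> N x \<le> 1 \<Longrightarrow> N y \<le> 1 \<Longrightarrow> N (T a x + (y - T a y)) \<le> 1 + e a"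
    and e: "(e \<longlongrightarrow> 0) F"
    and conv: "\<And>x. x \<in> J \<Longrightarrow> ((\<lambda>a. N (T a x - x)) \<longlongrightarrow> 0) F"
  shows "M_ideal s X N J"
proof -
  interpret banach_space_on s X N by fact
  have JX: "J \<subseteq> X" and subJ: "subspace J"
    using J by (auto simp: closed_subspace_on_def)
  have TX: "T a x \<in> X" if "x \<in> X" for a x using TJ that JX by blast
  have T_add: "T a (x + y) = T a x + T a y" and T_scale: "T a (s c x) = s c (T a x)"
    if "x \<in> X" "y \<in> X" for a x y c
    using T_lin that by (auto simp: linear_map_on_def)
  have est': "norm (f (T a x)) + norm (f (y - T a y)) \<le> c * (1 + e a)"
    if f: "linear_map_on s (*) X f" "\<And>x. x \<in> X \<Longrightarrow> norm (f x) \<le> c * N x" and "0 \<le> c"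
      and xy: "x \<in> X" "y \<in> X" "N x \<le> 1" "N y \<le> 1" for f a x y c
  proof -
    have f_add: "f (x + y) = f x + f y" and f_scale: "f (s c x) = c * f x" if "x \<in> X" "y \<in> X" for x y c
      using f that by (auto simp: linear_map_on_def)
    \<comment> \<open>The unimodular factors make both values nonnegative, so their sum is the value
      of \<open>f\<close> at a single vector to which \<open>est\<close> applies.\<close>
    obtain u where u: "norm u = 1" "u * f (T a x) = of_real (norm (f (T a x)))"
      by (rule unimodular_norm)
    obtain w where w: "norm w = 1" "w * f (y - T a y) = of_real (norm (f (y - T a y)))"
      by (rule unimodular_norm)
    have ux: "s u x \<in> X" "s w y \<in> X" "N (s u x) \<le> 1" "N (s w y) \<le> 1"
      using xy u w by (simp_all add: X_closed N_scale)
    let ?z = "T a (s u x) + (s w y - T a (s w y))"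
    have "?z = s u (T a x) + s w (y - T a y)"
      using xy by (simp add: T_scale scale_right_diff_distrib)
    then have "f ?z = u * f (T a x) + w * f (y - T a y)"
      using xy by (simp add: f_add f_scale X_closed TX)
    also have "\<dots> = of_real (norm (f (T a x)) + norm (f (y - T a y)))" by (simp add: u w)
    finally have eq: "f ?z = of_real (norm (f (T a x)) + norm (f (y - T a y)))" .
    have "norm (f (T a x)) + norm (f (y - T a y)) = norm (f ?z)"
      unfolding eq norm_of_real by simp
    also have "\<dots> \<le> c * N ?z" using ux xy by (intro f X_closed TX)
    also have "\<dots> \<le> c * (1 + e a)" using ux \<open>0 \<le> c\<close> by (intro mult_left_mono est)
    finally show ?thesis .
  qed
  have conv_f: "((\<lambda>a. f (T a x)) \<longlongrightarrow> f x) F" if "f \<in> D" "x \<in> J" for f x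
  proof -
    have "((\<lambda>a. f (T a x) - f x) \<longlongrightarrow> 0) F"
    proof (rule Lim_null_comparison)
      show "((\<lambda>a. dual_norm X N f * N (T a x - x)) \<longlongrightarrow> 0) F"
        using tendsto_mult_right_zero[OF conv[OF that(2)]] .
      have "norm (f (T a x) - f x) \<le> dual_norm X N f * N (T a x - x)" for a
        using that JX TX by (subst dual_diff[symmetric]) (auto intro!: dual_norm_apply X_closed)
      then show "\<forall>\<^sub>F a in F. norm (f (T a x) - f x) \<le> dual_norm X N f * N (T a x - x)" by simp
    qed
    then show ?thesis by (simp add: LIM_zero_cancel)
  qed
  have lim_ex: "\<exists>L. ((\<lambda>a. f (T a x)) \<longlongrightarrow> L) F" if f: "f \<in> D" and x: "x \<in> X" for f x
  proof -
    interpret J: normed_space_on s J N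
      using JX subJ N_nonneg N_eq_0 N_scale N_triangle by unfold_locales blast+
    define f' where "f' x = (if x \<in> J then f x else 0)" for x
    have f': "f' \<in> J.D"
      using f JX J.X_closed
      by (intro J.dualI[where C = "dual_norm X N f"])
        (auto simp: f'_def linear_map_on_def dual_add dual_scale subset_iff intro: dual_norm_apply)
    define c where "c = dual_norm J N f'"
    have c0: "0 \<le> c" using J.dual_norm_nonneg[OF f'] by (simp add: c_def)
    obtain g where g: "linear_map_on s (*) X g" "\<And>x. x \<in> X \<Longrightarrow> norm (g x) \<le> c * N x"
      "\<And>x. x \<in> J \<Longrightarrow> g x = f' x"
    proof (rule hahn_banach[OF vector_space_axioms subspace_X subJ JX, of "\<lambda>x. c * N x" f'])
      show "linear_map_on s (*) J f'" using f' by (auto simp: dual_space_def)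
      show "norm (f' x) \<le> c * N x" if "x \<in> J" for x
        using J.dual_norm_apply[OF f' that] by (simp add: c_def)
      show "c * N (x + y) \<le> c * N x + c * N y" if "x \<in> X" "y \<in> X" for x y
        using c0 N_triangle[OF that] by (simp add: mult_left_mono flip: distrib_left)
    qed (auto simp: N_scale)
    have g_f: "g (T a x) = f (T a x)" if "x \<in> X" for a x
      using TJ that g(3) by (simp add: f'_def)
    have g_add: "g (x + y) = g x + g y" and g_scale: "g (s c x) = c * g x" if "x \<in> X" "y \<in> X" for x y c
      using g that by (auto simp: linear_map_on_def)
    have unit: "((\<lambda>a. g (x - T a x)) \<longlongrightarrow> 0) F" if x: "x \<in> X" "N x \<le> 1" for x
    proof (rule tendstoI)
      fix r :: real assume r: "r > 0"
      \<comment> \<open>The vector \<open>y\<close> of the unit ball of \<open>J\<close> almost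
        norms the restriction of \<open>f\<close>. Since \<open>f (T a y)\<close> tends to
        \<open>f y\<close>, it eventually uses up all but \<open>r / 2\<close> of \<open>c\<close>
        in \<open>est'\<close>. Together with \<open>c * e a < r / 2\<close> this leaves less than
        \<open>r\<close> for \<open>g (x - T a x)\<close>.\<close>
      have "c - r / 2 < (SUP x\<in>{x\<in>J. N x \<le> 1}. norm (f' x))"
        using r by (simp add: c_def dual_norm_def)
      then obtain y where y: "y \<in> J" "N y \<le> 1" "c - r / 2 < norm (f' y)"
        using J.X_closed J.N_0 by (subst (asm) less_cSUP_iff) (auto intro: J.dual_bdd[OF f'])
      have "((\<lambda>a. norm (f (T a y))) \<longlongrightarrow> norm (f y)) F"
        using conv_f[OF f y(1)] by (rule tendsto_norm)
      moreover have "c - r / 2 < norm (f y)" using y by (simp add: f'_def)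
      ultimately have "\<forall>\<^sub>F a in F. c - r / 2 < norm (f (T a y))"
        by (rule order_tendstoD)
      moreover have "\<forall>\<^sub>F a in F. c * e a < r / 2"
        using tendsto_mult_right_zero[OF e, of c] r by (intro order_tendstoD) auto
      ultimately show "\<forall>\<^sub>F a in F. dist (g (x - T a x)) 0 < r"
      proof eventually_elim
        case (elim a)
        have "norm (g (T a y)) + norm (g (x - T a x)) \<le> c * (1 + e a)"
          using x y JX c0 by (intro est' g) auto
        with elim show ?case using g_f[of y a] y JX by (auto simp: distrib_left)
      qed
    qed
    \<comment> \<open>The summand 1 keeps the scaling factor nonzero at
      \<open>x = 0\<close>.\<close>
    define k :: 'k where "k = of_real (1 + N x)"
    have k: "norm k = 1 + N x" "k \<noteq> 0" using N_nonneg[OF x] unfolding k_def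
      by (simp_all only: norm_of_real of_real_eq_0_iff)
    define z where "z = s (inverse k) x"
    have z: "z \<in> X" "N z \<le> 1" "x = s k z"
      using x k N_nonneg[OF x] by (simp_all add: z_def X_closed N_scale norm_inverse norm_divide field_simps)
    have "((\<lambda>a. k * g (z - T a z)) \<longlongrightarrow> k * 0) F"
      by (intro tendsto_mult_left unit z)
    moreover have "k * g (z - T a z) = g x - f (T a x)" for a
    proof -
      have "g x = g (x - T a x) + g (T a x)" using x by (subst g_add[symmetric]) (auto simp: X_closed TX)
      moreover have "g (x - T a x) = k * g (z - T a z)"
        using z by (simp add: T_scale g_scale X_closed TX flip: scale_right_diff_distrib)
      ultimately show ?thesis using x by (simp add: g_f)
    qed
    ultimately have "((\<lambda>a. g x - (g x - f (T a x))) \<longlongrightarrow> g x - 0) F"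
      by (intro tendsto_diff tendsto_const) simp
    then show ?thesis by auto
  qed
  define \<pi> where "\<pi> f x = (if x \<in> X then Lim F (\<lambda>a. f (T a x)) else 0)" for f :: "'a \<Rightarrow> 'k" and x
  have lim: "((\<lambda>a. f (T a x)) \<longlongrightarrow> \<pi> f x) F" if "f \<in> D" "x \<in> X" for f x
    using lim_ex[OF that] tendsto_Lim[OF \<open>F \<noteq> bot\<close>] that by (auto simp: \<pi>_def)
  have pi_eq: "\<pi> f x = L" if "f \<in> D" "x \<in> X" "((\<lambda>a. f (T a x)) \<longlongrightarrow> L) F" for f x L
    using tendsto_unique[OF \<open>F \<noteq> bot\<close> lim] that by blast
  \<comment> \<open>In the limit of \<open>est'\<close> the vectors \<open>x\<close> and
    \<open>y\<close> are still independent, so taking suprema separately gives the nontrivial half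
    of the norm identity.\<close>
  have split: "norm (\<pi> f x) + norm (f y - \<pi> f y) \<le> dual_norm X N f"
    if f: "f \<in> D" and xy: "x \<in> X" "y \<in> X" "N x \<le> 1" "N y \<le> 1" for f x y
  proof (rule tendsto_le[OF \<open>F \<noteq> bot\<close>])
    show "((\<lambda>a. dual_norm X N f * (1 + e a)) \<longlongrightarrow> dual_norm X N f) F"
      using tendsto_mult_left[OF tendsto_add[OF tendsto_const[of 1] e], of "dual_norm X N f"] by simp
    show "((\<lambda>a. norm (f (T a x)) + norm (f y - f (T a y))) \<longlongrightarrow> norm (\<pi> f x) + norm (f y - \<pi> f y)) F"
      using f xy by (intro tendsto_intros lim)
    have "norm (f (T a x)) + norm (f y - f (T a y)) \<le> dual_norm X N f * (1 + e a)" for a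
      using est'[of f "dual_norm X N f" x y a] f xy dual_norm_apply dual_norm_nonneg
      by (auto simp: dual_diff TX dual_space_def)
    then show "\<forall>\<^sub>F a in F. norm (f (T a x)) + norm (f y - f (T a y)) \<le> dual_norm X N f * (1 + e a)"
      by simp
  qed
  have pi_D: "\<pi> f \<in> D" if f: "f \<in> D" for f
  proof -
    have "((\<lambda>a. f (T a (x + y))) \<longlongrightarrow> \<pi> f x + \<pi> f y) F" if "x \<in> X" "y \<in> X" for x y
      using tendsto_add[OF lim[OF f that(1)] lim[OF f that(2)]] f that
      by (simp add: T_add dual_add TX)
    moreover have "((\<lambda>a. f (T a (s c x))) \<longlongrightarrow> c * \<pi> f x) F" if "x \<in> X" for x c
      using tendsto_mult_left[OF lim[OF f that], of c] f that by (simp add: T_scale dual_scale TX)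
    ultimately have lin: "linear_map_on s (*) X (\<pi> f)"
      unfolding linear_map_on_def by (auto intro!: pi_eq f X_closed)
    show ?thesis
    proof (rule dualI[OF lin linear_bound[OF lin]])
      show "norm (\<pi> f x) \<le> dual_norm X N f" if "x \<in> X" "N x \<le> 1" for x
        using split[OF f that(1) X_closed(1) that(2)] N_0 norm_ge_zero[of "f 0 - \<pi> f 0"] by linarith
    qed (auto simp: \<pi>_def)
  qed
  have pi_J: "\<pi> f x = f x" if "f \<in> D" "x \<in> J" for f x
    using that JX by (intro pi_eq conv_f) auto
  \<comment> \<open>Since \<open>T a\<close> maps into \<open>J\<close>, the limit sees only the
    restriction of the functional to \<open>J\<close>. Idempotence follows because
    \<open>\<pi> f\<close> and \<open>f\<close> agree there.\<close>
  have pi_cong: "\<pi> f = \<pi> g" if "f \<in> D" "g \<in> D" "\<And>x. x \<in> J \<Longrightarrow> f x = g x" for f g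
    using that TJ by (auto simp: \<pi>_def fun_eq_iff)
  have "dual_norm X N f = dual_norm X N (\<pi> f) + dual_norm X N (f - \<pi> f)" if f: "f \<in> D" for f
  proof (rule antisym)
    show "dual_norm X N f \<le> dual_norm X N (\<pi> f) + dual_norm X N (f - \<pi> f)"
      using dual_norm_triangle[OF pi_D[OF f] dual_diff_closed[OF f pi_D[OF f]]] by simp
    have "dual_norm X N (\<pi> f) \<le> dual_norm X N f - norm (f y - \<pi> f y)" if "y \<in> X" "N y \<le> 1" for y
      using split[OF f _ that(1) _ that(2)] by (intro dual_norm_le) (simp add: le_diff_eq)
    then have "dual_norm X N (f - \<pi> f) \<le> dual_norm X N f - dual_norm X N (\<pi> f)"
      by (intro dual_norm_le) (fastforce simp: algebra_simps)
    then show "dual_norm X N (\<pi> f) + dual_norm X N (f - \<pi> f) \<le> dual_norm X N f" by simp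
  qed
  moreover have "linear_map_on (fun_scale (*)) (fun_scale (*)) D \<pi>"
    unfolding linear_map_on_def
  proof (intro conjI ballI allI ext)
    show "\<pi> (f + g) x = (\<pi> f + \<pi> g) x" if "f \<in> D" "g \<in> D" for f g x
      using tendsto_add[OF lim[OF that(1)] lim[OF that(2)], of x] pi_eq[OF dual_add_closed[OF that]]
      by (cases "x \<in> X") (auto simp: \<pi>_def)
    show "\<pi> (fun_scale (*) c f) x = fun_scale (*) c (\<pi> f) x" if "f \<in> D" for f c x
      using tendsto_mult_left[OF lim[OF that], of x c] pi_eq[OF dual_scale_closed[OF that], of x c]
      by (cases "x \<in> X") (auto simp: \<pi>_def fun_scale_def)
  qed
  moreover have "\<pi> (\<pi> f) = \<pi> f" if "f \<in> D" for f
    using that by (intro pi_cong pi_D) (auto simp: pi_J)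
  moreover have "{f \<in> D. \<pi> f = 0} = annihilator s X N J"
  proof -
    have "f x = 0" if "f \<in> D" "\<pi> f = 0" "x \<in> J" for f x
      using pi_J[OF that(1,3)] that(2) by simp
    moreover have "\<pi> f = 0" if "f \<in> D" "\<forall>x\<in>J. f x = 0" for f
    proof
      show "\<pi> f x = 0 x" for x
        using pi_eq[OF that(1), of x 0] that(2) TJ by (cases "x \<in> X") (auto simp: \<pi>_def)
    qed
    ultimately show ?thesis by (auto simp: annihilator_def)
  qed
  ultimately show ?thesis
    unfolding M_ideal_def using pi_D J \<open>banach_space_on s X N\<close> by blast
qed

section \<open>Compact operators on the direct sum\<close>

lemma linear_bounded_linearI:
  assumes "scaling s" "scaling t"
    and "\<And>x y. T (x + y) = T x + T y" "\<And>c x. T (s c x) = t c (T x)" "\<And>x. norm (T x) \<le> C * norm x"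
  shows "Vector_Spaces.linear s t T" "bounded_linear T"
proof -
  interpret s: scaling s by fact
  interpret t: scaling t by fact
  show "Vector_Spaces.linear s t T"
    by (intro Vector_Spaces.linear_iff[THEN iffD2] conjI allI s.vector_space_axioms t.vector_space_axioms assms)
  show "bounded_linear T"
  proof (rule bounded_linear_intro)
    show "T (r *\<^sub>R x) = r *\<^sub>R T x" for r x
      using assms(4)[of "of_real r" x] by (simp add: s.scale_of_real t.scale_of_real)
    show "norm (T x) \<le> norm x * C" for x using assms(5)[of x] by (simp add: mult.commute)
  qed (rule assms)
qed

lemma bounded_opsI:
  assumes "scaling s" "\<And>x y. T (x + y) = T x + T y" "\<And>c x. T (s c x) = s c (T x)"
    "\<And>x. norm (T x) \<le> C * norm x"
  shows "T \<in> bounded_ops s"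
  using linear_bounded_linearI[OF assms(1,1), of T C] assms by (simp add: bounded_ops_def)

lemma bounded_ops_add: "T \<in> bounded_ops s \<Longrightarrow> T (x + y) = T x + T y"
  and bounded_ops_scale: "T \<in> bounded_ops s \<Longrightarrow> T (s c x) = s c (T x)"
  and bounded_ops_norm: "T \<in> bounded_ops s \<Longrightarrow> norm (T x) \<le> onorm T * norm x"
  by (auto simp: bounded_ops_def Vector_Spaces.linear_iff onorm)

lemma bounded_ops_comp: "S \<in> bounded_ops s \<Longrightarrow> T \<in> bounded_ops s \<Longrightarrow> S \<circ> T \<in> bounded_ops s"
  by (auto simp: bounded_ops_def Vector_Spaces.linear_iff comp_def intro: bounded_linear_compose)

lemma compact_opsI:
  assumes "T \<in> bounded_ops s" "T ` cball 0 1 \<subseteq> C" "compact C"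
  shows "T \<in> compact_ops s"
proof -
  have "closure (T ` cball 0 1) \<subseteq> C"
    using assms(2) compact_imp_closed[OF assms(3)] by (rule closure_minimal)
  then have "compact (closure (T ` cball 0 1))"
    using compact_Int_closed[OF assms(3) closed_closure] by (metis inf.absorb_iff2)
  then show ?thesis using assms(1) by (simp add: compact_ops_def)
qed

lemma compact_ops_comp_left:
  assumes "A \<in> bounded_ops s" "T \<in> compact_ops s"
  shows "A \<circ> T \<in> compact_ops s"
proof (rule compact_opsI)
  show "A \<circ> T \<in> bounded_ops s" using assms by (auto simp: compact_ops_def intro: bounded_ops_comp)
  have "continuous_on UNIV A"
    using assms(1) by (auto simp: bounded_ops_def intro: linear_continuous_on)
  then show "compact (A ` closure (T ` cball 0 1))"
    using assms(2) by (auto simp: compact_ops_def intro: compact_continuous_image continuous_on_subset)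
  show "(A \<circ> T) ` cball 0 1 \<subseteq> A ` closure (T ` cball 0 1)"
    using closure_subset by fastforce
qed

lemma compact_ops_comp_right:
  assumes "A \<in> bounded_ops s" "T \<in> compact_ops s" "\<And>x. norm (A x) \<le> norm x"
  shows "T \<circ> A \<in> compact_ops s"
proof (rule compact_opsI)
  show "T \<circ> A \<in> bounded_ops s" using assms by (auto simp: compact_ops_def intro: bounded_ops_comp)
  show "compact (closure (T ` cball 0 1))" using assms(2) by (simp add: compact_ops_def)
  show "(T \<circ> A) ` cball 0 1 \<subseteq> closure (T ` cball 0 1)"
    using assms(3) by (force intro: subsetD[OF closure_subset] order_trans)
qed

text \<open>The functional \<open>S \<mapsto> \<psi> (S z)\<close> attains its norm on rank one operators, so the \<open>L\<close>-projection fixes it.\<close>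

lemma M_projection_rank_one:
  fixes s :: "'k::real_or_complex \<Rightarrow> 'a::real_normed_vector \<Rightarrow> 'a" and z :: 'a
  assumes "scaling s" and "M_projection (fun_scale s) (bounded_ops s) onorm (compact_ops s) \<pi>"
    and psi: "\<And>x y. \<psi> (x + y) = \<psi> x + \<psi> y" "\<And>c x. \<psi> (s c x) = c * \<psi> x"
    and psi_le: "\<And>x. norm (\<psi> x) \<le> C * norm x"
  defines "k \<equiv> (\<lambda>S. if S \<in> bounded_ops s then \<psi> (S z) else 0)"
  shows "k \<in> dual_space (fun_scale s) (bounded_ops s) onorm" "\<pi> k = k"
proof -
  interpret s: scaling s by fact
  interpret M_projection "fun_scale s" "bounded_ops s" onorm "compact_ops s" \<pi> by fact
  show k: "k \<in> D"
  proof (rule dualI)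
    show "linear_map_on (fun_scale s) (*) (bounded_ops s) k"
      using psi X_closed by (auto simp: linear_map_on_def k_def fun_scale_def)
    show "norm (k S) \<le> (\<bar>C\<bar> * norm z) * onorm S" if "S \<in> bounded_ops s" for S
    proof -
      have "norm (\<psi> (S z)) \<le> \<bar>C\<bar> * norm (S z)"
        using psi_le[of "S z"] mult_right_mono[OF abs_ge_self[of C] norm_ge_zero[of "S z"]] by linarith
      also have "\<dots> \<le> \<bar>C\<bar> * (onorm S * norm z)"
        by (intro mult_left_mono bounded_ops_norm[OF that]) auto
      finally show ?thesis using that by (simp add: k_def algebra_simps)
    qed
  qed (simp add: k_def)
  show "\<pi> k = k"
  proof (cases "z = 0")
    case True
    have "k S = 0" for S
      using bounded_ops_scale[of S s 0 0] psi(2)[of 0 0] by (simp add: k_def True)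
    then have "k = 0" by (simp add: fun_eq_iff)
    then show ?thesis using pi_annihilator[OF k] by simp
  next
    case False
    obtain \<phi> where phi: "linear_map_on s (*) UNIV \<phi>" "\<And>x. norm (\<phi> x) \<le> norm x" "\<phi> z = of_real (norm z)"
      using hahn_banach_separation[OF s.vector_space_axioms, of UNIV "{0}" norm z "norm z"] False
      by (auto simp: s.norm_scale norm_triangle_ineq s.subspace_UNIV s.subspace_0)
    have "norm (k S) \<le> dual_norm (bounded_ops s) onorm (\<pi> k)" if S: "S \<in> bounded_ops s" "onorm S \<le> 1" for S
    proof -
      \<comment> \<open>The rank one operator \<open>R\<close> built from \<open>\<phi>\<close> and
        \<open>u\<close> lies in the unit ball and satisfies \<open>R z = S z\<close>. It is
        compact, so \<open>\<pi> k\<close> and \<open>k\<close> agree at it, and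
        \<open>\<pi> k\<close> is therefore at least as large in norm as \<open>k\<close>.\<close>
      define u where "u = inverse (norm z) *\<^sub>R S z"
      have "norm (S z) \<le> norm z"
        using bounded_ops_norm[OF S(1), of z] mult_right_mono[OF S(2) norm_ge_zero[of z]] by linarith
      then have u: "norm u \<le> 1" using False by (simp add: u_def field_simps)
      define R where "R x = s (\<phi> x) u" for x
      have R_norm: "norm (R x) \<le> 1 * norm x" for x
        using mult_mono[OF phi(2)[of x] u] by (simp add: R_def s.norm_scale)
      have R: "R \<in> bounded_ops s"
        using phi(1) R_norm by (intro bounded_opsI[OF \<open>scaling s\<close>, where C = 1])
          (auto simp: R_def linear_map_on_def s.scale_left_distrib)
      have cR: "R \<in> compact_ops s"
      proof (rule compact_opsI[OF R])
        have "continuous_on (cball 0 1) (\<lambda>c. s c u)"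
          unfolding continuous_on_iff
        proof (intro ballI allI impI)
          fix c :: 'k and e :: real assume "e > 0"
          have "dist (s c' u) (s c u) < e" if "dist c' c < e" for c'
          proof -
            have "dist (s c' u) (s c u) = norm (c' - c) * norm u"
              by (simp add: dist_norm s.norm_scale flip: s.scale_left_diff_distrib)
            also have "\<dots> \<le> norm (c' - c) * 1" using u by (intro mult_left_mono) auto
            finally show ?thesis using that by (simp add: dist_norm)
          qed
          with \<open>e > 0\<close> show "\<exists>d>0. \<forall>c'\<in>cball 0 1. dist c' c < d \<longrightarrow> dist (s c' u) (s c u) < e"
            by blast
        qed
        then show "compact ((\<lambda>c. s c u) ` cball 0 1)"
          by (rule compact_continuous_image[OF _ compact_cball_scalar])
        show "R ` cball 0 1 \<subseteq> (\<lambda>c. s c u) ` cball 0 1"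
          using phi(2) by (fastforce simp: R_def intro: order_trans)
      qed
      have "R z = S z" using False by (simp add: R_def phi(3) u_def s.scale_of_real)
      then have "norm (k S) = norm (\<pi> k R)"
        using S R by (simp add: k_def pi_on_J[OF k cR, unfolded k_def])
      also have "\<dots> \<le> dual_norm (bounded_ops s) onorm (\<pi> k)"
        using R R_norm by (intro dual_norm_ge pi_closed k onorm_bound) auto
      finally show ?thesis .
    qed
    then show ?thesis by (intro pi_fix k dual_norm_le)
  qed
qed

section \<open>Coordinate symmetries of the sum, and compact approximations of the identity\<close>

definition first_part :: "('a::real_normed_vector, 'a) max_sum \<Rightarrow> ('a, 'a) max_sum"
  where "first_part z = Abs_max_sum (fst (Rep_max_sum z), 0)"

definition reflect_sum :: "('a::real_normed_vector, 'a) max_sum \<Rightarrow> ('a, 'a) max_sum"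
  where "reflect_sum z = Abs_max_sum (fst (Rep_max_sum z), - snd (Rep_max_sum z))"

definition swap_sum :: "('a::real_normed_vector, 'a) max_sum \<Rightarrow> ('a, 'a) max_sum"
  where "swap_sum z = Abs_max_sum (snd (Rep_max_sum z), fst (Rep_max_sum z))"

lemmas max_sum_simps = Rep_max_sum_inject[symmetric] Rep_max_sum_simps Abs_max_sum_inverse
  max_sum_scale_def prod_eq_iff norm_max_sum_def

context
  fixes s :: "'k::real_or_complex \<Rightarrow> 'a::real_normed_vector \<Rightarrow> 'a"
  assumes s: "scaling s"
begin

interpretation sc: scaling s by (rule s)

private abbreviation (input) "m \<equiv> max_sum_scale s s"

private lemma m: "scaling m"
  by (rule scaling_max_sum[OF s s])

private lemma sum_ops:
  "first_part \<in> bounded_ops m" "reflect_sum \<in> bounded_ops m" "swap_sum \<in> bounded_ops m"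
  by (rule bounded_opsI[OF m, where C = 1];
      simp add: first_part_def reflect_sum_def swap_sum_def max_sum_simps)+

private lemma sum_ops_norm:
  "norm (first_part z) \<le> norm z" "norm (reflect_sum z) = norm z" "norm (swap_sum z) = norm z"
  by (simp_all add: first_part_def reflect_sum_def swap_sum_def max_sum_simps max.commute)

private lemma sum_ops_invol: "reflect_sum (reflect_sum z) = z" "swap_sum (swap_sum z) = z"
  for z :: "('a, 'a) max_sum"
  by (simp_all add: reflect_sum_def swap_sum_def max_sum_simps)

private lemma first_part_idem: "first_part (first_part z) = first_part z"
  for z :: "('a, 'a) max_sum"
  by (simp add: first_part_def Abs_max_sum_inverse)

text \<open>The projection is not an isometry, so \<open>pi_commute\<close> does not apply to it
  directly. It is the average of two isometric involutions, to which it does apply.\<close>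

private lemma first_part_mean: "first_part z = m (1/2) (z + reflect_sum z)"
  by (simp add: first_part_def reflect_sum_def max_sum_simps sc.scale_right_distrib flip: sc.scale_left_distrib)

text \<open>\<open>K\<close> is the upper left entry of a compact operator \<open>C\<close> on the
  sum. If no \<open>C\<close> were good enough, a functional \<open>G\<close> would separate the
  target \<open>v\<close> from the subspace of corrections \<open>w C\<close>. Applying
  \<open>\<pi>\<close> to the relation \<open>G (w C) = 0\<close> turns it into an identity at the
  coordinate projection, which contradicts \<open>pi_split_le\<close>.\<close>

lemma M_infinity_approx:
  fixes Y :: "'a set" and e :: real
  assumes M: "M_ideal (fun_scale m) (bounded_ops m) onorm (compact_ops m)"
    and Y: "finite Y" and e: "e > 0"
  obtains K where "K \<in> compact_ops s"
    "\<And>x y. norm (K x + (y - K y)) \<le> (1 + e) * max (norm x) (norm y)"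
    "\<And>y. y \<in> Y \<Longrightarrow> norm (K y - y) \<le> e"
proof -
  obtain \<pi> where pi: "M_projection (fun_scale m) (bounded_ops m) onorm (compact_ops m) \<pi>"
    using M_ideal_projection[OF M] .
  interpret m: scaling m by (rule m)
  interpret M_projection "fun_scale m" "bounded_ops m" onorm "compact_ops m" \<pi> by (rule pi)
  let ?X = "bounded_ops m" and ?J = "compact_ops m"
  let ?p = "first_part :: ('a, 'a) max_sum \<Rightarrow> _" and ?u = "swap_sum :: ('a, 'a) max_sum \<Rightarrow> _"
    and ?r = "reflect_sum :: ('a, 'a) max_sum \<Rightarrow> _"
  let ?in = "\<lambda>x. Abs_max_sum (x, 0) :: ('a, 'a) max_sum"
  have JX: "S \<in> ?X" if "S \<in> ?J" for S using that by (simp add: compact_ops_def)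
  have J_sub: "subspace ?J"
    using M by (simp add: M_ideal_def closed_subspace_on_def)
  have comp: "S \<circ> T \<in> ?X" if "S \<in> ?X" "T \<in> ?X" for S T
    using that by (rule bounded_ops_comp)
  have op_add: "S (x + y) = S x + S y" and op_scale: "S (m c x) = m c (S x)" if "S \<in> ?X" for S c x y
    by (rule bounded_ops_add[OF that], rule bounded_ops_scale[OF that])
  have right: "linear_map_on (fun_scale m) (fun_scale m) ?X (\<lambda>S. S \<circ> A)" for A
    by (auto simp: linear_map_on_def fun_scale_def)
  have left: "linear_map_on (fun_scale m) (fun_scale m) ?X (\<lambda>S. A \<circ> S)" if "A \<in> ?X" for A
    using that by (auto simp: linear_map_on_def fun_scale_def op_add op_scale)
  have right_le: "onorm (S \<circ> A) \<le> onorm S"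
    if "S \<in> ?X" "A \<in> ?X" "\<And>z. norm (A z) \<le> norm z" for S A
  proof (rule onorm_bound[OF N_nonneg[OF that(1)]])
    show "norm ((S \<circ> A) z) \<le> onorm S * norm z" for z
      using bounded_ops_norm[OF that(1), of "A z"] mult_left_mono[OF that(3)[of z] N_nonneg[OF that(1)]]
      by simp
  qed
  have right_iso: "onorm (S \<circ> A) = onorm S"
    if "S \<in> ?X" "A \<in> ?X" "\<And>z. norm (A z) = norm z" "\<And>z. A (A z) = z" for S A
    using right_le[of S A] right_le[of "S \<circ> A" A] that comp by (simp add: comp_def)
  have left_iso: "onorm (A \<circ> S) = onorm S" if "\<And>z. norm (A z) = norm z"
    for A S :: "('a, 'a) max_sum \<Rightarrow> ('a, 'a) max_sum"
    using that by (simp add: onorm_def)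
  note ops = sum_ops sum_ops_norm sum_ops_invol
  have ops_comp: "?r \<circ> (?r \<circ> S) = S" "S \<circ> (?r \<circ> ?r) = S" "S \<circ> (?u \<circ> ?u) = S" for S
    by (auto simp: ops)
  let ?R = "\<lambda>f :: (('a, 'a) max_sum \<Rightarrow> ('a, 'a) max_sum) \<Rightarrow> 'k. \<lambda>S. f (S \<circ> ?r)"
  let ?L = "\<lambda>f :: (('a, 'a) max_sum \<Rightarrow> ('a, 'a) max_sum) \<Rightarrow> 'k. \<lambda>S. f (?r \<circ> S)"
  let ?U = "\<lambda>f :: (('a, 'a) max_sum \<Rightarrow> ('a, 'a) max_sum) \<Rightarrow> 'k. \<lambda>S. f (S \<circ> ?u)"
  have R: "?R f \<in> D" "\<pi> (?R f) = ?R (\<pi> f)" if "f \<in> D" for f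
    by ((rule dual_comp[OF that right] pi_commute[OF that right];
        simp add: comp ops right_iso compact_ops_comp_right comp_assoc ops_comp))+
  have L: "?L f \<in> D" "\<pi> (?L f) = ?L (\<pi> f)" if "f \<in> D" for f
    by ((rule dual_comp[OF that left[OF sum_ops(2)]] pi_commute[OF that left[OF sum_ops(2)]];
        simp add: comp ops left_iso compact_ops_comp_left ops_comp))+
  have U: "?U f \<in> D" "\<pi> (?U f) = ?U (\<pi> f)" if "f \<in> D" for f
    by ((rule dual_comp[OF that right] pi_commute[OF that right];
        simp add: comp ops right_iso compact_ops_comp_right comp_assoc ops_comp))+
  \<comment> \<open>Compression to the upper left entry,
    \<open>S \<mapsto> f (?p \<circ> S \<circ> ?p)\<close>, written as an average over sign changes
    on either side so that it visibly commutes with \<open>\<pi>\<close>.\<close>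
  define Q where "Q f = fun_scale (*) (1/4) (f + ?R f + ?L f + ?L (?R f))"
    for f :: "(('a, 'a) max_sum \<Rightarrow> ('a, 'a) max_sum) \<Rightarrow> 'k"
  have Q_D: "Q f \<in> D" if "f \<in> D" for f
    unfolding Q_def by (intro dual_scale_closed dual_add_closed R L that)
  have pi_Q: "\<pi> (Q f) = Q (\<pi> f)" if "f \<in> D" for f
    unfolding Q_def using that R[OF that] L[OF that] L[OF R(1)[OF that]]
    by (simp add: pi_scale pi_add dual_add_closed)
  have Q_eval: "Q f S = f (?p \<circ> S \<circ> ?p)" if "f \<in> D" "S \<in> ?X" for f S
  proof -
    have "?p \<circ> S \<circ> ?p = fun_scale m (1/4) (S + (S \<circ> ?r) + (?r \<circ> S) + (?r \<circ> S \<circ> ?r))"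
      using that by (auto simp: fun_eq_iff first_part_mean op_add op_scale ops fun_scale_def m.scale_right_distrib)
    moreover have "S + (S \<circ> ?r) \<in> ?X" "S + (S \<circ> ?r) + (?r \<circ> S) \<in> ?X"
      "S + (S \<circ> ?r) + (?r \<circ> S) + (?r \<circ> S \<circ> ?r) \<in> ?X"
      using that by (simp_all add: X_closed comp ops)
    ultimately show ?thesis
      using that by (simp add: Q_def fun_scale_def[of "(*)"] dual_scale dual_add comp ops comp_assoc)
  qed
  define sV :: "'k \<Rightarrow> ((('a, 'a) max_sum \<Rightarrow> ('a, 'a) max_sum) \<times> ('a \<Rightarrow> 'a)) \<Rightarrow> _"
    where "sV c = map_prod (fun_scale m c) (fun_scale s c)"
    for c
  \<comment> \<open>The weight \<open>(1 + e) / e\<close> is chosen so that the single inequality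
    \<open>q z < 1 + e\<close> yields both \<open>onorm (fst z) < 1 + e\<close> and a sum of errors
    over \<open>Y\<close> below \<open>e\<close>.\<close>
  define q where "q z = onorm (fst z) + (1 + e) / e * (\<Sum>y\<in>Y. norm (snd z y))"
    for z :: "(('a, 'a) max_sum \<Rightarrow> ('a, 'a) max_sum) \<times> ('a \<Rightarrow> 'a)"
  \<comment> \<open>The first component of \<open>v + w C\<close> maps \<open>(x, y)\<close> to
    \<open>(K x + y - K y, 0)\<close> and the second maps \<open>y\<close> to
    \<open>K y - y\<close>. Thus \<open>q (v + w C) < 1 + e\<close> is all that is wanted of
    \<open>K\<close>.\<close>
  define w where "w C = ((?p \<circ> C \<circ> ?p) - (?p \<circ> C \<circ> ?p \<circ> ?u), \<lambda>y. fst (Rep_max_sum (C (?in y))))" for C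
  define v where "v = (?p \<circ> ?u, \<lambda>y :: 'a. - y)"
  have p_diff: "?p (x - y) = ?p x - ?p y" for x y
    using op_add[OF sum_ops(1), of "x - y" y] by simp
  have sV: "vector_space sV"
    by unfold_locales
      (auto simp: sV_def fun_scale_def fun_eq_iff m.scale_right_distrib m.scale_left_distrib
        sc.scale_right_distrib sc.scale_left_distrib prod_eq_iff)
  interpret sV: vector_space sV by (rule sV)
  have q_add: "q (z + z') \<le> q z + q z'" if "fst z \<in> ?X" "fst z' \<in> ?X" for z z'
  proof -
    have "(\<Sum>y\<in>Y. norm (snd (z + z') y)) \<le> (\<Sum>y\<in>Y. norm (snd z y)) + (\<Sum>y\<in>Y. norm (snd z' y))"
      by (auto simp: sum.distrib[symmetric] intro!: sum_mono norm_triangle_ineq)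
    then have "(1 + e) / e * (\<Sum>y\<in>Y. norm (snd (z + z') y))
        \<le> (1 + e) / e * ((\<Sum>y\<in>Y. norm (snd z y)) + (\<Sum>y\<in>Y. norm (snd z' y)))"
      using e by (intro mult_left_mono) auto
    then show ?thesis using N_triangle[OF that] unfolding q_def by (simp add: distrib_left)
  qed
  have q_scale: "q (sV c z) = norm c * q z" if "fst z \<in> ?X" for c z
    using N_scale[OF that, of c]
    by (simp add: q_def sV_def fun_scale_def sc.norm_scale distrib_left sum_distrib_left algebra_simps)
  have fst_m: "fst (Rep_max_sum (m c z)) = s c (fst (Rep_max_sum z))" for c z
    by (simp add: max_sum_scale_def Abs_max_sum_inverse)
  have w_lin: "w (C + C') = w C + w C'" "w (fun_scale m c C) = sV c (w C)" for c C C'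
    by (auto simp: w_def sV_def fun_scale_def fun_eq_iff op_add[OF sum_ops(1)] op_scale[OF sum_ops(1)]
        m.scale_right_diff_distrib Rep_max_sum_simps fst_m)
  have "\<exists>C\<in>?J. q (v + w C) < 1 + e"
  proof (rule ccontr)
    assume "\<not> ?thesis"
    then have far: "\<And>C. C \<in> ?J \<Longrightarrow> 1 + e \<le> q (v + w C)" by force
    obtain G where G: "linear_map_on sV (*) (?X \<times> UNIV) G"
      and G_le: "\<And>z. z \<in> ?X \<times> UNIV \<Longrightarrow> norm (G z) \<le> q z"
      and G_W: "\<And>z. z \<in> w ` ?J \<Longrightarrow> G z = 0" and G_v: "G v = of_real (1 + e)"
    proof (rule hahn_banach_separation[OF sV, of "?X \<times> UNIV" "w ` ?J" q v "1 + e"])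
      show "sV.subspace (?X \<times> UNIV)"
        unfolding sV.subspace_def by (auto simp: sV_def X_closed zero_prod_def)
      show "sV.subspace (w ` ?J)"
        unfolding sV.subspace_def
      proof (intro conjI ballI allI)
        have "w 0 = 0" using w_lin(2)[of 0 0] by simp
        then show "0 \<in> w ` ?J" using subspace_0[OF J_sub] by (metis imageI)
      qed (auto simp: w_lin[symmetric] intro!: imageI subspace_add[OF J_sub] subspace_scale[OF J_sub])
      show "w ` ?J \<subseteq> ?X \<times> UNIV" using JX by (auto simp: w_def intro!: X_closed comp ops)
      show "v \<in> ?X \<times> UNIV" by (auto simp: v_def intro!: comp ops)
    qed (use e far in \<open>auto intro: q_add q_scale\<close>)
    have G_add: "G (z + z') = G z + G z'" and G_scale: "G (sV c z) = c * G z"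
      if "fst z \<in> ?X" "fst z' \<in> ?X" for z z' c
      using G that by (cases z, cases z', simp add: linear_map_on_def)+
    have zeroX: "0 \<in> ?X" by (rule X_closed)
    define f where "f S = (if S \<in> ?X then G (S, 0) else 0)" for S
    have f_norm: "norm (f S) \<le> 1 * onorm S" if "S \<in> ?X" for S
      using G_le[of "(S, 0)"] that by (simp add: f_def q_def)
    have f: "f \<in> D"
    proof (rule dualI[OF _ f_norm])
      show "linear_map_on (fun_scale m) (*) ?X f"
        unfolding linear_map_on_def
      proof (intro conjI ballI allI)
        show "f (S + T) = f S + f T" if "S \<in> ?X" "T \<in> ?X" for S T
          using G_add[of "(S, 0)" "(T, 0)"] that X_closed(2)[OF that] by (simp add: f_def)
        show "f (fun_scale m c S) = c * f S" if "S \<in> ?X" for S c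
        proof -
          have "sV c (S, 0) = (fun_scale m c S, 0)" by (simp add: sV_def fun_scale_def fun_eq_iff)
          then show ?thesis
            using G_scale[of "(S, 0)" "(S, 0)" c] that X_closed(3)[OF that, of c] by (simp add: f_def)
        qed
      qed
    qed (auto simp: f_def)
    have f_le: "dual_norm ?X onorm f \<le> 1"
      using f_norm by (intro dual_norm_le) fastforce
    have G0_add: "G (0, b + b') = G (0, b) + G (0, b')" and G0_scale: "G (0, \<lambda>x. s c (b x)) = c * G (0, b)" for b b' c
    proof -
      show "G (0, b + b') = G (0, b) + G (0, b')"
        using G_add[of "(0, b)" "(0, b')"] zeroX by simp
      have "sV c (0, b) = (0, \<lambda>x. s c (b x))"
        by (simp add: sV_def fun_scale_def fun_eq_iff)
      then show "G (0, \<lambda>x. s c (b x)) = c * G (0, b)"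
        using G_scale[of "(0, b)" "(0, b)" c] zeroX by simp
    qed
    have G0_le: "norm (G (0, b)) \<le> (1 + e) / e * (\<Sum>y\<in>Y. norm (b y))" for b
      using G_le[of "(0, b)"] zeroX N_0 by (simp add: q_def)
    \<comment> \<open>This is the contribution of the second component of \<open>G\<close>. It is a
      sum of functionals \<open>S \<mapsto> \<psi> (S z)\<close>, one for each point of
      \<open>Y'\<close>, each fixed by \<open>\<pi>\<close>. The general \<open>Y'\<close> is for
      the induction over finite sets.\<close>
    define k where "k Y' S = (if S \<in> ?X then G (0, \<lambda>x. if x \<in> Y' then fst (Rep_max_sum (S (?in x))) else 0) else 0)"
      for Y' S
    have k1: "k {y} \<in> D \<and> \<pi> (k {y}) = k {y}" for y
    proof -
      have "norm (G (0, \<lambda>x. if x = y then fst (Rep_max_sum z) else 0)) \<le> (1 + e) / e * norm z" for z :: "('a, 'a) max_sum"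
      proof -
        have "(\<Sum>x\<in>Y. norm (if x = y then fst (Rep_max_sum z) else 0)) = (\<Sum>x\<in>Y. if x = y then norm (fst (Rep_max_sum z)) else 0)"
          by (rule sum.cong) auto
        also have "\<dots> \<le> norm z" using Y by (simp add: norm_max_sum_def le_max_iff_disj)
        finally have "(1 + e) / e * (\<Sum>x\<in>Y. norm (if x = y then fst (Rep_max_sum z) else 0)) \<le> (1 + e) / e * norm z"
          using e by (intro mult_left_mono) auto
        with G0_le show ?thesis by (rule order_trans)
      qed
      moreover have "G (0, \<lambda>x. if x = y then fst (Rep_max_sum (z + z')) else 0)
          = G (0, \<lambda>x. if x = y then fst (Rep_max_sum z) else 0) + G (0, \<lambda>x. if x = y then fst (Rep_max_sum z') else 0)"
        for z z' :: "('a, 'a) max_sum"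
        unfolding G0_add[symmetric] by (auto simp: Rep_max_sum_simps intro!: arg_cong[where f = G])
      moreover have "G (0, \<lambda>x. if x = y then fst (Rep_max_sum (m c z)) else 0)
          = c * G (0, \<lambda>x. if x = y then fst (Rep_max_sum z) else 0)" for c z
        unfolding G0_scale[symmetric] by (auto simp: max_sum_scale_def Abs_max_sum_inverse intro!: arg_cong[where f = G])
      ultimately have "(\<lambda>S. if S \<in> ?X then G (0, \<lambda>x. if x = y then fst (Rep_max_sum (S (?in y))) else 0) else 0) \<in> D \<and>
          \<pi> (\<lambda>S. if S \<in> ?X then G (0, \<lambda>x. if x = y then fst (Rep_max_sum (S (?in y))) else 0) else 0)
          = (\<lambda>S. if S \<in> ?X then G (0, \<lambda>x. if x = y then fst (Rep_max_sum (S (?in y))) else 0) else 0)"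
        using M_projection_rank_one[OF m pi, of "\<lambda>z. G (0, \<lambda>x. if x = y then fst (Rep_max_sum z) else 0)" "(1 + e) / e" "?in y"]
        by blast
      moreover have "k {y} = (\<lambda>S. if S \<in> ?X then G (0, \<lambda>x. if x = y then fst (Rep_max_sum (S (?in y))) else 0) else 0)"
        by (auto simp: k_def fun_eq_iff intro!: arg_cong[where f = G])
      ultimately show ?thesis by simp
    qed
    have kY: "k Y' \<in> D \<and> \<pi> (k Y') = k Y'" if "finite Y'" for Y'
      using that
    proof induction
      case empty
      have "k {} = 0"
        using G0_scale[of 0 "\<lambda>x. 0"] by (auto simp: k_def fun_eq_iff)
      moreover have "0 \<in> D" by (rule dualI[where C = 0]) (auto simp: linear_map_on_def)
      moreover have "\<pi> 0 = 0" by (rule pi_annihilator) (use calculation in simp_all)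
      ultimately show ?case by (simp only: simp_thms)
    next
      case (insert y Y')
      have "k (insert y Y') = k {y} + k Y'"
        using insert.hyps by (auto simp: k_def fun_eq_iff G0_add[symmetric] intro!: arg_cong[where f = G])
      then have "k (insert y Y') \<in> D \<and> \<pi> (k (insert y Y')) = k (insert y Y')"
        using k1[of y] insert.IH by (simp only: dual_add_closed pi_add simp_thms)
      then show ?case .
    qed
    \<comment> \<open>The seminorm \<open>q\<close> ignores the second component outside
      \<open>Y\<close>, and so does \<open>G\<close>.\<close>
    have k_eq: "k Y S = G (0, \<lambda>x. fst (Rep_max_sum (S (?in x))))" if "S \<in> ?X" for S
    proof -
      let ?b = "\<lambda>x. fst (Rep_max_sum (S (?in x)))"
      have "G (0, ?b) = G (0, \<lambda>x. if x \<in> Y then ?b x else 0) + G (0, \<lambda>x. if x \<in> Y then 0 else ?b x)"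
        unfolding G0_add[symmetric] by (auto intro!: arg_cong[where f = G])
      moreover have "norm (G (0, \<lambda>x. if x \<in> Y then 0 else ?b x)) \<le> 0"
        using G0_le[of "\<lambda>x. if x \<in> Y then 0 else ?b x"] by simp
      ultimately show ?thesis using that by (simp add: k_def)
    qed
    have Uf: "?U f \<in> D" "?U (\<pi> f) \<in> D" using U f pi_closed by blast+
    \<comment> \<open>On every bounded \<open>S\<close> this is \<open>G (w S)\<close>. It vanishes
      on the compact operators, which is what \<open>G_W\<close> says, hence
      \<open>\<pi> h = 0\<close>.\<close>
    define h where "h = Q f - Q (?U f) + k Y"
    have h: "h \<in> D"
      unfolding h_def by (intro dual_add_closed dual_diff_closed Q_D f Uf kY[OF Y, THEN conjunct1])
    have "\<pi> h = 0"
    proof (rule pi_annihilator[OF h])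
      fix C assume C: "C \<in> ?J"
      have CX: "C \<in> ?X" by (rule JX[OF C])
      have cX: "?p \<circ> C \<circ> ?p \<in> ?X" "?p \<circ> C \<circ> ?p \<circ> ?u \<in> ?X" by (intro comp ops CX)+
      have "h C = f ((?p \<circ> C \<circ> ?p) - (?p \<circ> C \<circ> ?p \<circ> ?u)) + k Y C"
        using f Uf CX cX by (simp add: h_def Q_eval dual_diff comp_assoc)
      also have "\<dots> = G (w C)"
        using CX cX X_closed zeroX by (simp add: f_def k_eq w_def G_add[symmetric])
      finally show "h C = 0" using G_W C by simp
    qed
    moreover have "\<pi> h = Q (\<pi> f) - Q (?U (\<pi> f)) + k Y"
    proof -
      have "\<pi> h = \<pi> (Q f - Q (?U f)) + \<pi> (k Y)"
        unfolding h_def by (intro pi_add dual_diff_closed Q_D f Uf kY[OF Y, THEN conjunct1])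
      also have "\<pi> (Q f - Q (?U f)) = \<pi> (Q f) - \<pi> (Q (?U f))"
        by (intro pi_diff Q_D f Uf)
      finally show ?thesis
        by (simp only: pi_Q[OF f] pi_Q[OF Uf(1)] U(2)[OF f] kY[OF Y, THEN conjunct2])
    qed
    \<comment> \<open>The equation \<open>\<pi> h = 0\<close> holds at all bounded operators, so it
      may be evaluated at \<open>?p\<close>, which need not be compact and whose upper left entry is
      the identity.\<close>
    ultimately have "(Q (\<pi> f) - Q (?U (\<pi> f)) + k Y) ?p = 0"
      by (simp only: zero_fun_apply)
    then have "Q (\<pi> f) ?p - Q (?U (\<pi> f)) ?p + k Y ?p = 0"
      by simp
    moreover have "?p \<circ> ?p \<circ> ?p = ?p" "?p \<circ> ?p = ?p" by (auto simp: first_part_idem)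
    ultimately have eq: "\<pi> f ?p - \<pi> f (?p \<circ> ?u) + G (0, \<lambda>x. x) = 0"
      using f Uf by (simp add: Q_eval ops pi_closed k_eq comp_assoc[symmetric])
        (simp add: first_part_def Abs_max_sum_inverse)
    have "G v = f (?p \<circ> ?u) + G (0, \<lambda>x. - x)"
      using zeroX by (simp add: f_def v_def G_add[symmetric] comp ops)
    moreover have "G (0, \<lambda>x. - x) = - G (0, \<lambda>x. x)"
      using G0_scale[of "-1" "\<lambda>x. x"] by simp
    moreover have "G (0, \<lambda>x. x) = \<pi> f (?p \<circ> ?u) - \<pi> f ?p"
      using eq by (simp add: algebra_simps)
    \<comment> \<open>Eliminating the term \<open>G (0, \<lambda>x. x)\<close> leaves exactly the
      expression bounded in \<open>pi_split_le\<close>, at two operators of norm at most 1. So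
      \<open>G v = 1 + e\<close> would be at most 1 in norm.\<close>
    ultimately have "G v = f (?p \<circ> ?u) - \<pi> f (?p \<circ> ?u) + \<pi> f ?p"
      by (simp only:) simp
    moreover have "onorm ?p \<le> 1" "onorm (?p \<circ> ?u) \<le> 1"
      using order_trans[OF ops(4) eq_refl[OF ops(6)]]
      by (auto intro!: onorm_bound ops)
    ultimately have "norm (G v) \<le> dual_norm ?X onorm f"
      using pi_split_le[OF f, of "?p \<circ> ?u" ?p] by (simp add: comp ops)
    moreover have "norm (G v) = 1 + e"
      using e unfolding G_v norm_of_real by simp
    ultimately show False using f_le e by simp
  qed
  then obtain C where C: "C \<in> ?J" "q (v + w C) < 1 + e" by blast
  define K where "K x = fst (Rep_max_sum (C (?in x)))" for x
  have CX: "C \<in> ?X" by (rule JX[OF C(1)])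
  have in_lin: "?in (x + y) = ?in x + ?in y" "?in (s c x) = m c (?in x)" "norm (?in x) = norm x" for x y c
    by (simp_all add: max_sum_simps)
  have S: "fst (v + w C) \<in> ?X"
    by (auto simp: v_def w_def intro!: X_closed comp ops CX)
  have sum_nonneg': "0 \<le> (1 + e) / e * (\<Sum>y\<in>Y. norm (snd (v + w C) y))"
    using e by (intro mult_nonneg_nonneg sum_nonneg norm_ge_zero) auto
  show ?thesis
  proof (rule that[of K])
    show "K \<in> compact_ops s"
    proof (rule compact_opsI)
      show "K \<in> bounded_ops s"
      proof (rule bounded_opsI[OF s, where C = "onorm C"])
        show "norm (K x) \<le> onorm C * norm x" for x
          using bounded_ops_norm[OF CX, of "?in x"] by (simp add: K_def in_lin norm_max_sum_def[of "C _"])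
      qed (simp_all add: K_def in_lin op_add[OF CX] op_scale[OF CX] Rep_max_sum_simps fst_m)
      have "bounded_linear (\<lambda>z :: ('a, 'a) max_sum. fst (Rep_max_sum z))"
        by (rule linear_bounded_linearI(2)[OF m s, where C = 1])
          (simp_all add: Rep_max_sum_simps max_sum_scale_def Abs_max_sum_inverse norm_max_sum_def)
      then show "compact ((\<lambda>z. fst (Rep_max_sum z)) ` closure (C ` cball 0 1))"
        using C(1) by (auto simp: compact_ops_def intro!: compact_continuous_image linear_continuous_on)
      show "K ` cball 0 1 \<subseteq> (\<lambda>z. fst (Rep_max_sum z)) ` closure (C ` cball 0 1)"
        by (auto simp: K_def in_lin intro!: imageI subsetD[OF closure_subset])
    qed
    show "norm (K x + (y - K y)) \<le> (1 + e) * max (norm x) (norm y)" for x y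
    proof -
      let ?z = "Abs_max_sum (x, y)"
      have "fst (v + w C) ?z = ?in (y + (K x - K y))"
        by (simp add: v_def w_def K_def first_part_def swap_sum_def max_sum_simps)
      then have "norm (K x + (y - K y)) = norm (fst (v + w C) ?z)"
        by (simp add: in_lin algebra_simps)
      also have "\<dots> \<le> onorm (fst (v + w C)) * norm ?z"
        by (rule bounded_ops_norm[OF S])
      also have "\<dots> \<le> (1 + e) * norm ?z"
        using C(2) sum_nonneg' by (intro mult_right_mono) (auto simp: q_def)
      finally show ?thesis by (simp add: norm_max_sum_def Abs_max_sum_inverse)
    qed
    show "norm (K y - y) \<le> e" if "y \<in> Y" for y
    proof -
      have "norm (K y - y) = norm (snd (v + w C) y)"
        by (simp add: v_def w_def K_def)
      also have "\<dots> \<le> (\<Sum>y\<in>Y. norm (snd (v + w C) y))"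
        by (rule member_le_sum[OF that _ Y]) simp
      also have "\<dots> \<le> e"
      proof -
        have "(1 + e) / e * (\<Sum>y\<in>Y. norm (snd (v + w C) y)) \<le> 1 + e"
          using C(2) N_nonneg[OF S] by (simp add: q_def)
        then have "(1 + e) * (\<Sum>y\<in>Y. norm (snd (v + w C) y)) \<le> (1 + e) * e"
          using e by (simp add: divide_le_eq)
        then show ?thesis by (rule mult_left_le_imp_le) (use e in simp)
      qed
      finally show ?thesis .
    qed
  qed
qed

end

section \<open>Weak uniform continuity\<close>

lemma totally_bounded_scalar:
  fixes S :: "'k::real_or_complex set"
  assumes "bounded S" "0 < e"
  obtains D where "finite D" "D \<subseteq> S" "\<And>x. x \<in> S \<Longrightarrow> \<exists>d\<in>D. norm (x - d) < e"
proof -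
  obtain R where R: "S \<subseteq> cball 0 R"
    using assms(1) by (auto simp: bounded_iff subset_iff)
  have "compact (closure S)"
    using closure_minimal[OF R closed_cball] compact_Int_closed[OF compact_cball_scalar closed_closure]
    by (metis inf.absorb_iff2)
  moreover have cover: "closure S \<subseteq> (\<Union>d\<in>S. ball d e)"
    using assms(2) by (force simp: closure_approachable)
  ultimately obtain D where "D \<subseteq> S" "finite D" "closure S \<subseteq> (\<Union>d\<in>D. ball d e)"
    using compactE_image[of "closure S" S "\<lambda>d. ball d e"] by (metis open_ball)
  then show ?thesis
    using closure_subset[of S] by (intro that[of D]) (force simp: dist_norm norm_minus_commute)+
qed

definition topological_dual :: "('k::real_or_complex \<Rightarrow> 'e::real_normed_vector \<Rightarrow> 'e) \<Rightarrow> ('e \<Rightarrow> 'k) set"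
  where "topological_dual s = {\<phi>. Vector_Spaces.linear s (*) \<phi> \<and> bounded_linear \<phi>}"

lemma topological_dual_diff: "\<phi> \<in> topological_dual s \<Longrightarrow> \<phi> (x - y) = \<phi> x - \<phi> y"
  by (simp add: topological_dual_def bounded_linear.linear linear_diff)

lemma topological_dual_add: "\<phi> \<in> topological_dual s \<Longrightarrow> \<phi> (x + y) = \<phi> x + \<phi> y"
  by (simp add: topological_dual_def bounded_linear.linear linear_add)

text \<open>Induction on the functionals: the bounded image of \<open>B\<close> under
  \<open>\<phi>\<close> is totally bounded, so \<open>B\<close> is cut into finitely many slices on
  which \<open>\<phi>\<close> is almost constant. The induction hypothesis is applied inside each
  slice, which keeps the centres in \<open>B\<close>.\<close>

lemma weakly_totally_bounded:
  assumes "finite \<Phi>" "\<Phi> \<subseteq> topological_dual s" "bounded B" "0 < e"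
  obtains C where "finite C" "C \<subseteq> B" "\<And>x. x \<in> B \<Longrightarrow> \<exists>c\<in>C. \<forall>\<phi>\<in>\<Phi>. norm (\<phi> (x - c)) < e"
proof -
  have "\<exists>C. finite C \<and> C \<subseteq> B \<and> (\<forall>x\<in>B. \<exists>c\<in>C. \<forall>\<phi>\<in>\<Phi>. norm (\<phi> (x - c)) < e)"
    using assms
  proof (induction arbitrary: B e)
    case empty
    then show ?case by (cases "B = {}") (auto intro!: exI[of _ "{SOME x. x \<in> B}"] some_in_eq[THEN iffD2])
  next
    case (insert \<phi> \<Phi>)
    have dual: "\<psi> \<in> topological_dual s" if "\<psi> \<in> insert \<phi> \<Phi>" for \<psi>
      using insert.prems that by auto
    have "bounded (\<phi> ` B)"
      using dual[of \<phi>] insert.prems(2) by (auto simp: topological_dual_def intro: bounded_linear_image)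
    then obtain D where D: "finite D" "D \<subseteq> \<phi> ` B" "\<And>z. z \<in> \<phi> ` B \<Longrightarrow> \<exists>d\<in>D. norm (z - d) < e / 2"
      using insert.prems(3) by (elim totally_bounded_scalar[of _ "e / 2"]) auto
    \<comment> \<open>A point and its centre lie in the same slice, hence the half: both values of
      \<open>\<phi>\<close> are within \<open>e / 2\<close> of \<open>d\<close>.\<close>
    let ?B = "\<lambda>d. {x \<in> B. norm (\<phi> x - d) < e / 2}"
    have "\<exists>C. finite C \<and> C \<subseteq> ?B d \<and> (\<forall>x\<in>?B d. \<exists>c\<in>C. \<forall>\<phi>\<in>\<Phi>. norm (\<phi> (x - c)) < e)" for d
      using insert.prems by (intro insert.IH) (auto intro: bounded_subset)
    then have "\<exists>C. \<forall>d. finite (C d) \<and> C d \<subseteq> ?B d \<and> (\<forall>x\<in>?B d. \<exists>c\<in>C d. \<forall>\<phi>\<in>\<Phi>. norm (\<phi> (x - c)) < e)"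
      by (intro choice allI)
    then obtain C where "\<forall>d. finite (C d) \<and> C d \<subseteq> ?B d \<and> (\<forall>x\<in>?B d. \<exists>c\<in>C d. \<forall>\<phi>\<in>\<Phi>. norm (\<phi> (x - c)) < e)"
      by (elim exE)
    then have C: "finite (C d)" "C d \<subseteq> ?B d"
      "x \<in> ?B d \<Longrightarrow> \<exists>c\<in>C d. \<forall>\<phi>\<in>\<Phi>. norm (\<phi> (x - c)) < e" for d x
      by (simp_all only:)
    have "\<exists>c\<in>(\<Union>d\<in>D. C d). \<forall>\<psi>\<in>insert \<phi> \<Phi>. norm (\<psi> (x - c)) < e" if x: "x \<in> B" for x
    proof -
      obtain d where d: "d \<in> D" "norm (\<phi> x - d) < e / 2" using D(3)[of "\<phi> x"] x by auto
      then obtain c where c: "c \<in> C d" "\<forall>\<phi>\<in>\<Phi>. norm (\<phi> (x - c)) < e" using C(3)[of x d] x by auto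
      have "norm (\<phi> c - d) < e / 2" using C(2) c(1) by blast
      with d(2) have "norm (\<phi> x - \<phi> c) < e"
        using norm_triangle_ineq4[of "\<phi> x - d" "\<phi> c - d"] by simp
      then show ?thesis
        using c d(1) topological_dual_diff[OF dual, of \<phi> x c]
        by (intro bexI[of _ c] ballI) (auto simp: insert_iff)
    qed
    moreover have "finite (\<Union>d\<in>D. C d)" "(\<Union>d\<in>D. C d) \<subseteq> B"
      using D(1) C by auto
    ultimately show ?case by blast
  qed
  then show ?thesis using that by blast
qed

text \<open>The filter of weak neighbourhoods of \<open>x\<close>, restricted to a ball, is one of
  the filters in the definition of weak continuity. An event of this filter is already forced by
  finitely many of its basic sets.\<close>

lemma weakly_continuous_on_boundedD:
  assumes "weakly_continuous_on_bounded s Q" "0 < e"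
  obtains \<Phi> \<delta> where "finite \<Phi>" "\<Phi> \<subseteq> topological_dual s" "0 < \<delta>"
    "\<And>y. norm y \<le> R \<Longrightarrow> (\<forall>\<phi>\<in>\<Phi>. norm (\<phi> (y - x)) < \<delta>) \<Longrightarrow> norm (Q y - Q x) < e"
proof -
  let ?I = "topological_dual s \<times> {0 :: real<..}"
  let ?V = "\<lambda>p. {y. norm (fst p (y - x)) < snd p}"
  let ?F = "INF p\<in>?I. principal (?V p)"
  have "weakly_tendsto s (\<lambda>y. y) x (inf ?F (principal (cball 0 R)))"
    unfolding weakly_tendsto_def
  proof (intro allI impI tendstoI)
    fix \<phi> :: "'b \<Rightarrow> 'a" and r :: real
    assume \<phi>: "Vector_Spaces.linear s (*) \<phi>" "bounded_linear \<phi>" and r: "0 < r"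
    then have p: "(\<phi>, r) \<in> ?I" by (simp add: topological_dual_def)
    have "\<forall>\<^sub>F y in principal (?V (\<phi>, r)). dist (\<phi> y) (\<phi> x) < r"
      using \<phi> by (simp add: eventually_principal dist_norm bounded_linear.linear linear_diff)
    moreover have "inf ?F (principal (cball 0 R)) \<le> principal (?V (\<phi>, r))"
      by (rule le_infI1[OF INF_lower[OF p]])
    ultimately show "\<forall>\<^sub>F y in inf ?F (principal (cball 0 R)). dist (\<phi> y) (\<phi> x) < r"
      using filter_leD by blast
  qed
  moreover have "\<forall>\<^sub>F y in inf ?F (principal (cball 0 R)). y \<in> cball 0 R"
    by (simp add: eventually_inf_principal)
  ultimately have "((\<lambda>y. norm (Q y - Q x)) \<longlongrightarrow> 0) (inf ?F (principal (cball 0 R)))"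
    using assms(1) bounded_cball unfolding weakly_continuous_on_bounded_def by blast
  then have "\<forall>\<^sub>F y in inf ?F (principal (cball 0 R)). norm (Q y - Q x) < e"
    using assms(2) by (auto dest: order_tendstoD)
  then have "\<forall>\<^sub>F y in ?F. y \<in> cball 0 R \<longrightarrow> norm (Q y - Q x) < e"
    by (simp add: eventually_inf_principal)
  then obtain I where I: "finite I" "I \<subseteq> ?I"
    and "\<forall>\<^sub>F y in (INF p\<in>I. principal (?V p)). y \<in> cball 0 R \<longrightarrow> norm (Q y - Q x) < e"
    unfolding eventually_INF[of _ _ ?I] by blast
  then have Q: "norm (Q y - Q x) < e" if "\<forall>p\<in>I. y \<in> ?V p" "norm y \<le> R" for y
    using that by (auto simp: INF_principal_finite eventually_principal)
  \<comment> \<open>The inserted 1 covers an empty \<open>I\<close>.\<close>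
  define \<delta> where "\<delta> = Min (insert 1 (snd ` I))"
  show ?thesis
  proof (rule that[of "fst ` I" \<delta>])
    show "fst ` I \<subseteq> topological_dual s" using I(2) by auto
    show "0 < \<delta>" using I by (auto simp: \<delta>_def)
    have le: "\<delta> \<le> snd p" if "p \<in> I" for p using I(1) that by (simp add: \<delta>_def)
    show "norm (Q y - Q x) < e" if "norm y \<le> R" "\<forall>\<phi>\<in>fst ` I. norm (\<phi> (y - x)) < \<delta>" for y
      using that le by (intro Q) (auto intro: less_le_trans)
  qed (use I in simp)
qed

text \<open>Polynomials of degree at most \<open>n\<close> enter through the vanishing of their differences of order \<open>n + 1\<close>.\<close>

fun finite_degree :: "nat \<Rightarrow> ('e::ab_group_add \<Rightarrow> 'f::ab_group_add) \<Rightarrow> bool" where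
  "finite_degree 0 Q \<longleftrightarrow> (\<forall>x y. Q x = Q y)"
| "finite_degree (Suc n) Q \<longleftrightarrow> (\<forall>h. finite_degree n (\<lambda>x. Q (x + h) - Q x))"

lemma finite_degree_zero: "finite_degree n (\<lambda>x. 0)"
  by (induction n) auto

lemma finite_degree_add:
  "finite_degree n Q \<Longrightarrow> finite_degree n Q' \<Longrightarrow> finite_degree n (\<lambda>x. Q x + Q' x)"
proof (induction n arbitrary: Q Q')
  case 0 then show ?case unfolding finite_degree.simps by metis
next
  case (Suc n)
  have "finite_degree n (\<lambda>x. (Q (x + h) - Q x) + (Q' (x + h) - Q' x))" for h
    using Suc.prems by (intro Suc.IH) auto
  then show ?case by (simp add: algebra_simps)
qed

lemma finite_degree_sum:
  "(\<And>i. i \<in> I \<Longrightarrow> finite_degree n (Q i)) \<Longrightarrow> finite_degree n (\<lambda>x. \<Sum>i\<in>I. Q i x)"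
  by (induction I rule: infinite_finite_induct) (auto simp: finite_degree_zero finite_degree_add)

definition weakly_uniformly_continuous ::
  "('k::real_or_complex \<Rightarrow> 'e::real_normed_vector \<Rightarrow> 'e) \<Rightarrow> ('e \<Rightarrow> 'f::real_normed_vector) \<Rightarrow> bool"
  where "weakly_uniformly_continuous s Q \<longleftrightarrow> (\<forall>R. \<forall>e>0. \<exists>\<Phi> \<delta>. finite \<Phi> \<and> \<Phi> \<subseteq> topological_dual s \<and> 0 < \<delta> \<and>
    (\<forall>x y. norm x \<le> R \<longrightarrow> norm y \<le> R \<longrightarrow> (\<forall>\<phi>\<in>\<Phi>. norm (\<phi> (y - x)) < \<delta>) \<longrightarrow> norm (Q y - Q x) < e))"

text \<open>For \<open>x = c + w\<close> and \<open>y = c + w + v\<close> with \<open>w\<close>, \<open>v\<close> weakly small and \<open>c\<close> in a finite weak net,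
  \<open>Q y - Q x\<close> is an increment of \<open>z \<mapsto> Q (z + c) - Q z\<close>, which has lower degree, plus
  \<open>Q (w + v) - Q w\<close>, which is small by the weak continuity of \<open>Q\<close> at \<open>0\<close>.\<close>

theorem weakly_uniformly_continuous_finite_degree:
  fixes s :: "'k::real_or_complex \<Rightarrow> 'e::real_normed_vector \<Rightarrow> 'e"
    and Q :: "'e \<Rightarrow> 'f::real_normed_vector"
  assumes "finite_degree n Q"
    and "\<And>x R e. 0 < e \<Longrightarrow> \<exists>\<Phi> \<delta>. finite \<Phi> \<and> \<Phi> \<subseteq> topological_dual s \<and> 0 < \<delta> \<and>
      (\<forall>y. norm y \<le> R \<longrightarrow> (\<forall>\<phi>\<in>\<Phi>. norm (\<phi> (y - x)) < \<delta>) \<longrightarrow> norm (Q y - Q x) < (e::real))"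
  shows "weakly_uniformly_continuous s Q"
  using assms
proof (induction n arbitrary: Q)
  case 0
  then have const: "Q y - Q x = 0" for x y by simp
  show ?case
    unfolding weakly_uniformly_continuous_def const
    by (auto intro!: exI[of _ "{} :: ('e \<Rightarrow> 'k) set"] exI[of _ "1 :: real"])
next
  case (Suc n)
  have IH: "weakly_uniformly_continuous s (\<lambda>x. Q (x + h) - Q x)" for h
  proof (rule Suc.IH)
    show "finite_degree n (\<lambda>x. Q (x + h) - Q x)" using Suc.prems(1) by simp
    fix x and R e :: real assume e: "0 < e"
    obtain \<Phi> \<delta> where 1: "finite \<Phi>" "\<Phi> \<subseteq> topological_dual s" "0 < \<delta>"
      "\<And>y. norm y \<le> R \<Longrightarrow> (\<forall>\<phi>\<in>\<Phi>. norm (\<phi> (y - x)) < \<delta>) \<Longrightarrow> norm (Q y - Q x) < e / 2"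
      using Suc.prems(2)[of "e / 2" R x] e by auto
    \<comment> \<open>Translating by \<open>h\<close> enlarges the ball by \<open>norm h\<close>;
      the increment inherits weak continuity from the two points \<open>x\<close> and
      \<open>x + h\<close>.\<close>
    obtain \<Phi>' \<delta>' where 2: "finite \<Phi>'" "\<Phi>' \<subseteq> topological_dual s" "0 < \<delta>'"
      "\<And>y. norm y \<le> R + norm h \<Longrightarrow> (\<forall>\<phi>\<in>\<Phi>'. norm (\<phi> (y - (x + h))) < \<delta>') \<Longrightarrow> norm (Q y - Q (x + h)) < e / 2"
      using Suc.prems(2)[of "e / 2" "R + norm h" "x + h"] e by auto
    show "\<exists>\<Phi> \<delta>. finite \<Phi> \<and> \<Phi> \<subseteq> topological_dual s \<and> 0 < \<delta> \<and>
      (\<forall>y. norm y \<le> R \<longrightarrow> (\<forall>\<phi>\<in>\<Phi>. norm (\<phi> (y - x)) < \<delta>) \<longrightarrow>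
        norm (Q (y + h) - Q y - (Q (x + h) - Q x)) < e)"
    proof (intro exI[of _ "\<Phi> \<union> \<Phi>'"] exI[of _ "min \<delta> \<delta>'"] conjI allI impI)
      fix y assume y: "norm y \<le> R" "\<forall>\<phi>\<in>\<Phi> \<union> \<Phi>'. norm (\<phi> (y - x)) < min \<delta> \<delta>'"
      have "norm (Q y - Q x) < e / 2" using y by (intro 1) auto
      moreover have "norm (Q (y + h) - Q (x + h)) < e / 2"
        using y norm_triangle_ineq[of y h] by (intro 2) auto
      ultimately show "norm (Q (y + h) - Q y - (Q (x + h) - Q x)) < e"
        using norm_triangle_ineq4[of "Q (y + h) - Q (x + h)" "Q y - Q x"] by (simp add: algebra_simps)
    qed (use 1 2 in auto)
  qed
  show ?case
    unfolding weakly_uniformly_continuous_def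
  proof (intro allI impI)
    fix R e :: real assume e: "0 < e"
    \<comment> \<open>The radius \<open>2 * R\<close> accommodates \<open>x - c\<close> and
      \<open>y - c\<close>. The three shares of \<open>e\<close> go to the increment by
      \<open>c\<close> and to the distances of \<open>Q (x - c)\<close> and \<open>Q (y - c)\<close>
      from \<open>Q 0\<close>; halving \<open>\<delta>0\<close> for the net leaves room for
      \<open>y - x\<close>.\<close>
    obtain \<Phi>0 \<delta>0 where 0: "finite \<Phi>0" "\<Phi>0 \<subseteq> topological_dual s" "0 < \<delta>0"
      "\<And>y. norm y \<le> 2 * R \<Longrightarrow> (\<forall>\<phi>\<in>\<Phi>0. norm (\<phi> y) < \<delta>0) \<Longrightarrow> norm (Q y - Q 0) < e / 3"
      using Suc.prems(2)[of "e / 3" "2 * R" 0] e by auto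
    obtain C where C: "finite C" "C \<subseteq> cball 0 R"
      "\<And>x. x \<in> cball 0 R \<Longrightarrow> \<exists>c\<in>C. \<forall>\<phi>\<in>\<Phi>0. norm (\<phi> (x - c)) < \<delta>0 / 2"
      using weakly_totally_bounded[OF 0(1,2), of "cball 0 R" "\<delta>0 / 2"] 0(3) by auto
    have "\<exists>\<Phi> \<delta>. finite \<Phi> \<and> \<Phi> \<subseteq> topological_dual s \<and> 0 < \<delta> \<and>
      (\<forall>x y. norm x \<le> 2 * R \<longrightarrow> norm y \<le> 2 * R \<longrightarrow> (\<forall>\<phi>\<in>\<Phi>. norm (\<phi> (y - x)) < \<delta>) \<longrightarrow>
        norm ((Q (y + c) - Q y) - (Q (x + c) - Q x)) < e / 3)" for c
      using IH[of c, unfolded weakly_uniformly_continuous_def, rule_format, of "e / 3" "2 * R"] e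
      by (simp only: divide_pos_pos zero_less_numeral simp_thms)
    then obtain \<Phi> \<delta> where 1: "\<And>c. finite (\<Phi> c)" "\<And>c. \<Phi> c \<subseteq> topological_dual s" "\<And>c. 0 < \<delta> c"
      "\<And>c x y. norm x \<le> 2 * R \<Longrightarrow> norm y \<le> 2 * R \<Longrightarrow> \<forall>\<phi>\<in>\<Phi> c. norm (\<phi> (y - x)) < \<delta> c \<Longrightarrow>
        norm ((Q (y + c) - Q y) - (Q (x + c) - Q x)) < e / 3"
      by metis
    define d where "d = Min (insert (\<delta>0 / 2) (\<delta> ` C))"
    have d: "0 < d" "d \<le> \<delta>0 / 2" "\<And>c. c \<in> C \<Longrightarrow> d \<le> \<delta> c"
    proof -
      show "0 < d" using C(1) 0(3) 1(3) by (simp add: d_def)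
      show "d \<le> \<delta>0 / 2" "\<And>c. c \<in> C \<Longrightarrow> d \<le> \<delta> c"
        unfolding d_def by (rule Min_le; simp add: C(1))+
    qed
    show "\<exists>\<Phi> \<delta>. finite \<Phi> \<and> \<Phi> \<subseteq> topological_dual s \<and> 0 < \<delta> \<and>
      (\<forall>x y. norm x \<le> R \<longrightarrow> norm y \<le> R \<longrightarrow> (\<forall>\<phi>\<in>\<Phi>. norm (\<phi> (y - x)) < \<delta>) \<longrightarrow> norm (Q y - Q x) < e)"
    proof (intro exI[of _ "\<Phi>0 \<union> (\<Union>c\<in>C. \<Phi> c)"] exI[of _ d] conjI allI impI)
      fix x y assume xy: "norm x \<le> R" "norm y \<le> R"
        "\<forall>\<phi>\<in>\<Phi>0 \<union> (\<Union>c\<in>C. \<Phi> c). norm (\<phi> (y - x)) < d"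
      obtain c where c: "c \<in> C" "\<forall>\<phi>\<in>\<Phi>0. norm (\<phi> (x - c)) < \<delta>0 / 2" using C(3)[of x] xy by auto
      have "norm c \<le> R" using c C(2) by auto
      then have small: "norm (x - c) \<le> 2 * R" "norm (y - c) \<le> 2 * R"
        using xy norm_triangle_ineq4[of x c] norm_triangle_ineq4[of y c] by auto
      have "norm (\<phi> (y - c)) < \<delta>0" if "\<phi> \<in> \<Phi>0" for \<phi>
      proof -
        have "\<phi> (y - c) = \<phi> (y - x) + \<phi> (x - c)"
          using topological_dual_add[of \<phi> s "y - x" "x - c"] that 0(2) by auto
        moreover have "norm (\<phi> (y - x)) < \<delta>0 / 2" using xy(3) that d(2) by force
        ultimately show ?thesis
          using c(2) that norm_triangle_ineq[of "\<phi> (y - x)" "\<phi> (x - c)"] by fastforce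
      qed
      then have a: "norm (Q (y - c) - Q 0) < e / 3" using small by (intro 0) auto
      have "norm (\<phi> (x - c)) < \<delta>0" if "\<phi> \<in> \<Phi>0" for \<phi> using c(2) that 0(3) by force
      then have b: "norm (Q (x - c) - Q 0) < e / 3" using small by (intro 0) auto
      have "norm ((Q (y - c + c) - Q (y - c)) - (Q (x - c + c) - Q (x - c))) < e / 3"
        using small c(1) xy(3) d(3) by (intro 1) (auto intro: less_le_trans)
      then have "norm ((Q y - Q (y - c)) - (Q x - Q (x - c))) < e / 3" by simp
      moreover have "norm (Q y - Q x)
          = norm (((Q y - Q (y - c)) - (Q x - Q (x - c))) + ((Q (y - c) - Q 0) - (Q (x - c) - Q 0)))"
        by simp
      ultimately show "norm (Q y - Q x) < e"
        using a b norm_triangle_ineq[of "(Q y - Q (y - c)) - (Q x - Q (x - c))" "(Q (y - c) - Q 0) - (Q (x - c) - Q 0)"]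
          norm_triangle_ineq4[of "Q (y - c) - Q 0" "Q (x - c) - Q 0"]
        by linarith
    qed (use 0(1,2) 1(1) subsetD[OF 1(2)] C(1) d(1) in auto)
  qed
qed

section \<open>Differences of multilinear maps\<close>

lemma multilinear_map_add:
  "multilinear_map n s t A \<Longrightarrow> length xs = n \<Longrightarrow> i < n \<Longrightarrow> A (xs[i := x + y]) = A (xs[i := x]) + A (xs[i := y])"
  and multilinear_map_scale:
  "multilinear_map n s t A \<Longrightarrow> length xs = n \<Longrightarrow> i < n \<Longrightarrow> A (xs[i := s c x]) = t c (A (xs[i := x]))"
  by (auto simp: multilinear_map_def Vector_Spaces.linear_iff)

lemma multilinear_map_diff:
  "multilinear_map n s t A \<Longrightarrow> length xs = n \<Longrightarrow> i < n \<Longrightarrow> A (xs[i := x - y]) = A (xs[i := x]) - A (xs[i := y])"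
  using multilinear_map_add[of n s t A xs i "x - y" y] by simp

lemma multilinear_map_zero:
  "multilinear_map n s t A \<Longrightarrow> length xs = n \<Longrightarrow> i < n \<Longrightarrow> A (xs[i := 0]) = 0"
  using multilinear_map_diff[of n s t A xs i 0 0] by simp

text \<open>The slots are constants or translations because this class is stable under differencing:
  the increment of a translation is the constant \<open>h\<close>. A difference telescopes over the
  slots, and each nonzero term has one nonconstant slot fewer, which is what \<open>I\<close>
  counts.\<close>

lemma finite_degree_multilinear:
  assumes A: "multilinear_map n s t A" and "length fs = n"
    and "\<And>i. i < n \<Longrightarrow> (\<exists>c. fs ! i = (\<lambda>x. c)) \<or> (\<exists>c. fs ! i = (\<lambda>x. x + c))"
    and "finite I" "card I \<le> k" "\<And>i. i < n \<Longrightarrow> i \<notin> I \<Longrightarrow> \<exists>c. fs ! i = (\<lambda>x. c)"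
  shows "finite_degree k (\<lambda>x. A (map (\<lambda>f. f x) fs))"
  using assms(2-)
proof (induction k arbitrary: fs I)
  case 0
  have "map (\<lambda>f. f x) fs = map (\<lambda>f. f y) fs" for x y
  proof (rule nth_equalityI)
    fix i assume i: "i < length (map (\<lambda>f. f x) fs)"
    then obtain c where "fs ! i = (\<lambda>x. c)" using 0 by (metis card_0_eq empty_iff le_zero_eq length_map)
    then show "map (\<lambda>f. f x) fs ! i = map (\<lambda>f. f y) fs ! i" using i by simp
  qed simp
  then show ?case unfolding finite_degree.simps by metis
next
  case (Suc k)
  show ?case unfolding finite_degree.simps
  proof
    fix h
    \<comment> \<open>\<open>w i\<close> has its first \<open>i\<close> slots shifted by
      \<open>h\<close>, and \<open>g i\<close> carries the increment in slot \<open>i\<close>; it is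
      the difference of \<open>w (Suc i)\<close> and \<open>w i\<close> after applying
      \<open>A\<close>.\<close>
    define w where "w i = map (\<lambda>f x. f (x + h)) (take i fs) @ drop i fs" for i
    define g where "g i = (w i)[i := \<lambda>x. (fs ! i) (x + h) - (fs ! i) x]" for i
    have len: "length (w i) = n" if "i \<le> n" for i using that Suc.prems(1) by (simp add: w_def)
    have nth_w: "w i ! j = (if j < i then (\<lambda>x. (fs ! j) (x + h)) else fs ! j)" if "i \<le> n" "j < n" for i j
      using that Suc.prems(1) by (auto simp: w_def nth_append)
    have deg: "finite_degree k (\<lambda>x. A (map (\<lambda>f. f x) (g i)))" if i: "i < n" for i
    proof (cases "i \<in> I")
      case True
      have gi: "\<exists>c. g i ! i = (\<lambda>x. c)"
        using Suc.prems(2)[OF i] i len[of i] by (auto simp: g_def)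
      have gj: "g i ! j = (if j < i then (\<lambda>x. (fs ! j) (x + h)) else fs ! j)" if "j < n" "j \<noteq> i" for j
        using that i nth_w[of i j] by (simp add: g_def)
      show ?thesis
      proof (rule Suc.IH[of _ "I - {i}"])
        show "length (g i) = n" using len[of i] i by (simp add: g_def)
        show "(\<exists>c. g i ! j = (\<lambda>x. c)) \<or> (\<exists>c. g i ! j = (\<lambda>x. x + c))" if "j < n" for j
          using gi gj[OF that] Suc.prems(2)[OF that]
          by (cases "j = i") (auto simp: add.assoc add.commute[of h])
        show "\<exists>c. g i ! j = (\<lambda>x. c)" if "j < n" "j \<notin> I - {i}" for j
          using gi gj[OF that(1)] Suc.prems(5)[OF that(1)] that(2) by (cases "j = i") auto
      qed (use Suc.prems(3,4) True in auto)
    next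
      case False
      \<comment> \<open>A constant slot has increment 0, so the term vanishes by
        multilinearity.\<close>
      then obtain c where "fs ! i = (\<lambda>x. c)" using Suc.prems(5)[OF i] by blast
      then have "map (\<lambda>f. f x) (g i) = (map (\<lambda>f. f x) (w i))[i := 0]" for x
        by (simp add: g_def map_update)
      then have "A (map (\<lambda>f. f x) (g i)) = 0" for x
        using multilinear_map_zero[OF A, of "map (\<lambda>f. f x) (w i)" i] len[of i] i by simp
      then show ?thesis by (simp add: finite_degree_zero)
    qed
    have "A (map (\<lambda>f. f (x + h)) fs) - A (map (\<lambda>f. f x) fs) = (\<Sum>i<n. A (map (\<lambda>f. f x) (g i)))" for x
    proof -
      have "A (map (\<lambda>f. f x) (g i)) = A (map (\<lambda>f. f x) (w (Suc i))) - A (map (\<lambda>f. f x) (w i))" if i: "i < n" for i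
      proof -
        let ?w = "map (\<lambda>f. f x) (w i)"
        have 1: "?w[i := (fs ! i) (x + h)] = map (\<lambda>f. f x) (w (Suc i))"
          using i len[of i] len[of "Suc i"] nth_w[of i] nth_w[of "Suc i"]
          by (intro nth_equalityI) (auto simp: nth_list_update less_Suc_eq)
        have 2: "?w[i := (fs ! i) x] = ?w"
          using i len[of i] nth_w[of i i] by (intro list_update_same_conv[THEN iffD2]) auto
        have "map (\<lambda>f. f x) (g i) = ?w[i := (fs ! i) (x + h) - (fs ! i) x]"
          by (simp add: g_def map_update)
        then show ?thesis
          using multilinear_map_diff[OF A, of ?w i "(fs ! i) (x + h)" "(fs ! i) x"] i len[of i] 1 2 by simp
      qed
      then have "(\<Sum>i<n. A (map (\<lambda>f. f x) (g i))) = A (map (\<lambda>f. f x) (w n)) - A (map (\<lambda>f. f x) (w 0))"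
        by (simp add: sum_lessThan_telescope[of "\<lambda>i. A (map (\<lambda>f. f x) (w i))"])
      then show ?thesis using Suc.prems(1) by (simp add: w_def comp_def)
    qed
    then show "finite_degree k (\<lambda>x. A (map (\<lambda>f. f (x + h)) fs) - A (map (\<lambda>f. f x) fs))"
      using deg by (auto intro: finite_degree_sum)
  qed
qed

lemma finite_degree_hom_poly: "P \<in> hom_polys n s t \<Longrightarrow> finite_degree n P"
proof -
  assume "P \<in> hom_polys n s t"
  then obtain A where A: "multilinear_map n s t A" "\<And>x. P x = A (replicate n x)"
    by (auto simp: hom_polys_def)
  have "finite_degree n (\<lambda>x. A (map (\<lambda>f. f x) (replicate n (\<lambda>x. x))))"
    by (rule finite_degree_multilinear[OF A(1), where I = "{..<n}"]) (auto intro: exI[of _ 0])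
  moreover have "P = (\<lambda>x. A (map (\<lambda>f. f x) (replicate n (\<lambda>x. x))))"
    by (simp add: A(2) fun_eq_iff)
  ultimately show ?thesis by (simp only:)
qed

text \<open>Uniform weak continuity carries a finite weak net of the unit ball to a finite norm net
  of its image.\<close>

lemma wc_hom_poly_totally_bounded:
  fixes s :: "'k::real_or_complex \<Rightarrow> 'e::real_normed_vector \<Rightarrow> 'e"
    and P :: "'e \<Rightarrow> 'f::real_normed_vector" and e :: real
  assumes "P \<in> wc_hom_polys n s t" "0 < e"
  obtains C where "finite C" "\<And>x. norm x \<le> 1 \<Longrightarrow> \<exists>c\<in>C. norm (P x - P c) < e"
proof -
  have "weakly_uniformly_continuous s P"
  proof (rule weakly_uniformly_continuous_finite_degree)
    show "finite_degree n P" using assms(1) by (auto simp: wc_hom_polys_def intro: finite_degree_hom_poly)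
    have P: "weakly_continuous_on_bounded s P" using assms(1) by (simp add: wc_hom_polys_def)
    show "\<exists>\<Phi> \<delta>. finite \<Phi> \<and> \<Phi> \<subseteq> topological_dual s \<and> 0 < \<delta> \<and>
      (\<forall>y. norm y \<le> R \<longrightarrow> (\<forall>\<phi>\<in>\<Phi>. norm (\<phi> (y - x)) < \<delta>) \<longrightarrow> norm (P y - P x) < e)"
      if "0 < e" for x and R e :: real
      using weakly_continuous_on_boundedD[OF P that, of R x] by metis
  qed
  then have "\<exists>\<Phi> \<delta>. finite \<Phi> \<and> \<Phi> \<subseteq> topological_dual s \<and> 0 < \<delta> \<and>
    (\<forall>x y. norm x \<le> 1 \<longrightarrow> norm y \<le> 1 \<longrightarrow> (\<forall>\<phi>\<in>\<Phi>. norm (\<phi> (y - x)) < \<delta>) \<longrightarrow> norm (P y - P x) < e)"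
    using assms(2) unfolding weakly_uniformly_continuous_def by blast
  then obtain \<Phi> \<delta> where 1: "finite \<Phi>" "\<Phi> \<subseteq> topological_dual s" "0 < \<delta>"
    "\<And>x y. norm x \<le> 1 \<Longrightarrow> norm y \<le> 1 \<Longrightarrow> (\<forall>\<phi>\<in>\<Phi>. norm (\<phi> (y - x)) < \<delta>) \<Longrightarrow> norm (P y - P x) < e"
    by metis
  obtain C where C: "finite C" "C \<subseteq> cball 0 1" "\<And>x. x \<in> cball 0 1 \<Longrightarrow> \<exists>c\<in>C. \<forall>\<phi>\<in>\<Phi>. norm (\<phi> (x - c)) < \<delta>"
    using weakly_totally_bounded[OF 1(1,2) bounded_cball 1(3)] by blast
  show ?thesis
  proof (rule that[OF C(1)])
    fix x :: 'e assume x: "norm x \<le> 1"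
    then obtain c where c: "c \<in> C" "\<forall>\<phi>\<in>\<Phi>. norm (\<phi> (x - c)) < \<delta>" using C(3) by auto
    with C(2) x show "\<exists>c\<in>C. norm (P x - P c) < e" by (intro bexI[OF _ c(1)] 1(4)) auto
  qed
qed

section \<open>Spaces of polynomials\<close>

lemma multilinear_map_sum:
  assumes A: "multilinear_map n s t A" and "length xs = n" "i < n"
  shows "A (xs[i := \<Sum>j\<in>T. z j]) = (\<Sum>j\<in>T. A (xs[i := z j]))"
  by (induction T rule: infinite_finite_induct)
    (simp_all add: multilinear_map_add[OF assms] multilinear_map_zero[OF assms])

text \<open>The fixed entries \<open>ys\<close> outside \<open>I\<close> make the induction work:
  after slot \<open>a\<close> is expanded, each \<open>z j\<close> becomes such an entry.\<close>

lemma multilinear_map_expand: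
  assumes A: "multilinear_map n s t A" and "finite I" "I \<subseteq> {..<n}" "finite T" "length ys = n"
  shows "A (map (\<lambda>i. if i \<in> I then \<Sum>j\<in>T. z j else ys ! i) [0..<n])
    = (\<Sum>f\<in>I \<rightarrow>\<^sub>E T. A (map (\<lambda>i. if i \<in> I then z (f i) else ys ! i) [0..<n]))"
  using assms(2,3,5)
proof (induction I arbitrary: ys)
  case empty
  then show ?case by simp
next
  case (insert a I)
  have a: "a < n" using insert.prems by simp
  let ?L = "map (\<lambda>i. if i \<in> I then \<Sum>j\<in>T. z j else ys ! i) [0..<n]"
  have "map (\<lambda>i. if i \<in> insert a I then \<Sum>j\<in>T. z j else ys ! i) [0..<n] = ?L[a := \<Sum>j\<in>T. z j]"
    using a by (intro nth_equalityI) (auto simp: nth_list_update)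
  then have "A (map (\<lambda>i. if i \<in> insert a I then \<Sum>j\<in>T. z j else ys ! i) [0..<n])
      = (\<Sum>j\<in>T. A (?L[a := z j]))"
    using multilinear_map_sum[OF A _ a, of ?L] by simp
  also have "\<dots> = (\<Sum>j\<in>T. \<Sum>f\<in>I \<rightarrow>\<^sub>E T. A (map (\<lambda>i. if i \<in> I then z (f i) else ys[a := z j] ! i) [0..<n]))"
  proof (rule sum.cong[OF refl])
    fix j
    have "?L[a := z j] = map (\<lambda>i. if i \<in> I then \<Sum>j\<in>T. z j else ys[a := z j] ! i) [0..<n]"
      using insert.hyps a insert.prems(2) by (intro nth_equalityI) (auto simp: nth_list_update)
    then show "A (?L[a := z j]) = (\<Sum>f\<in>I \<rightarrow>\<^sub>E T. A (map (\<lambda>i. if i \<in> I then z (f i) else ys[a := z j] ! i) [0..<n]))"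
      using insert.IH[of "ys[a := z j]"] insert.prems by simp
  qed
  also have "\<dots> = (\<Sum>(j, f)\<in>T \<times> (I \<rightarrow>\<^sub>E T). A (map (\<lambda>i. if i \<in> insert a I then z ((f(a := j)) i) else ys ! i) [0..<n]))"
    unfolding sum.cartesian_product
  proof (rule sum.cong[OF refl], clarify)
    fix j f
    have "map (\<lambda>i. if i \<in> I then z (f i) else ys[a := z j] ! i) [0..<n]
        = map (\<lambda>i. if i \<in> insert a I then z ((f(a := j)) i) else ys ! i) [0..<n]"
      using insert.hyps a insert.prems(2) by (intro nth_equalityI) (auto simp: nth_list_update)
    then show "A (map (\<lambda>i. if i \<in> I then z (f i) else ys[a := z j] ! i) [0..<n])
        = A (map (\<lambda>i. if i \<in> insert a I then z ((f(a := j)) i) else ys ! i) [0..<n])" by (simp only:)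
  qed
  also have "\<dots> = (\<Sum>f\<in>insert a I \<rightarrow>\<^sub>E T. A (map (\<lambda>i. if i \<in> insert a I then z (f i) else ys ! i) [0..<n]))"
    unfolding PiE_insert_eq using insert.hyps(2)
    by (subst sum.reindex[OF inj_combinator]) (auto simp: case_prod_unfold)
  finally show ?case .
qed

text \<open>This is the expansion of the product of \<open>1 + g i\<close> over \<open>U\<close>,
  where \<open>g\<close> is 0 on \<open>R\<close> and -1 elsewhere. Sets \<open>T\<close> that miss
  a point of \<open>R\<close> contribute nothing, and the product has a factor 0 unless
  \<open>R = U\<close>.\<close>

lemma sum_supersets_sign:
  assumes "finite U" "R \<subseteq> U"
  shows "(\<Sum>T\<in>Pow U. if R \<subseteq> T then (-1) ^ card (U - T) else 0) = (if R = U then 1 else 0 :: real)"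
proof -
  define g where "g i = (if i \<in> R then 0 else - 1 :: real)" for i
  have "(\<Sum>T\<in>Pow U. if R \<subseteq> T then (-1) ^ card (U - T) else 0) = (\<Sum>T\<in>Pow U. (\<Prod>i\<in>T. 1) * (\<Prod>i\<in>U - T. g i))"
  proof (rule sum.cong[OF refl])
    fix T assume T: "T \<in> Pow U"
    show "(if R \<subseteq> T then (-1) ^ card (U - T) else 0) = (\<Prod>i\<in>T. 1) * (\<Prod>i\<in>U - T. g i)"
    proof (cases "R \<subseteq> T")
      case True
      then have "(\<Prod>i\<in>U - T. g i) = (\<Prod>i\<in>U - T. - 1)"
        by (intro prod.cong) (auto simp: g_def)
      with True show ?thesis by simp
    next
      case False
      then have "\<exists>i\<in>U - T. g i = 0" using assms(2) by (auto simp: g_def)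
      with False show ?thesis using assms(1) by (simp add: prod_zero)
    qed
  qed
  also have "\<dots> = (\<Prod>i\<in>U. 1 + g i)"
    by (rule prod_add[symmetric]) (rule assms)
  also have "\<dots> = (if R = U then 1 else 0)"
  proof (cases "R = U")
    case False
    then have "\<exists>i\<in>U. 1 + g i = 0" using assms(2) by (auto simp: g_def)
    with False show ?thesis using assms(1) by (simp add: prod_zero)
  qed (simp add: g_def)
  finally show ?thesis .
qed

text \<open>The polarization formula without the factor \<open>1 / n!\<close>. It refers to
  \<open>P\<close> alone and to finitely many of its values, so it passes to pointwise
  limits.\<close>

definition polarization :: "nat \<Rightarrow> ('e::real_vector \<Rightarrow> 'f::real_vector) \<Rightarrow> 'e list \<Rightarrow> 'f"
  where "polarization n P xs =
    (\<Sum>T\<in>Pow {..<n}. (-1) ^ card ({..<n} - T) *\<^sub>R P (\<Sum>i\<in>T. xs ! i))"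

text \<open>These are the permutations of \<open>{..<n}\<close>, described by surjectivity because
  that is the condition which survives inclusion-exclusion.\<close>

definition onto_maps :: "nat \<Rightarrow> (nat \<Rightarrow> nat) set"
  where "onto_maps n = {f \<in> {..<n} \<rightarrow>\<^sub>E {..<n}. f ` {..<n} = {..<n}}"

lemma finite_onto_maps: "finite (onto_maps n)"
  unfolding onto_maps_def by (rule finite_subset[of _ "{..<n} \<rightarrow>\<^sub>E {..<n}"]) (auto intro: finite_PiE)

lemma card_onto_maps: "0 < card (onto_maps n)"
proof -
  have "restrict (\<lambda>i. i) {..<n} \<in> onto_maps n" by (auto simp: onto_maps_def)
  then show ?thesis using finite_onto_maps by (auto simp: card_gt_0_iff)
qed

text \<open>In the expansion of \<open>P\<close> at the sum over \<open>T\<close> exactly the maps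
  with values in \<open>T\<close> occur. The alternating sum over \<open>T\<close> cancels every map
  that is not onto.\<close>

lemma polarization_eq:
  assumes A: "multilinear_map n s t A" and P: "\<And>x. P x = A (replicate n x)"
  shows "polarization n P xs = (\<Sum>f\<in>onto_maps n. A (map (\<lambda>i. xs ! f i) [0..<n]))"
proof -
  let ?U = "{..<n}" and ?B = "\<lambda>f. A (map (\<lambda>i. xs ! f i) [0..<n])"
  have P_eq: "P (\<Sum>i\<in>T. xs ! i) = (\<Sum>f\<in>?U \<rightarrow>\<^sub>E ?U. if f ` ?U \<subseteq> T then ?B f else 0)" if T: "T \<in> Pow ?U" for T
  proof -
    have "finite T" using T by (auto intro: finite_subset)
    have "P (\<Sum>i\<in>T. xs ! i) = A (map (\<lambda>i. if i \<in> ?U then \<Sum>j\<in>T. xs ! j else replicate n 0 ! i) [0..<n])"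
      unfolding P by (rule arg_cong[where f = A], rule nth_equalityI) auto
    also have "\<dots> = (\<Sum>f\<in>?U \<rightarrow>\<^sub>E T. A (map (\<lambda>i. if i \<in> ?U then xs ! f i else replicate n 0 ! i) [0..<n]))"
      by (rule multilinear_map_expand[OF A]) (use \<open>finite T\<close> in auto)
    also have "\<dots> = (\<Sum>f\<in>?U \<rightarrow>\<^sub>E T. ?B f)"
      by (intro sum.cong refl arg_cong[where f = A] map_cong) auto
    also have "?U \<rightarrow>\<^sub>E T = {f \<in> ?U \<rightarrow>\<^sub>E ?U. f ` ?U \<subseteq> T}"
      using T by (auto simp: PiE_def Pi_def extensional_def)
    also have "(\<Sum>f\<in>\<dots>. ?B f) = (\<Sum>f\<in>?U \<rightarrow>\<^sub>E ?U. if f ` ?U \<subseteq> T then ?B f else 0)"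
      by (rule sum.inter_filter) (auto intro: finite_PiE)
    finally show ?thesis .
  qed
  have "polarization n P xs = (\<Sum>T\<in>Pow ?U. \<Sum>f\<in>?U \<rightarrow>\<^sub>E ?U. (if f ` ?U \<subseteq> T then (-1) ^ card (?U - T) else 0) *\<^sub>R ?B f)"
    unfolding polarization_def
    by (intro sum.cong refl) (auto simp: P_eq scaleR_sum_right intro!: sum.cong)
  also have "\<dots> = (\<Sum>f\<in>?U \<rightarrow>\<^sub>E ?U. (\<Sum>T\<in>Pow ?U. if f ` ?U \<subseteq> T then (-1) ^ card (?U - T) else 0) *\<^sub>R ?B f)"
    by (subst sum.swap) (simp add: scaleR_sum_left)
  also have "\<dots> = (\<Sum>f\<in>?U \<rightarrow>\<^sub>E ?U. if f ` ?U = ?U then ?B f else 0)"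
  proof (rule sum.cong[OF refl])
    fix f assume "f \<in> ?U \<rightarrow>\<^sub>E ?U"
    then have "f ` ?U \<subseteq> ?U" by auto
    then show "(\<Sum>T\<in>Pow ?U. if f ` ?U \<subseteq> T then (-1) ^ card (?U - T) else 0) *\<^sub>R ?B f
        = (if f ` ?U = ?U then ?B f else 0)"
      using sum_supersets_sign[of ?U "f ` ?U"] by simp
  qed
  also have "\<dots> = (\<Sum>f\<in>onto_maps n. ?B f)"
    unfolding onto_maps_def by (rule sum.inter_filter[symmetric]) (auto intro: finite_PiE)
  finally show ?thesis .
qed

lemma polarization_replicate:
  assumes "multilinear_map n s t A" "\<And>x. P x = A (replicate n x)"
  shows "polarization n P (replicate n x) = real (card (onto_maps n)) *\<^sub>R P x"
proof -
  have "map (\<lambda>i. replicate n x ! f i) [0..<n] = replicate n x" if "f \<in> onto_maps n" for f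
    using that by (intro nth_equalityI) (auto simp: onto_maps_def PiE_iff)
  then show ?thesis
    by (simp add: polarization_eq[OF assms] assms(2) sum_constant_scaleR)
qed

text \<open>An onto map of a finite set to itself is injective, so each entry of \<open>xs\<close>
  occupies exactly one slot in each summand.\<close>

lemma multilinear_polarization:
  assumes "vector_space s" "vector_space t" and A: "multilinear_map n s t A" and P: "\<And>x. P x = A (replicate n x)"
  shows "multilinear_map n s t (polarization n P)"
proof -
  interpret s: vector_space s by fact
  interpret t: vector_space t by fact
  have slot: "\<exists>k<n. \<forall>x. map (\<lambda>j. xs[i := x] ! f j) [0..<n] = (map (\<lambda>j. xs ! f j) [0..<n])[k := x]"
    if f: "f \<in> onto_maps n" and xs: "length xs = n" "i < n" for f xs i
  proof -
    have inj: "inj_on f {..<n}"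
      using f by (auto simp: onto_maps_def intro: eq_card_imp_inj_on)
    have "i \<in> f ` {..<n}" using f xs(2) by (simp add: onto_maps_def)
    then obtain k where k: "k < n" "f k = i" by auto
    have "map (\<lambda>j. xs[i := x] ! f j) [0..<n] = (map (\<lambda>j. xs ! f j) [0..<n])[k := x]" for x
    proof (rule nth_equalityI)
      fix j assume "j < length (map (\<lambda>j. xs[i := x] ! f j) [0..<n])"
      then have j: "j < n" by simp
      have "f j = i \<longleftrightarrow> j = k" using inj_onD[OF inj, of j k] j k by auto
      then show "map (\<lambda>j. xs[i := x] ! f j) [0..<n] ! j = (map (\<lambda>j. xs ! f j) [0..<n])[k := x] ! j"
        using j k xs by (auto simp: nth_list_update)
    qed simp
    then show ?thesis using k by blast
  qed
  show ?thesis
    unfolding multilinear_map_def Vector_Spaces.linear_iff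
  proof (intro allI impI conjI s.vector_space_axioms t.vector_space_axioms)
    fix xs :: "'b list" and i assume xs: "length xs = n" "i < n"
    show "polarization n P (xs[i := x + y]) = polarization n P (xs[i := x]) + polarization n P (xs[i := y])" for x y
      unfolding polarization_eq[OF A P] sum.distrib[symmetric]
    proof (rule sum.cong[OF refl])
      fix f assume f: "f \<in> onto_maps n"
      show "A (map (\<lambda>j. xs[i := x + y] ! f j) [0..<n])
        = A (map (\<lambda>j. xs[i := x] ! f j) [0..<n]) + A (map (\<lambda>j. xs[i := y] ! f j) [0..<n])"
        using slot[OF f xs] multilinear_map_add[OF A, of "map (\<lambda>j. xs ! f j) [0..<n]"] by auto
    qed
    show "polarization n P (xs[i := s c x]) = t c (polarization n P (xs[i := x]))" for c x
      unfolding polarization_eq[OF A P] t.scale_sum_right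
    proof (rule sum.cong[OF refl])
      fix f assume f: "f \<in> onto_maps n"
      show "A (map (\<lambda>j. xs[i := s c x] ! f j) [0..<n]) = t c (A (map (\<lambda>j. xs[i := x] ! f j) [0..<n]))"
        using slot[OF f xs] multilinear_map_scale[OF A, of "map (\<lambda>j. xs ! f j) [0..<n]"] by auto
    qed
  qed
qed

section \<open>The normed space of homogeneous polynomials\<close>

lemma vector_space_fun_scale: "vector_space s \<Longrightarrow> vector_space (fun_scale s)"
proof -
  assume "vector_space s"
  then interpret vector_space s .
  show ?thesis
    by unfold_locales (auto simp: fun_scale_def fun_eq_iff scale_right_distrib scale_left_distrib)
qed

lemma scaling_continuous: "scaling t \<Longrightarrow> continuous_on UNIV (t c)"
proof -
  assume t: "scaling t"
  then interpret scaling t .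
  have "bounded_linear (t c)"
    by (rule linear_bounded_linearI(2)[OF t t, where C = "norm c"])
      (simp_all add: scale_right_distrib norm_scale mult.commute)
  then show ?thesis by (rule linear_continuous_on)
qed

lemma poly_norm_le: "(\<And>x. norm x \<le> 1 \<Longrightarrow> norm (P x) \<le> c) \<Longrightarrow> poly_norm P \<le> c"
  unfolding poly_norm_def by (rule cSUP_least) auto

context
  fixes sE :: "'k::real_or_complex \<Rightarrow> 'e::real_normed_vector \<Rightarrow> 'e"
    and sF :: "'k \<Rightarrow> 'f::real_normed_vector \<Rightarrow> 'f" and n :: nat
  assumes sE: "scaling sE" and sF: "scaling sF" and n: "n \<ge> 1"
begin

interpretation E: scaling sE by (rule sE)
interpretation F: scaling sF by (rule sF)

private abbreviation (input) "Pn \<equiv> hom_polys n sE sF"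

lemma hom_poly_scale:
  assumes "P \<in> Pn" shows "P (sE c x) = sF (c ^ n) (P x)"
proof -
  obtain A where A: "multilinear_map n sE sF A" and P: "\<And>x. P x = A (replicate n x)"
    using assms by (auto simp: hom_polys_def)
  have "k \<le> n \<Longrightarrow> A (replicate k (sE c x) @ replicate (n - k) x) = sF (c ^ k) (A (replicate n x))" for k
  proof (induction k)
    case (Suc k)
    define m where "m = n - Suc k"
    have m: "n - k = Suc m" using Suc.prems by (simp add: m_def)
    let ?xs = "replicate k (sE c x) @ x # replicate m x"
    have upd: "?xs[k := y] = replicate k (sE c x) @ y # replicate m x" for y
      using list_update_length[of "replicate k (sE c x)" x "replicate m x" y] by simp
    have "A (?xs[k := sE c x]) = sF c (A (?xs[k := x]))"
      using Suc.prems m by (intro multilinear_map_scale[OF A]) auto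
    then show ?case
      using Suc m by (simp add: upd replicate_app_Cons_same flip: m_def)
  qed simp
  from this[of n] show ?thesis by (simp add: P)
qed

lemma hom_poly_zero: "P \<in> Pn \<Longrightarrow> P 0 = 0"
  using hom_poly_scale[of P 0 0] n by (simp add: power_0_left)

lemma hom_poly_norm_le:
  assumes P: "P \<in> Pn" and "\<And>x. norm x \<le> 1 \<Longrightarrow> norm (P x) \<le> c"
  shows "norm (P x) \<le> c * norm x ^ n"
proof (cases "x = 0")
  case True
  then show ?thesis using hom_poly_zero[OF P] n by (simp add: power_0_left)
next
  case False
  define r :: 'k where "r = of_real (1 / norm x)"
  have r: "norm r = 1 / norm x" by (simp add: r_def norm_divide)
  have "norm (P (sE r x)) \<le> c" using False r by (intro assms) (simp add: E.norm_scale)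
  then have "(1 / norm x) ^ n * norm (P x) \<le> c"
    by (simp add: hom_poly_scale[OF P] F.norm_scale norm_power r)
  then show ?thesis using False by (simp add: power_divide divide_le_eq)
qed

text \<open>Continuity at 0 bounds \<open>P\<close> on a small ball and homogeneity spreads the
  bound to the unit ball. This makes the supremum in \<open>poly_norm\<close> a genuine one.\<close>

lemma hom_poly_bdd:
  assumes P: "P \<in> Pn" shows "bdd_above ((\<lambda>x. norm (P x)) ` cball 0 1)"
proof -
  have "isCont P 0" using P by (simp add: hom_polys_def continuous_on_eq_continuous_at)
  then obtain d where d: "0 < d" "\<And>x. norm x < d \<Longrightarrow> norm (P x) < 1"
    using hom_poly_zero[OF P] by (auto simp: continuous_at_eps_delta dist_norm dest!: spec[of _ "1 :: real"])
  define r :: 'k where "r = of_real (d / 2)"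
  have r: "norm r = d / 2" using d(1) unfolding r_def norm_of_real by simp
  have "norm (P x) \<le> (2 / d) ^ n" if "norm x \<le> 1" for x
  proof -
    have "norm (sE r x) < d"
      using mult_left_mono[OF that, of "d / 2"] d(1) by (simp add: E.norm_scale r)
    then have "(d / 2) ^ n * norm (P x) \<le> 1"
      using d(2)[of "sE r x"] by (simp add: hom_poly_scale[OF P] F.norm_scale norm_power r)
    then show ?thesis using d(1) by (simp add: power_divide field_simps)
  qed
  then show ?thesis by (auto intro!: bdd_aboveI[of _ "(2 / d) ^ n"])
qed

lemma poly_norm_ge: "P \<in> Pn \<Longrightarrow> norm x \<le> 1 \<Longrightarrow> norm (P x) \<le> poly_norm P"
  unfolding poly_norm_def by (rule cSUP_upper[OF _ hom_poly_bdd]) auto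

lemma poly_norm_apply: "P \<in> Pn \<Longrightarrow> norm (P x) \<le> poly_norm P * norm x ^ n"
  by (rule hom_poly_norm_le) (auto intro: poly_norm_ge)

lemma poly_norm_nonneg: "P \<in> Pn \<Longrightarrow> 0 \<le> poly_norm P"
  using poly_norm_ge[of P 0] by (auto intro: order_trans[OF norm_ge_zero])

lemma normed_space_hom_polys: "normed_space_on (fun_scale sF) Pn poly_norm"
proof -
  interpret vector_space "fun_scale sF :: 'k \<Rightarrow> ('e \<Rightarrow> 'f) \<Rightarrow> _"
    by (rule vector_space_fun_scale) (rule F.vector_space_axioms)
  have add: "P + Q \<in> Pn" if "P \<in> Pn" "Q \<in> Pn" for P Q
  proof -
    obtain A where A: "multilinear_map n sE sF A" "\<And>x. P x = A (replicate n x)"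
      using \<open>P \<in> Pn\<close> by (auto simp: hom_polys_def)
    obtain B where B: "multilinear_map n sE sF B" "\<And>x. Q x = B (replicate n x)"
      using \<open>Q \<in> Pn\<close> by (auto simp: hom_polys_def)
    have "multilinear_map n sE sF (\<lambda>xs. A xs + B xs)"
      using A(1) B(1) by (simp add: multilinear_map_def Vector_Spaces.linear_iff F.scale_right_distrib)
    moreover have "continuous_on UNIV (P + Q)"
      unfolding plus_fun_def using that by (intro continuous_on_add) (auto simp: hom_polys_def)
    ultimately show ?thesis
      using A(2) B(2) unfolding hom_polys_def by (intro CollectI conjI exI[of _ "\<lambda>xs. A xs + B xs"]) simp_all
  qed
  have scale: "fun_scale sF c P \<in> Pn" if "P \<in> Pn" for c P
  proof -
    obtain A where A: "multilinear_map n sE sF A" "\<And>x. P x = A (replicate n x)"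
      using \<open>P \<in> Pn\<close> by (auto simp: hom_polys_def)
    have "multilinear_map n sE sF (\<lambda>xs. sF c (A xs))"
      using A(1) by (simp add: multilinear_map_def Vector_Spaces.linear_iff F.scale_right_distrib mult.commute)
    moreover have "continuous_on UNIV (fun_scale sF c P)"
      unfolding fun_scale_def using that
      by (intro continuous_on_compose2[OF scaling_continuous[OF sF]]) (auto simp: hom_polys_def)
    ultimately show ?thesis
      using A(2) unfolding hom_polys_def
      by (intro CollectI conjI exI[of _ "\<lambda>xs. sF c (A xs)"]) (simp_all add: fun_scale_def)
  qed
  have "0 \<in> Pn"
    by (auto simp: hom_polys_def multilinear_map_def Vector_Spaces.linear_iff zero_fun_def
        E.vector_space_axioms F.vector_space_axioms intro!: exI[of _ "\<lambda>_. 0"])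
  then have sub: "subspace Pn" unfolding subspace_def using add scale by blast
  show ?thesis
  proof unfold_locales
    show "subspace Pn" by (rule sub)
    show "0 \<le> poly_norm P" if "P \<in> Pn" for P using that by (rule poly_norm_nonneg)
    show "poly_norm P = 0 \<longleftrightarrow> P = 0" if "P \<in> Pn" for P
    proof
      assume "poly_norm P = 0"
      then show "P = 0" using poly_norm_apply[OF that] by (auto simp: fun_eq_iff)
    next
      assume "P = 0"
      then have "poly_norm P \<le> 0" by (intro poly_norm_le) simp
      then show "poly_norm P = 0" using poly_norm_nonneg[OF that] by simp
    qed
    show "poly_norm (P + Q) \<le> poly_norm P + poly_norm Q" if "P \<in> Pn" "Q \<in> Pn" for P Q
      using that by (intro poly_norm_le)
        (auto intro!: order_trans[OF norm_triangle_ineq] add_mono poly_norm_ge)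
    have le: "poly_norm (fun_scale sF c P) \<le> norm c * poly_norm P" if "P \<in> Pn" for P c
      using that by (intro poly_norm_le) (simp add: fun_scale_def F.norm_scale mult_left_mono poly_norm_ge)
    show "poly_norm (fun_scale sF c P) = norm c * poly_norm P" if P: "P \<in> Pn" for P c
    proof (cases "c = 0")
      case True
      then show ?thesis using le[OF P, of c] poly_norm_nonneg[OF scale[OF P, of c]] by simp
    next
      case False
      \<comment> \<open>The inequality \<open>le\<close>, applied to the scaled polynomial and
        \<open>inverse c\<close>, gives the reverse estimate.\<close>
      then have "poly_norm P \<le> norm (inverse c) * poly_norm (fun_scale sF c P)"
        using le[OF scale[OF P, of c], of "inverse c"] by simp
      then have "norm c * poly_norm P \<le> poly_norm (fun_scale sF c P)"
        using False by (simp add: norm_inverse norm_divide field_simps)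
      then show ?thesis using le[OF P, of c] by simp
    qed
  qed
qed

interpretation P: normed_space_on "fun_scale sF :: 'k \<Rightarrow> ('e \<Rightarrow> 'f) \<Rightarrow> _" Pn poly_norm
  by (rule normed_space_hom_polys)

text \<open>By homogeneity, convergence in \<open>poly_norm\<close> is uniform on every ball, so
  weak continuity on bounded sets survives the limit.\<close>

lemma closed_subspace_wc_hom_polys:
  "closed_subspace_on (fun_scale sF) Pn poly_norm (wc_hom_polys n sE sF)"
  unfolding closed_subspace_on_def
proof (intro conjI allI impI)
  show "wc_hom_polys n sE sF \<subseteq> Pn" by (auto simp: wc_hom_polys_def)
  have lim: "weakly_continuous_on_bounded sE P \<longleftrightarrow> (\<forall>F B x. bounded B \<longrightarrow> eventually (\<lambda>y. y \<in> B) F \<longrightarrow>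
    weakly_tendsto sE (\<lambda>y. y) x F \<longrightarrow> (P \<longlongrightarrow> P x) F)" for P :: "'e \<Rightarrow> 'f"
    unfolding weakly_continuous_on_bounded_def by (simp add: tendsto_norm_zero_iff LIM_zero_iff)
  show "P.subspace (wc_hom_polys n sE sF)"
    unfolding P.subspace_def
  proof (intro conjI ballI allI)
    show "0 \<in> wc_hom_polys n sE sF"
      using P.X_closed(1) by (auto simp: wc_hom_polys_def lim zero_fun_def)
    show "P + Q \<in> wc_hom_polys n sE sF" if "P \<in> wc_hom_polys n sE sF" "Q \<in> wc_hom_polys n sE sF" for P Q
      using that P.X_closed(2)[of P Q] by (auto simp: wc_hom_polys_def lim plus_fun_def intro!: tendsto_add)
    show "fun_scale sF c P \<in> wc_hom_polys n sE sF" if "P \<in> wc_hom_polys n sE sF" for c P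
      using that P.X_closed(3)[of P c] scaling_continuous[OF sF, of c]
      by (auto simp: wc_hom_polys_def lim fun_scale_def continuous_on_eq_continuous_at intro: isCont_tendsto_compose)
  qed
  fix u :: "nat \<Rightarrow> 'e \<Rightarrow> 'f" and P
  assume u: "\<forall>i. u i \<in> wc_hom_polys n sE sF" and P: "P \<in> Pn" and conv: "(\<lambda>i. poly_norm (u i - P)) \<longlonglongrightarrow> 0"
  have "weakly_continuous_on_bounded sE P"
    unfolding lim
  proof (intro allI impI tendstoI)
    fix F B x and r :: real
    assume B: "bounded B" "\<forall>\<^sub>F y in F. y \<in> B" and w: "weakly_tendsto sE (\<lambda>y. y) x F" and r: "0 < r"
    \<comment> \<open>The weak limit \<open>x\<close> need not belong to \<open>B\<close>, so
      \<open>R\<close> has to bound it as well.\<close>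
    obtain R where R: "0 < R" "\<And>y. y \<in> B \<Longrightarrow> norm y \<le> R" "norm x \<le> R"
    proof -
      obtain b where "0 < b" "\<forall>y\<in>B. norm y \<le> b" using B(1) by (auto simp: bounded_pos)
      then show ?thesis by (intro that[of "max b (norm x)"]) auto
    qed
    have "\<forall>\<^sub>F i in sequentially. poly_norm (u i - P) < r / (3 * R ^ n)"
      using conv r R(1) by (intro order_tendstoD) auto
    then obtain i where i: "poly_norm (u i - P) < r / (3 * R ^ n)"
      by (auto simp: eventually_sequentially)
    have ui: "u i \<in> Pn" using u by (auto simp: wc_hom_polys_def)
    have close: "norm (u i y - P y) < r / 3" if "norm y \<le> R" for y
    proof -
      have "norm (u i y - P y) \<le> poly_norm (u i - P) * norm y ^ n"
        using poly_norm_apply[OF P.X_closed(4)[OF ui P]] by simp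
      also have "\<dots> \<le> poly_norm (u i - P) * R ^ n"
        using that P.N_nonneg[OF P.X_closed(4)[OF ui P]] by (intro mult_left_mono power_mono) auto
      also have "\<dots> < r / 3" using i R(1) by (simp add: field_simps)
      finally show ?thesis .
    qed
    have "(u i \<longlongrightarrow> u i x) F" using u B w by (auto simp: wc_hom_polys_def lim)
    then have "\<forall>\<^sub>F y in F. dist (u i y) (u i x) < r / 3" using r by (intro tendstoD) auto
    with B(2) show "\<forall>\<^sub>F y in F. dist (P y) (P x) < r"
    proof eventually_elim
      case (elim y)
      have "norm (u i y - P y) < r / 3" "norm (u i x - P x) < r / 3" using close[of y] close[of x] elim R by blast+
      moreover have "norm (P y - P x) = norm ((u i y - u i x) - ((u i y - P y) - (u i x - P x)))" by simp
      ultimately show ?case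
        using elim norm_triangle_ineq4[of "u i y - u i x" "(u i y - P y) - (u i x - P x)"]
          norm_triangle_ineq4[of "u i y - P y" "u i x - P x"] unfolding dist_norm by linarith
    qed
  qed
  then show "P \<in> wc_hom_polys n sE sF" using P by (simp add: wc_hom_polys_def)
qed

end


text \<open>The pointwise limit must again come from an \<open>n\<close>-linear map, but the maps
  behind the \<open>u i\<close> are arbitrary and need not converge. Their polarizations are
  canonical, and converge because the \<open>u i\<close> do.\<close>

lemma banach_space_hom_polys:
  fixes sE :: "'k::real_or_complex \<Rightarrow> 'e::real_normed_vector \<Rightarrow> 'e"
    and sF :: "'k \<Rightarrow> 'f::banach \<Rightarrow> 'f"
  assumes sE: "scaling sE" and sF: "scaling sF" and n: "n \<ge> 1"
  shows "banach_space_on (fun_scale sF) (hom_polys n sE sF) poly_norm"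
proof -
  let ?P = "hom_polys n sE sF"
  interpret E: scaling sE by (rule sE)
  interpret F: scaling sF by (rule sF)
  interpret P: normed_space_on "fun_scale sF :: 'k \<Rightarrow> ('e \<Rightarrow> 'f) \<Rightarrow> _" ?P poly_norm
    by (rule normed_space_hom_polys[OF assms])
  show ?thesis
  proof unfold_locales
    fix u :: "nat \<Rightarrow> 'e \<Rightarrow> 'f"
    assume "\<forall>i. u i \<in> ?P" and C: "\<forall>e>0. \<exists>m. \<forall>i\<ge>m. \<forall>j\<ge>m. poly_norm (u i - u j) < e"
    then have u: "u i \<in> ?P" for i by simp
    have C: "\<exists>m. \<forall>i\<ge>m. \<forall>j\<ge>m. \<forall>x. norm (u i x - u j x) \<le> e * norm x ^ n" if e: "0 < e" for e
    proof -
      obtain m where m: "\<And>i j. i \<ge> m \<Longrightarrow> j \<ge> m \<Longrightarrow> poly_norm (u i - u j) < e" using C e by blast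
      have "norm (u i x - u j x) \<le> e * norm x ^ n" if "i \<ge> m" "j \<ge> m" for i j x
        using poly_norm_apply[OF assms P.X_closed(4)[OF u u], of i j x]
          mult_right_mono[OF less_imp_le[OF m[OF that]], of "norm x ^ n"] by simp
      then show ?thesis by blast
    qed
    have "convergent (\<lambda>i. u i x)" for x
    proof (rule Cauchy_convergent, rule CauchyI)
      fix e :: real assume e: "0 < e"
      \<comment> \<open>Adding 1 in the denominator avoids division by zero at \<open>x = 0\<close>
        and makes the final inequality strict.\<close>
      obtain m where m: "\<And>i j. i \<ge> m \<Longrightarrow> j \<ge> m \<Longrightarrow> norm (u i x - u j x) \<le> e / (1 + norm x ^ n) * norm x ^ n"
        using C[of "e / (1 + norm x ^ n)"] e by (auto simp: add_pos_nonneg)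
      have "e / (1 + norm x ^ n) * norm x ^ n < e"
        using e by (simp add: divide_less_eq add_pos_nonneg distrib_left)
      then show "\<exists>m. \<forall>i\<ge>m. \<forall>j\<ge>m. norm (u i x - u j x) < e" using m by (meson le_less_trans)
    qed
    then obtain P where P: "\<And>x. (\<lambda>i. u i x) \<longlonglongrightarrow> P x"
      unfolding convergent_def by metis
    have close: "\<exists>m. \<forall>i\<ge>m. \<forall>x. norm (u i x - P x) \<le> e * norm x ^ n" if e: "0 < e" for e
    proof -
      obtain m where m: "\<And>i j x. i \<ge> m \<Longrightarrow> j \<ge> m \<Longrightarrow> norm (u i x - u j x) \<le> e * norm x ^ n"
        using C[OF e] by blast
      have "norm (u i x - P x) \<le> e * norm x ^ n" if "i \<ge> m" for i x
      proof (rule tendsto_upperbound)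
        show "(\<lambda>j. norm (u i x - u j x)) \<longlonglongrightarrow> norm (u i x - P x)"
          by (intro tendsto_intros P)
        show "\<forall>\<^sub>F j in sequentially. norm (u i x - u j x) \<le> e * norm x ^ n"
          using m that by (auto simp: eventually_sequentially)
      qed simp
      then show ?thesis by blast
    qed
    have "isCont P x" for x
    proof -
      \<comment> \<open>The convergence is uniform on bounded sets only, so continuity at
        \<open>x\<close> is checked in an open ball around 0 that contains \<open>x\<close>.\<close>
      have "uniform_limit (ball 0 (norm x + 1)) u P sequentially"
      proof (rule uniform_limitI)
        fix e :: real assume e: "0 < e"
        let ?e = "e / (2 * (norm x + 1) ^ n)"
        obtain m where m: "\<And>i y. i \<ge> m \<Longrightarrow> norm (u i y - P y) \<le> ?e * norm y ^ n"
          using close[of ?e] e by (auto simp: add_nonneg_pos)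
        have "dist (u i y) (P y) < e" if "i \<ge> m" "y \<in> ball 0 (norm x + 1)" for i y
        proof -
          have "?e * norm y ^ n \<le> ?e * (norm x + 1) ^ n"
            using that e by (intro mult_left_mono power_mono) auto
          also have "\<dots> = e / 2"
            using add_nonneg_pos[OF norm_ge_zero[of x] zero_less_one] by simp
          finally have "norm (u i y - P y) \<le> e / 2" by (rule order_trans[OF m[OF that(1)]])
          then show ?thesis using e by (simp add: dist_norm)
        qed
        then show "\<forall>\<^sub>F i in sequentially. \<forall>y\<in>ball 0 (norm x + 1). dist (u i y) (P y) < e"
          unfolding eventually_sequentially by blast
      qed
      moreover have "\<forall>\<^sub>F i in sequentially. continuous_on (ball 0 (norm x + 1)) (u i)"
        using u by (auto simp: hom_polys_def intro!: always_eventually intro: continuous_on_subset)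
      ultimately have "continuous_on (ball 0 (norm x + 1)) P"
        by (intro uniform_limit_theorem) auto
      then show ?thesis by (simp add: continuous_on_eq_continuous_at)
    qed
    then have cont: "continuous_on UNIV P" by (simp add: continuous_at_imp_continuous_on)
    have pol: "multilinear_map n sE sF (polarization n (u i))"
      "polarization n (u i) (replicate n x) = real (card (onto_maps n)) *\<^sub>R u i x" for i x
    proof -
      obtain A where A: "multilinear_map n sE sF A" "\<And>x. u i x = A (replicate n x)"
        using u[of i] by (auto simp: hom_polys_def)
      show "multilinear_map n sE sF (polarization n (u i))"
        by (rule multilinear_polarization[OF E.vector_space_axioms F.vector_space_axioms A])
      show "polarization n (u i) (replicate n x) = real (card (onto_maps n)) *\<^sub>R u i x"
        by (rule polarization_replicate[OF A])
    qed
    have pol_lim: "(\<lambda>i. polarization n (u i) xs) \<longlonglongrightarrow> polarization n P xs" for xs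
      unfolding polarization_def by (intro tendsto_intros P)
    \<comment> \<open>On the diagonal the polarization is \<open>P\<close> times the number of
      permutations; \<open>c\<close> removes this factor.\<close>
    define c where "c = inverse (real (card (onto_maps n)))"
    define A where "A xs = sF (of_real c) (polarization n P xs)" for xs
    have "multilinear_map n sE sF A"
      unfolding multilinear_map_def Vector_Spaces.linear_iff
    proof (intro allI impI conjI E.vector_space_axioms F.vector_space_axioms)
      fix xs :: "'e list" and i assume xs: "length xs = n" "i < n"
      show "A (xs[i := x + y]) = A (xs[i := x]) + A (xs[i := y])" for x y
      proof -
        have "(\<lambda>j. polarization n (u j) (xs[i := x + y])) \<longlonglongrightarrow> polarization n P (xs[i := x]) + polarization n P (xs[i := y])"
          unfolding multilinear_map_add[OF pol(1) xs] by (intro tendsto_add pol_lim)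
        then show ?thesis
          using LIMSEQ_unique[OF pol_lim] by (simp add: A_def F.scale_right_distrib[symmetric])
      qed
      show "A (xs[i := sE k x]) = sF k (A (xs[i := x]))" for k x
      proof -
        have "isCont (sF k) z" for z
          using scaling_continuous[OF sF] by (simp add: continuous_on_eq_continuous_at)
        then have "(\<lambda>j. polarization n (u j) (xs[i := sE k x])) \<longlonglongrightarrow> sF k (polarization n P (xs[i := x]))"
          unfolding multilinear_map_scale[OF pol(1) xs] using pol_lim by (rule isCont_tendsto_compose)
        then show ?thesis
          using LIMSEQ_unique[OF pol_lim] by (simp add: A_def mult.commute)
      qed
    qed
    moreover have "P x = A (replicate n x)" for x
    proof -
      have "(\<lambda>i. polarization n (u i) (replicate n x)) \<longlonglongrightarrow> real (card (onto_maps n)) *\<^sub>R P x"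
        unfolding pol(2) by (intro tendsto_intros P)
      then have "polarization n P (replicate n x) = real (card (onto_maps n)) *\<^sub>R P x"
        using LIMSEQ_unique[OF pol_lim] by blast
      then show ?thesis
        using card_onto_maps[of n] unfolding A_def F.scale_of_real by (simp add: c_def)
    qed
    ultimately have PP: "P \<in> ?P" using cont by (auto simp: hom_polys_def)
    have "(\<lambda>i. poly_norm (u i - P)) \<longlonglongrightarrow> 0"
    proof (rule LIMSEQ_I)
      fix e :: real assume e: "0 < e"
      obtain m where m: "\<And>i x. i \<ge> m \<Longrightarrow> norm (u i x - P x) \<le> e / 2 * norm x ^ n"
        using close[of "e / 2"] e by auto
      have "norm (poly_norm (u i - P) - 0) < e" if "i \<ge> m" for i
      proof -
        have "poly_norm (u i - P) \<le> e / 2"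
        proof (rule poly_norm_le)
          fix x :: 'e assume "norm x \<le> 1"
          then have "e / 2 * norm x ^ n \<le> e / 2 * 1"
            using e by (intro mult_left_mono power_le_one) auto
          then show "norm ((u i - P) x) \<le> e / 2" using m[OF that, of x] by simp
        qed
        then show ?thesis using e P.N_nonneg[OF P.X_closed(4)[OF u PP], of i] by simp
      qed
      then show "\<exists>m. \<forall>i\<ge>m. norm (poly_norm (u i - P) - 0) < e" by blast
    qed
    with PP show "\<exists>x\<in>?P. (\<lambda>i. poly_norm (u i - x)) \<longlonglongrightarrow> 0" by blast
  qed
qed

section \<open>Composition with compact operators\<close>

lemma hom_polys_compose:
  assumes "P \<in> hom_polys n sE sF" "Vector_Spaces.linear sF sG K" "bounded_linear K"
  shows "(\<lambda>x. K (P x)) \<in> hom_polys n sE sG"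
proof -
  obtain A where A: "multilinear_map n sE sF A" "\<And>x. P x = A (replicate n x)"
    using assms(1) by (auto simp: hom_polys_def)
  have "multilinear_map n sE sG (\<lambda>xs. K (A xs))"
    using A(1) assms(2) by (simp add: multilinear_map_def Vector_Spaces.linear_iff)
  moreover have "continuous_on UNIV (\<lambda>x. K (P x))"
    using assms(1) by (intro continuous_on_compose2[OF linear_continuous_on[OF assms(3), of UNIV]])
      (auto simp: hom_polys_def)
  ultimately show ?thesis
    using A(2) unfolding hom_polys_def by (intro CollectI conjI exI[of _ "\<lambda>xs. K (A xs)"]) simp_all
qed

text \<open>On the relatively compact set \<open>K (P B)\<close> the weak topology is the norm topology, and
  \<open>\<psi> \<circ> K \<circ> P\<close> is a scalar polynomial for every functional \<open>\<psi>\<close>.\<close>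

lemma compact_comp_hom_poly:
  fixes sE :: "'k::real_or_complex \<Rightarrow> 'e::real_normed_vector \<Rightarrow> 'e"
    and sF :: "'k \<Rightarrow> 'f::real_normed_vector \<Rightarrow> 'f"
  assumes sE: "scaling sE" and sF: "scaling sF" and n: "n \<ge> 1"
    and wc: "wc_hom_polys n sE ((*) :: 'k \<Rightarrow> _) = hom_polys n sE (*)"
    and K: "K \<in> compact_ops sF" and P: "P \<in> hom_polys n sE sF"
  shows "(\<lambda>x. K (P x)) \<in> wc_hom_polys n sE sF"
proof -
  interpret E: scaling sE by (rule sE)
  interpret F: scaling sF by (rule sF)
  have K_lin: "Vector_Spaces.linear sF sF K" "bounded_linear K"
    and K_comp: "compact (closure (K ` cball 0 1))"
    using K by (auto simp: compact_ops_def bounded_ops_def)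
  have "weakly_continuous_on_bounded sE (\<lambda>x. K (P x))"
    unfolding weakly_continuous_on_bounded_def
  proof (intro allI impI)
    fix F B x assume B: "bounded B" "\<forall>\<^sub>F y in F. y \<in> B" and w: "weakly_tendsto sE (\<lambda>y. y) x F"
    have scalar: "((\<lambda>y. \<psi> (K (P y))) \<longlongrightarrow> \<psi> (K (P x))) F"
      if "Vector_Spaces.linear sF (*) \<psi>" "bounded_linear \<psi>" for \<psi> :: "'f \<Rightarrow> 'k"
    proof -
      have "(\<lambda>y. \<psi> (K (P y))) \<in> hom_polys n sE (*)"
        by (intro hom_polys_compose[OF _ that] hom_polys_compose[OF P K_lin])
      then have "(\<lambda>y. \<psi> (K (P y))) \<in> wc_hom_polys n sE (*)" using wc by simp
      then have "((\<lambda>y. norm (\<psi> (K (P y)) - \<psi> (K (P x)))) \<longlongrightarrow> 0) F"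
        using B w unfolding wc_hom_polys_def weakly_continuous_on_bounded_def by blast
      then show ?thesis by (simp add: tendsto_norm_zero_iff LIM_zero_iff)
    qed
    obtain b where b: "0 < b" "\<And>y. y \<in> B \<Longrightarrow> norm y \<le> b" using B(1) by (auto simp: bounded_pos)
    \<comment> \<open>The summand 1 makes \<open>M\<close> positive, so that \<open>P y\<close> can
      be scaled into the unit ball.\<close>
    define M where "M = poly_norm P * b ^ n + 1"
    have "0 \<le> poly_norm P" using poly_norm_nonneg[OF sE sF n P] .
    then have M: "0 < M" using b(1) by (auto simp: M_def intro: add_nonneg_pos)
    have PM: "norm (P y) \<le> M" if "y \<in> B" for y
    proof -
      have "poly_norm P * norm y ^ n \<le> poly_norm P * b ^ n"
        using b(2)[OF that] \<open>0 \<le> poly_norm P\<close> by (intro mult_left_mono power_mono) auto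
      then show ?thesis using poly_norm_apply[OF sE sF n P, of y] by (simp add: M_def)
    qed
    define C where "C = (\<lambda>z. M *\<^sub>R z) ` closure (K ` cball 0 1)"
    have "compact C" unfolding C_def by (rule compact_scaling[OF K_comp])
    have KC: "K (P y) \<in> C" if "y \<in> B" for y
    proof -
      have "inverse M *\<^sub>R P y \<in> cball 0 1" using PM[OF that] M by (simp add: field_simps)
      then have "K (inverse M *\<^sub>R P y) \<in> closure (K ` cball 0 1)"
        by (intro subsetD[OF closure_subset] imageI)
      moreover have "K (P y) = M *\<^sub>R K (inverse M *\<^sub>R P y)"
        using M K_lin(2) by (simp add: linear_simps)
      ultimately show ?thesis unfolding C_def by (rule image_eqI[rotated])
    qed
    have "\<forall>\<^sub>F y in F. norm (K (P y) - K (P x)) < r" if r: "0 < r" for r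
    proof (rule ccontr)
      assume no: "\<not> ?thesis"
      \<comment> \<open>If the claim fails, the values that stay \<open>r\<close> away from
        \<open>K (P x)\<close> form a proper filter on the compact set \<open>C\<close>. It has a
        cluster point \<open>z\<close>. The scalar limits force \<open>z = K (P x)\<close>, although
        \<open>z\<close> also has distance at least \<open>r\<close> from it.\<close>
      define G where "G = filtermap (\<lambda>y. K (P y)) (inf F (principal {y. r \<le> norm (K (P y) - K (P x))}))"
      have "G \<noteq> bot"
        using no unfolding G_def trivial_limit_def eventually_filtermap eventually_inf_principal
        by (auto simp: not_le elim: eventually_mono)
      moreover have "\<forall>\<^sub>F z in G. z \<in> C"
        using B(2) KC by (auto simp: G_def eventually_filtermap eventually_inf_principal elim!: eventually_mono)
      ultimately obtain z where z: "inf (nhds z) G \<noteq> bot"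
        using \<open>compact C\<close> unfolding compact_filter by blast
      have far: "\<forall>\<^sub>F w in G. r \<le> norm (w - K (P x))"
        by (simp add: G_def eventually_filtermap eventually_inf_principal)
      have "z = K (P x)"
      proof (rule ccontr)
        assume ne: "z \<noteq> K (P x)"
        let ?v = "z - K (P x)"
        obtain \<psi> where psi: "linear_map_on sF (*) UNIV \<psi>" "\<And>x. norm (\<psi> x) \<le> norm x" "\<psi> ?v = of_real (norm ?v)"
          using hahn_banach_separation[OF F.vector_space_axioms, of UNIV "{0}" norm ?v "norm ?v"] ne
          by (auto simp: F.norm_scale norm_triangle_ineq F.subspace_UNIV F.subspace_0)
        have psi_lin: "Vector_Spaces.linear sF (*) \<psi>" "bounded_linear \<psi>"
          using linear_bounded_linearI[OF sF scaling_mult, of \<psi> 1] psi by (auto simp: linear_map_on_def)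
        have "(\<psi> \<longlongrightarrow> \<psi> (K (P x))) G"
          unfolding G_def filterlim_filtermap
          by (rule tendsto_mono[OF inf_le1 scalar[OF psi_lin]])
        then have "(\<psi> \<longlongrightarrow> \<psi> (K (P x))) (inf (nhds z) G)" by (rule tendsto_mono[OF inf_le2])
        moreover have "(\<psi> \<longlongrightarrow> \<psi> z) (inf (nhds z) G)"
          by (rule tendsto_mono[OF inf_le1])
            (use linear_continuous_at[OF psi_lin(2), of z] in \<open>simp add: isCont_def tendsto_at_iff_tendsto_nhds\<close>)
        ultimately have "\<psi> z = \<psi> (K (P x))" using tendsto_unique[OF z] by blast
        then have "\<psi> ?v = 0" using psi_lin(2) by (simp add: linear_simps)
        then show False using psi(3) ne by simp
      qed
      have "\<forall>\<^sub>F w in nhds z. dist w z < r" using r eventually_nhds_metric by blast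
      then have "\<forall>\<^sub>F w in inf (nhds z) G. dist w z < r" by (rule filter_leD[OF inf_le1])
      moreover have "\<forall>\<^sub>F w in inf (nhds z) G. r \<le> norm (w - K (P x))" by (rule filter_leD[OF inf_le2 far])
      ultimately have "\<forall>\<^sub>F w in inf (nhds z) G. False"
        by eventually_elim (simp add: \<open>z = K (P x)\<close> dist_norm)
      then show False using z by (simp add: trivial_limit_def)
    qed
    then show "((\<lambda>y. norm (K (P y) - K (P x))) \<longlongrightarrow> 0) F"
      by (intro tendstoI) (simp add: dist_norm)
  qed
  then show ?thesis
    using hom_polys_compose[OF P K_lin] by (simp add: wc_hom_polys_def)
qed

lemma critical_degreeD:
  fixes s :: "'k::real_or_complex \<Rightarrow> 'e::real_normed_vector \<Rightarrow> 'e"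
  assumes "enat n < critical_degree s" "n \<ge> 1"
  shows "wc_hom_polys n s ((*) :: 'k \<Rightarrow> _) = hom_polys n s (*)"
proof (rule ccontr)
  assume ne: "\<not> ?thesis"
  then have "critical_degree s \<le> enat n"
    using assms(2) by (auto simp: critical_degree_def intro: Least_le)
  with assms(1) show False by simp
qed

theorem proposition2p9:
  fixes sE :: "'k::real_or_complex \<Rightarrow> 'e::banach \<Rightarrow> 'e"
    and sF :: "'k \<Rightarrow> 'f::banach \<Rightarrow> 'f"
    and n :: nat
  assumes "scaling sE" and "scaling sF"
    and "M_infinity_space sF"
    and "n \<ge> 1"
    and "enat n < critical_degree sE"
  shows "M_ideal (fun_scale sF) (hom_polys n sE sF) poly_norm (wc_hom_polys n sE sF)"
proof -
  note sc = assms(1,2,4)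
  interpret F: scaling sF by (rule assms(2))
  have wc: "wc_hom_polys n sE ((*) :: 'k \<Rightarrow> _) = hom_polys n sE (*)"
    by (rule critical_degreeD[OF assms(5,4)])
  \<comment> \<open>An index is a set of vectors to be almost fixed together with a number that
    controls the error. The successor keeps \<open>e\<close> defined at 0 and at most 1
    throughout.\<close>
  define e where "e i = 1 / real (Suc (snd i))" for i :: "'f set \<times> nat"
  have "\<exists>K. K \<in> compact_ops sF \<and> (\<forall>x y. norm (K x + (y - K y)) \<le> (1 + e i) * max (norm x) (norm y)) \<and>
      (finite (fst i) \<longrightarrow> (\<forall>y\<in>fst i. norm (K y - y) \<le> e i))" for i
  proof -
    \<comment> \<open>The index type also contains infinite sets; the empty set replaces them so
      that an operator exists at every index.\<close>
    have "finite (if finite (fst i) then fst i else {})" "0 < e i" by (auto simp: e_def)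
    from M_infinity_approx[OF assms(2) assms(3)[unfolded M_infinity_space_def] this]
    show ?thesis by (metis (full_types))
  qed
  then have "\<exists>K. \<forall>i. K i \<in> compact_ops sF \<and>
      (\<forall>x y. norm (K i x + (y - K i y)) \<le> (1 + e i) * max (norm x) (norm y)) \<and>
      (finite (fst i) \<longrightarrow> (\<forall>y\<in>fst i. norm (K i y - y) \<le> e i))"
    by (intro choice allI)
  then obtain K where K: "\<And>i. K i \<in> compact_ops sF"
    "\<And>i x y. norm (K i x + (y - K i y)) \<le> (1 + e i) * max (norm x) (norm y)"
    "\<And>i y. finite (fst i) \<Longrightarrow> y \<in> fst i \<Longrightarrow> norm (K i y - y) \<le> e i"
    by blast
  have K_op: "K i \<in> bounded_ops sF" for i using K(1)[of i] by (simp add: compact_ops_def)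
  have K_add: "K i (x + y) = K i x + K i y" and K_scale: "K i (sF c x) = sF c (K i x)" for i x y c
    by (rule bounded_ops_add[OF K_op], rule bounded_ops_scale[OF K_op])
  have K_diff: "K i (x - y) = K i x - K i y" for i x y using K_add[of i "x - y" y] by simp
  have K_0: "K i 0 = 0" for i using K_diff[of i 0 0] by simp
  \<comment> \<open>Along this filter the set eventually contains any prescribed finite set of
    vectors, while the error bound tends to 0.\<close>
  let ?F = "finite_subsets_at_top (UNIV :: 'f set) \<times>\<^sub>F (sequentially :: nat filter)"
  show ?thesis
  proof (rule M_ideal_from_net[where F = ?F and T = "\<lambda>i P x. K i (P x)" and e = e])
    show "banach_space_on (fun_scale sF) (hom_polys n sE sF) poly_norm"
      by (rule banach_space_hom_polys[OF sc])
    show "closed_subspace_on (fun_scale sF) (hom_polys n sE sF) poly_norm (wc_hom_polys n sE sF)"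
      by (rule closed_subspace_wc_hom_polys[OF sc])
    show "?F \<noteq> bot" by (simp add: prod_filter_eq_bot)
    show "linear_map_on (fun_scale sF) (fun_scale sF) (hom_polys n sE sF) (\<lambda>P x. K i (P x))" for i
      by (auto simp: linear_map_on_def fun_scale_def K_add K_scale)
    show "(\<lambda>x. K i (P x)) \<in> wc_hom_polys n sE sF" if "P \<in> hom_polys n sE sF" for i P
      by (rule compact_comp_hom_poly[OF sc wc K(1) that])
    show "poly_norm ((\<lambda>x. K i (P x)) + (Q - (\<lambda>x. K i (Q x)))) \<le> 1 + e i"
      if "P \<in> hom_polys n sE sF" "Q \<in> hom_polys n sE sF" "poly_norm P \<le> 1" "poly_norm Q \<le> 1" for i P Q
    proof (rule poly_norm_le)
      fix x :: 'e assume x: "norm x \<le> 1"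
      have "norm (P x) \<le> 1" "norm (Q x) \<le> 1"
        using poly_norm_ge[OF sc that(1) x] poly_norm_ge[OF sc that(2) x] that by auto
      then have "(1 + e i) * max (norm (P x)) (norm (Q x)) \<le> (1 + e i) * 1"
        by (intro mult_left_mono) (auto simp: e_def)
      with K(2)[of i "P x" "Q x"]
      show "norm (((\<lambda>x. K i (P x)) + (Q - (\<lambda>x. K i (Q x)))) x) \<le> 1 + e i" by simp
    qed
    have e_small: "\<forall>\<^sub>F i in ?F. e i < r" if "0 < r" for r
    proof -
      have "\<forall>\<^sub>F m in sequentially. 1 / real (Suc m) < r"
        using LIMSEQ_Suc[OF lim_1_over_n] that by (rule order_tendstoD)
      then have "\<forall>\<^sub>F (Y, m) in ?F. 1 / real (Suc m) < r" by (subst eventually_prod2) auto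
      then show ?thesis by (simp add: e_def case_prod_unfold)
    qed
    show "(e \<longlongrightarrow> 0) ?F"
      by (rule tendstoI) (use e_small in \<open>simp add: e_def\<close>)
    show "((\<lambda>i. poly_norm ((\<lambda>x. K i (P x)) - P)) \<longlongrightarrow> 0) ?F" if P: "P \<in> wc_hom_polys n sE sF" for P
    proof (rule tendstoI)
      fix r :: real assume r: "0 < r"
      \<comment> \<open>Since the \<open>K i\<close> have norm at most 2, passing from
        \<open>P x\<close> to \<open>P c\<close> and back costs \<open>2 * r / 8 + r / 8\<close>.
        The error at \<open>P c\<close> adds \<open>r / 8\<close>, so the total is
        \<open>r / 2\<close>.\<close>
      obtain C where C: "finite C" "\<And>x. norm x \<le> 1 \<Longrightarrow> \<exists>c\<in>C. norm (P x - P c) < r / 8"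
        using wc_hom_poly_totally_bounded[OF P, of "r / 8"] r by auto
      have "\<forall>\<^sub>F Y in finite_subsets_at_top UNIV. finite Y \<and> P ` C \<subseteq> Y"
        using C(1) by (auto simp: eventually_finite_subsets_at_top intro!: exI[of _ "P ` C"])
      then have "\<forall>\<^sub>F (Y, m) in ?F. finite Y \<and> P ` C \<subseteq> Y"
        by (subst eventually_prod1) auto
      then have "\<forall>\<^sub>F i in ?F. finite (fst i) \<and> P ` C \<subseteq> fst i" by (simp add: case_prod_unfold)
      moreover have "\<forall>\<^sub>F i in ?F. e i < r / 8" using r by (intro e_small) simp
      ultimately show "\<forall>\<^sub>F i in ?F. dist (poly_norm ((\<lambda>x. K i (P x)) - P)) 0 < r"
      proof eventually_elim
        case (elim i)
        have K2: "norm (K i z) \<le> 2 * norm z" for z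
        proof -
          \<comment> \<open>The two-vector bound at \<open>y = 0\<close> contains a norm bound for
            \<open>K i\<close>.\<close>
          have "norm (K i z) \<le> (1 + e i) * norm z" using K(2)[of i z 0] by (simp add: K_0)
          also have "\<dots> \<le> 2 * norm z" by (intro mult_right_mono) (auto simp: e_def)
          finally show ?thesis .
        qed
        have "poly_norm ((\<lambda>x. K i (P x)) - P) \<le> r / 2"
        proof (rule poly_norm_le)
          fix x :: 'e assume "norm x \<le> 1"
          then obtain c where c: "c \<in> C" "norm (P x - P c) < r / 8" using C(2) by blast
          have 1: "norm (K i (P x) - K i (P c)) \<le> 2 * norm (P x - P c)"
            using K2[of "P x - P c"] by (simp add: K_diff)
          have 2: "norm (K i (P c) - P c) \<le> e i" using elim c(1) by (intro K(3)) auto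
          have "norm (K i (P x) - P x)
              = norm ((K i (P x) - K i (P c)) + (K i (P c) - P c) - (P x - P c))" by simp
          also have "\<dots> \<le> norm (K i (P x) - K i (P c)) + norm (K i (P c) - P c) + norm (P x - P c)"
            by (rule order_trans[OF norm_triangle_ineq4 add_right_mono[OF norm_triangle_ineq]])
          finally show "norm (((\<lambda>x. K i (P x)) - P) x) \<le> r / 2" using 1 2 c(2) elim by simp
        qed
        moreover have "0 \<le> poly_norm ((\<lambda>x. K i (P x)) - P)"
        proof -
          have "P \<in> hom_polys n sE sF" using P by (simp add: wc_hom_polys_def)
          moreover have "(\<lambda>x. K i (P x)) \<in> hom_polys n sE sF"
            using compact_comp_hom_poly[OF sc wc K(1) calculation] by (simp add: wc_hom_polys_def)
          ultimately show ?thesis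
            using normed_space_on.X_closed(4)[OF normed_space_hom_polys[OF sc]] poly_norm_nonneg[OF sc] by blast
        qed
        ultimately show ?case using r by simp
      qed
    qed
  qed
qed

end
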